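(* Let $\mathcal{A}=M_{n_1}\oplus\cdots\oplus M_{n_d}$, viewed as the block-diagonal subalgebra of $M_m$ with $m=n_1+\cdots+n_d$, and let $\tau$ be a completely positive map on $\mathcal{A}$ with $r(\tau)>0$. Then the canonical extension of the maximal part of $\tau$ equals the maximal part of the canonical extension of $\tau$: $\widetilde{\widehat{\tau}}=\widehat{\widetilde{\tau}}$. Moreover, for any Choi-Kraus decompositions $\widetilde{\tau}(X)=\sum_{i=1}^pA_i^*XA_i$ and $\widetilde{\widehat{\tau}}(X)=\sum_{j=1}^qB_j^*XB_j$ ($X\in M_m$), the vector space $\mathrm{span}\{B_1,\dots,B_q\}$ is a subalgebra of $M_m$ and is a non-zero ideal in the algebra generated by $A_1,\dots,A_p$.
   Context: $r(\tau)$ is the spectral radius. The canonical extension of a map $\sigma$ on $\mathcal{A}$ is $\widetilde{\sigma}=\iota\circ\sigma\circ\phi$, with $\iota:\mathcal{A}\hookrightarrow M_m$ the block-diagonal embedding and $\phi:M_m\to\mathcal{A}$ taking a block matrix to its block-diagonal part. For a positive map $\varphi$ on a finite dimensional $C^*$-algebra with $r(\varphi)>0$, its maximal part is $\widehat{\varphi}=\lim_{N\to\infty}\frac1N\sum_{n=1}^N\varphi^n/\|\varphi^n\|_\beta$, where $\beta$ is a Jordan basis of $\varphi$ and $\|\psi\|_\beta$ is the maximum modulus of the entries of the matrix of $\psi$ in $\beta$ (the limit exists, is independent of $\beta$, and is completely positive when $\varphi$ is). *)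

theory Defs
  imports Complex_Main "Jordan_Normal_Form.Jordan_Normal_Form" "Jordan_Normal_Form.Schur_Decomposition"
begin

definition lincomb :: "nat \<Rightarrow> complex list \<Rightarrow> complex mat list \<Rightarrow> complex mat" where
  "lincomb m cs Xs = foldr (\<lambda>(c,X) acc. c \<cdot>\<^sub>m X + acc) (zip cs Xs) (0\<^sub>m m m)"

definition mspan :: "nat \<Rightarrow> complex mat list \<Rightarrow> complex mat set" where
  "mspan m Xs = {lincomb m cs Xs | cs. length cs = length Xs}"

definition lin_indep :: "nat \<Rightarrow> complex mat list \<Rightarrow> bool" where
  "lin_indep m Xs \<longleftrightarrow> (\<forall>cs. length cs = length Xs \<longrightarrow> lincomb m cs Xs = 0\<^sub>m m m \<longrightarrow> set cs \<subseteq> {0})"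

definition is_basis :: "nat \<Rightarrow> complex mat set \<Rightarrow> complex mat list \<Rightarrow> bool" where
  "is_basis m V \<beta> \<longleftrightarrow> set \<beta> \<subseteq> carrier_mat m m \<and> lin_indep m \<beta> \<and> mspan m \<beta> = V"

definition coords :: "nat \<Rightarrow> complex mat list \<Rightarrow> complex mat \<Rightarrow> complex list" where
  "coords m \<beta> X = (THE cs. length cs = length \<beta> \<and> X = lincomb m cs \<beta>)"

definition map_mat :: "nat \<Rightarrow> complex mat list \<Rightarrow> (complex mat \<Rightarrow> complex mat) \<Rightarrow> complex mat" where
  "map_mat m \<beta> \<psi> = mat (length \<beta>) (length \<beta>) (\<lambda>(i,j). coords m \<beta> (\<psi> (\<beta> ! j)) ! i)"

definition jordan_basis :: "nat \<Rightarrow> complex mat set \<Rightarrow> (complex mat \<Rightarrow> complex mat) \<Rightarrow> complex mat list \<Rightarrow> bool" where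
  "jordan_basis m V \<phi> \<beta> \<longleftrightarrow> is_basis m V \<beta> \<and> (\<exists>n_as. map_mat m \<beta> \<phi> = jordan_matrix n_as)"

definition beta_norm :: "nat \<Rightarrow> complex mat list \<Rightarrow> (complex mat \<Rightarrow> complex mat) \<Rightarrow> real" where
  "beta_norm m \<beta> \<psi> = Max {cmod (map_mat m \<beta> \<psi> $$ (i,j)) | i j. i < length \<beta> \<and> j < length \<beta>}"

text \<open>maximal part of phi on the subspace V of M_m: the (pointwise, entrywise) limit of
  (1/N) sum_{n=1}^N phi^n / norm_beta(phi^n), for every Jordan basis beta of phi;
  values outside V are normalised to 0.\<close>
definition maximal_part :: "nat \<Rightarrow> complex mat set \<Rightarrow> (complex mat \<Rightarrow> complex mat) \<Rightarrow> (complex mat \<Rightarrow> complex mat)" where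
  "maximal_part m V \<phi> = (THE \<psi>.
      (\<forall>X. X \<notin> V \<longrightarrow> \<psi> X = 0\<^sub>m m m) \<and>
      (\<forall>X\<in>V. \<psi> X \<in> carrier_mat m m) \<and>
      (\<forall>\<beta>. jordan_basis m V \<phi> \<beta> \<longrightarrow>
         (\<forall>X\<in>V. \<forall>i<m. \<forall>j<m.
            (\<lambda>N. (\<Sum>n=1..N. ((\<phi>^^n) X $$ (i,j)) / complex_of_real (beta_norm m \<beta> (\<phi>^^n))) / of_nat N)
              \<longlonglongrightarrow> \<psi> X $$ (i,j))))"

definition linear_on :: "nat \<Rightarrow> complex mat set \<Rightarrow> (complex mat \<Rightarrow> complex mat) \<Rightarrow> bool" where
  "linear_on m V \<phi> \<longleftrightarrow> (\<forall>X\<in>V. \<phi> X \<in> V) \<and>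
     (\<forall>X\<in>V. \<forall>Y\<in>V. \<forall>a b. \<phi> (a \<cdot>\<^sub>m X + b \<cdot>\<^sub>m Y) = a \<cdot>\<^sub>m \<phi> X + b \<cdot>\<^sub>m \<phi> Y)"

definition map_spectral_radius :: "complex mat set \<Rightarrow> (complex mat \<Rightarrow> complex mat) \<Rightarrow> real" where
  "map_spectral_radius V \<phi> = Sup {cmod c | c. \<exists>X\<in>V. X \<noteq> 0\<^sub>m (dim_row X) (dim_col X) \<and> \<phi> X = c \<cdot>\<^sub>m X}"

definition block_idx :: "nat list \<Rightarrow> nat \<Rightarrow> nat" where
  "block_idx ns i = (LEAST k. i < sum_list (take (Suc k) ns))"

definition block_alg :: "nat list \<Rightarrow> complex mat set" where
  "block_alg ns = {X \<in> carrier_mat (sum_list ns) (sum_list ns).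
      \<forall>i<sum_list ns. \<forall>j<sum_list ns. block_idx ns i \<noteq> block_idx ns j \<longrightarrow> X $$ (i,j) = 0}"

definition bd_part :: "nat list \<Rightarrow> complex mat \<Rightarrow> complex mat" where
  "bd_part ns X = mat (sum_list ns) (sum_list ns)
      (\<lambda>(i,j). if block_idx ns i = block_idx ns j then X $$ (i,j) else 0)"

text \<open>canonical extension iota o sigma o phi (iota is the inclusion)\<close>
definition can_ext :: "nat list \<Rightarrow> (complex mat \<Rightarrow> complex mat) \<Rightarrow> (complex mat \<Rightarrow> complex mat)" where
  "can_ext ns \<sigma> = (\<lambda>X. \<sigma> (bd_part ns X))"

definition psd :: "nat \<Rightarrow> complex mat \<Rightarrow> bool" where
  "psd n Y \<longleftrightarrow> Y \<in> carrier_mat n n \<and>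
     (\<forall>v\<in>carrier_vec n. (Y *\<^sub>v v) \<bullet> conjugate v \<in> \<real> \<and> 0 \<le> Re ((Y *\<^sub>v v) \<bullet> conjugate v))"

definition blk :: "nat \<Rightarrow> complex mat \<Rightarrow> nat \<Rightarrow> nat \<Rightarrow> complex mat" where
  "blk m Y a b = mat m m (\<lambda>(i,j). Y $$ (a*m + i, b*m + j))"

definition amplify :: "nat \<Rightarrow> nat \<Rightarrow> (complex mat \<Rightarrow> complex mat) \<Rightarrow> complex mat \<Rightarrow> complex mat" where
  "amplify m k \<sigma> Y = mat (k*m) (k*m) (\<lambda>(i,j). \<sigma> (blk m Y (i div m) (j div m)) $$ (i mod m, j mod m))"

definition completely_positive_on :: "nat \<Rightarrow> complex mat set \<Rightarrow> (complex mat \<Rightarrow> complex mat) \<Rightarrow> bool" where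
  "completely_positive_on m V \<sigma> \<longleftrightarrow> linear_on m V \<sigma> \<and>
     (\<forall>k>0. \<forall>Y. Y \<in> carrier_mat (k*m) (k*m) \<and> (\<forall>a<k. \<forall>b<k. blk m Y a b \<in> V) \<and> psd (k*m) Y
              \<longrightarrow> psd (k*m) (amplify m k \<sigma> Y))"

definition kraus_sum :: "nat \<Rightarrow> complex mat list \<Rightarrow> complex mat \<Rightarrow> complex mat" where
  "kraus_sum m As X = foldr (\<lambda>A acc. mat_adjoint A * X * A + acc) As (0\<^sub>m m m)"

definition is_kraus :: "nat \<Rightarrow> (complex mat \<Rightarrow> complex mat) \<Rightarrow> complex mat list \<Rightarrow> bool" where
  "is_kraus m \<sigma> As \<longleftrightarrow> set As \<subseteq> carrier_mat m m \<and> (\<forall>X\<in>carrier_mat m m. \<sigma> X = kraus_sum m As X)"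

text \<open>(not necessarily unital) subalgebra of \<open>M_m\<close>\<close>
definition subalg :: "nat \<Rightarrow> complex mat set \<Rightarrow> bool" where
  "subalg m S \<longleftrightarrow> S \<subseteq> carrier_mat m m \<and> 0\<^sub>m m m \<in> S \<and>
     (\<forall>X\<in>S. \<forall>Y\<in>S. X + Y \<in> S \<and> X * Y \<in> S) \<and> (\<forall>c. \<forall>X\<in>S. c \<cdot>\<^sub>m X \<in> S)"

definition gen_alg :: "nat \<Rightarrow> complex mat list \<Rightarrow> complex mat set" where
  "gen_alg m As = \<Inter> {S. subalg m S \<and> set As \<subseteq> S}"

definition is_ideal :: "nat \<Rightarrow> complex mat set \<Rightarrow> complex mat set \<Rightarrow> bool" where
  "is_ideal m I S \<longleftrightarrow> I \<subseteq> S \<and> 0\<^sub>m m m \<in> I \<and>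
     (\<forall>X\<in>I. \<forall>Y\<in>I. X + Y \<in> I) \<and> (\<forall>c. \<forall>X\<in>I. c \<cdot>\<^sub>m X \<in> I) \<and>
     (\<forall>A\<in>S. \<forall>B\<in>I. A * B \<in> I \<and> B * A \<in> I)"

end

theory Submission
  imports Defs "Jordan_Normal_Form.Jordan_Normal_Form_Existence"
    "Jordan_Normal_Form.Jordan_Normal_Form_Uniqueness" "Jordan_Normal_Form.Spectral_Radius"
begin

text \<open>
  In Jordan coordinates the entries of \<open>\<phi>\<^sup>n\<close> are \<open>(n choose k) * a ^ (n - k)\<close>, and
  \<open>\<parallel>\<phi>\<^sup>n\<parallel>\<close> is eventually the largest of their moduli, with \<open>\<bar>a\<bar> = r\<close> maximal and then \<open>k\<close> maximal.
  After normalisation every entry tends to 0 or is eventually a unimodular geometric sequence,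
  so the Cesaro means converge; the norm does not depend on the Jordan basis because the set of
  Jordan blocks is unique. Passing to the canonical extension adds only zero blocks of size 1, which
  do not affect the norm of the powers, whence the first claim.

  For a map \<open>F\<close> with Kraus operators \<open>A\<^sub>i\<close>, the quadratic form of the Choi matrix at \<open>v\<close> is the sum
  of the \<open>\<bar>\<langle>A\<^sub>i, v\<rangle>\<bar>\<^sup>2\<close>; it vanishes exactly when \<open>v\<close> is orthogonal to all \<open>A\<^sub>i\<close>, so it determines
  \<open>span {A\<^sub>i}\<close>. Let \<open>T\<close> be the extended map and \<open>\<psi>\<close> its maximal part. The Kraus operators of \<open>T\<^sup>n\<close>
  are words in those of \<open>T\<close>, so in the limit those of \<open>\<psi>\<close> lie in the generated algebra. Since
  \<open>\<parallel>T\<^sup>n\<^sup>+\<^sup>1\<parallel> \<le> K \<parallel>T\<^sup>n\<parallel>\<close>, the forms of \<open>T \<circ> \<psi> = \<psi> \<circ> T\<close> are at most \<open>K\<close> times the form of \<open>\<psi>\<close>, so the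
  products \<open>B\<^sub>j A\<^sub>i\<close> and \<open>A\<^sub>i B\<^sub>j\<close> stay in \<open>span {B\<^sub>j}\<close>. Finally \<open>\<psi> \<noteq> 0\<close> because
  \<open>\<parallel>T\<^sup>n\<parallel>\<close> is bounded by a multiple of the trace of the Choi matrix of \<open>T\<^sup>n\<close>, which depends linearly on the map.
\<close>

section \<open>Cesaro means of normalised Jordan entries\<close>

text \<open>The entries of the \<open>n\<close>-th power of a Jordan block with eigenvalue \<open>a\<close> on the \<open>k\<close>-th superdiagonal.\<close>

definition jterm :: "nat \<Rightarrow> complex \<Rightarrow> nat \<Rightarrow> complex" where
  "jterm k a n = of_nat (n choose k) * a ^ (n - k)"

text \<open>The inserted 0 gives \<open>Max\<close> a value for empty \<open>E\<close> and stands
  for the zero entries. For the parameters of a nonempty Jordan matrix this is the largest modulus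
  of an entry of its \<open>n\<close>-th power (\<open>Max_jordan_matrix_pow\<close>).\<close>

definition jmax :: "(nat \<times> complex) set \<Rightarrow> nat \<Rightarrow> real" where
  "jmax E n = Max (insert 0 ((\<lambda>(k,a). cmod (jterm k a n)) ` E))"

lemma norm_jterm: "cmod (jterm k a n) = real (n choose k) * cmod a ^ (n - k)"
  by (simp add: jterm_def norm_mult norm_power)

lemma tendsto_zero_comparison:
  fixes f :: "nat \<Rightarrow> 'a :: real_normed_vector" and g :: "nat \<Rightarrow> real"
  assumes "eventually (\<lambda>n. norm (f n) \<le> g n) sequentially" "g \<longlonglongrightarrow> 0"
  shows "f \<longlonglongrightarrow> 0"
  by (rule tendsto_0_le[OF assms(2), of _ 1], rule eventually_mono[OF assms(1)]) auto

lemma cesaro_zero: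
  fixes u :: "nat \<Rightarrow> 'a :: real_normed_field"
  assumes "u \<longlonglongrightarrow> 0"
  shows "(\<lambda>N. (\<Sum>n=1..N. u n) / of_nat N) \<longlonglongrightarrow> 0"
proof (rule LIMSEQ_I)
  fix e :: real assume e: "0 < e"
  from LIMSEQ_D[OF assms, of "e/2"] e obtain n0 where n0: "\<And>n. n \<ge> n0 \<Longrightarrow> norm (u n) < e/2" by auto
  define C where "C = (\<Sum>n=1..n0. norm (u n))"
  \<comment> \<open>Past \<open>n1\<close> the fixed initial sum \<open>C\<close> contributes less
    than \<open>e/2\<close> to the mean.\<close>
  obtain n1 :: nat where n1: "2 * C / e < real n1" using reals_Archimedean2 by blast
  have C0: "C \<ge> 0" unfolding C_def by (intro sum_nonneg) auto
  show "\<exists>no. \<forall>N\<ge>no. norm ((\<Sum>n=1..N. u n) / of_nat N - 0) < e"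
  proof (intro exI allI impI)
    fix N assume N: "N \<ge> Suc (max n0 n1)"
    have "norm (\<Sum>n=1..N. u n) \<le> (\<Sum>n=1..N. norm (u n))" by (rule norm_sum)
    also have "\<dots> \<le> (\<Sum>n=1..N. (if n \<le> n0 then norm (u n) else 0) + e/2)"
      by (rule sum_mono) (use n0 e in \<open>auto simp: less_imp_le\<close>)
    also have "\<dots> = (\<Sum>n=1..N. (if n \<le> n0 then norm (u n) else 0)) + N * (e/2)"
      by (simp add: sum.distrib)
    also have "(\<Sum>n=1..N. (if n \<le> n0 then norm (u n) else 0)) = C"
      unfolding C_def by (rule sum.mono_neutral_cong_right) (use N in auto)
    finally have 1: "norm (\<Sum>n=1..N. u n) \<le> C + N * (e/2)" .
    have "2 * C / e < real N" using n1 N by linarith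
    hence "C < N * (e/2)" using e by (simp add: field_simps)
    with 1 have "norm (\<Sum>n=1..N. u n) < N * e" by (simp add: field_simps)
    thus "norm ((\<Sum>n=1..N. u n) / of_nat N - 0) < e" using N by (simp add: norm_divide field_simps)
  qed
qed

lemma cesaro_cong:
  fixes u h :: "nat \<Rightarrow> 'a :: real_normed_field"
  assumes "(\<lambda>n. u n - h n) \<longlonglongrightarrow> 0" "(\<lambda>N. (\<Sum>n=1..N. h n) / of_nat N) \<longlonglongrightarrow> l"
  shows "(\<lambda>N. (\<Sum>n=1..N. u n) / of_nat N) \<longlonglongrightarrow> l"
  using tendsto_add[OF cesaro_zero[OF assms(1)] assms(2)]
  by (simp add: sum_subtractf diff_divide_distrib)

text \<open>For \<open>w \<noteq> 1\<close> the sums telescope against \<open>1 - w\<close>, hence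
  stay bounded by \<open>2 / cmod (1 - w)\<close>, and the means tend to 0; for \<open>w = 1\<close>
  they tend to 1.\<close>

lemma cesaro_geometric:
  fixes w :: complex
  assumes "cmod w = 1"
  shows "\<exists>l. (\<lambda>N. (\<Sum>n=1..N. w ^ n) / of_nat N) \<longlonglongrightarrow> l"
proof (cases "w = 1")
  case True
  have "(\<lambda>N. (\<Sum>n=1..N. w ^ n) / of_nat N) \<longlonglongrightarrow> 1"
    \<comment> \<open>The mean equals 1 only from \<open>N = 1\<close> on; at \<open>N = 0\<close>
      it is 0 by the convention for division by 0.\<close>
    by (rule tendsto_eventually) (auto simp: True eventually_sequentially intro!: exI[of _ 1])
  thus ?thesis by blast
next
  case False
  have "(\<lambda>N. (\<Sum>n=1..N. w ^ n) / of_nat N) \<longlonglongrightarrow> 0"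
  proof (rule tendsto_zero_comparison)
    have "cmod (\<Sum>n=1..N. w ^ n) \<le> 2 / cmod (1 - w)" for N
    proof -
      have "(1 - w) * (\<Sum>n=1..N. w ^ n) = w - w ^ Suc N"
      proof (induction N)
        case (Suc N)
        have "(1 - w) * (\<Sum>n=1..Suc N. w ^ n) = (1 - w) * (\<Sum>n=1..N. w ^ n) + (1 - w) * w ^ Suc N"
          by (simp add: distrib_left)
        also have "\<dots> = w - w ^ Suc (Suc N)" unfolding Suc by (simp add: algebra_simps)
        finally show ?case .
      qed simp
      hence "(\<Sum>n=1..N. w ^ n) = (w - w ^ Suc N) / (1 - w)" using False by (simp add: field_simps)
      moreover have "cmod (w - w ^ Suc N) \<le> cmod w + cmod (w ^ Suc N)" by (rule norm_triangle_ineq4)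
      ultimately show ?thesis using assms by (simp add: norm_divide norm_power norm_mult divide_right_mono)
    qed
    hence "cmod ((\<Sum>n=1..N. w ^ n) / of_nat N) \<le> 2 / cmod (1 - w) / real N" for N
      unfolding norm_divide norm_of_nat by (intro divide_right_mono) auto
    thus "eventually (\<lambda>N. cmod ((\<Sum>n=1..N. w ^ n) / of_nat N) \<le> 2 / cmod (1 - w) / real N) sequentially"
      by simp
    show "(\<lambda>N. 2 / cmod (1 - w) / real N) \<longlonglongrightarrow> 0"
      by (rule lim_const_over_n)
  qed
  thus ?thesis by blast
qed

text \<open>With \<open>p\<close> the root of \<open>q\<close> of order \<open>k + 1\<close>,
  \<open>n ^ (k+1) * q ^ n\<close> is the \<open>(k+1)\<close>-st power of \<open>n * p ^ n\<close>,
  which reduces everything to the linear case.\<close>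

lemma power_times_geometric_tendsto_0:
  fixes q :: real
  assumes "0 \<le> q" "q < 1"
  shows "(\<lambda>n. real n ^ k * q ^ n) \<longlonglongrightarrow> 0"
proof (rule tendsto_zero_comparison)
  define p where "p = root (Suc k) q"
  have p: "p ^ Suc k = q" "p \<ge> 0" "p < 1"
    unfolding p_def using assms real_root_pow_pos2[of "Suc k" q] by auto
  have "(\<lambda>n. real n * p ^ n) \<longlonglongrightarrow> 0" using powser_times_n_limit_0[of p] p by simp
  hence "(\<lambda>n. (real n * p ^ n) ^ Suc k) \<longlonglongrightarrow> 0 ^ Suc k" by (rule tendsto_power)
  thus "(\<lambda>n. (real n * p ^ n) ^ Suc k) \<longlonglongrightarrow> 0" by simp
  have 1: "(real n * p ^ n) ^ Suc k = real n ^ Suc k * q ^ n" for n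
    unfolding power_mult_distrib p(1)[symmetric] power_mult[symmetric] by (simp add: mult.commute)
  have 2: "real n ^ k * q ^ n \<le> real n ^ Suc k * q ^ n" if "n \<ge> 1" for n
    using that assms by (intro mult_right_mono power_increasing) auto
  show "eventually (\<lambda>n. norm (real n ^ k * q ^ n) \<le> (real n * p ^ n) ^ Suc k) sequentially"
    unfolding eventually_sequentially 1 using assms 2 by (intro exI[of _ 1]) (auto simp: abs_mult)
qed

text \<open>From \<open>n choose k \<le> n ^ k\<close> and
  \<open>n choose l \<ge> (n / l) ^ l\<close> the quotient is at most
  \<open>l ^ l * n ^ k / n ^ l\<close>, hence at most \<open>l ^ l / n\<close>.\<close>

lemma binomial_ratio_tendsto_0:
  fixes k l :: nat
  assumes "k < l"
  shows "(\<lambda>n. real (n choose k) / real (n choose l)) \<longlonglongrightarrow> 0"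
proof (rule tendsto_zero_comparison)
  show "(\<lambda>n. real l ^ l / real n) \<longlonglongrightarrow> 0" by (rule lim_const_over_n)
  have "real (n choose k) / real (n choose l) \<le> real l ^ l / real n" if n: "n \<ge> l" for n
  proof -
    have 0: "n > 0" "l > 0" using assms n by auto
    have 1: "real (n choose k) \<le> real n ^ k" using binomial_le_pow2[of n k] n assms
      by (metis binomial_le_pow less_imp_le of_nat_le_iff of_nat_power order_trans)
    have 2: "(real n / real l) ^ l \<le> real (n choose l)" using binomial_ge_n_over_k_pow_k[OF n, where 'a=real] by simp
    have 3: "(real n / real l) ^ l > 0" using 0 by simp
    have "real (n choose k) / real (n choose l) \<le> real n ^ k / (real n / real l) ^ l"
      using 1 2 3 by (intro frac_le) auto
    also have "\<dots> = real l ^ l * (real n ^ k / real n ^ l)" by (simp add: power_divide)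
    also have "real n ^ k / real n ^ l \<le> 1 / real n"
    proof -
      have "real n ^ Suc k \<le> real n ^ l" using assms 0 by (intro power_increasing) auto
      thus ?thesis using 0 by (simp add: field_simps)
    qed
    finally show ?thesis by (simp add: mult_left_mono)
  qed
  thus "eventually (\<lambda>n. norm (real (n choose k) / real (n choose l)) \<le> real l ^ l / real n) sequentially"
    unfolding eventually_sequentially by (intro exI[of _ l]) auto
qed

text \<open>Exponential decay of \<open>(cmod a / r) ^ n\<close> beats the polynomial growth of the
  binomial coefficient, whatever \<open>k\<close> and \<open>l\<close> are.\<close>

lemma jterm_ratio_smaller_modulus:
  assumes "cmod a < r"
  shows "(\<lambda>n. cmod (jterm k a n) / (real (n choose l) * r ^ (n - l))) \<longlonglongrightarrow> 0"
proof (cases "a = 0")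
  case True
  \<comment> \<open>For \<open>a = 0\<close> the term vanishes only from \<open>n = k + 1\<close>
    on; at \<open>n = k\<close> it is \<open>0 ^ 0 = 1\<close>.\<close>
  show ?thesis
    by (rule tendsto_eventually) 
      (auto simp: True jterm_def eventually_sequentially intro!: exI[of _ "Suc k"])
next
  case False
  have r: "r > 0" using assms norm_ge_zero[of a] by linarith
  show ?thesis
  proof (rule tendsto_zero_comparison)
    \<comment> \<open>\<open>C\<close> absorbs the offsets in the exponents:
      \<open>cmod a ^ (n-k) / r ^ (n-l) = C * (cmod a / r) ^ n\<close>.\<close>
    define C where "C = r ^ l / cmod a ^ k"
    show "(\<lambda>n. C * (real n ^ k * (cmod a / r) ^ n)) \<longlonglongrightarrow> 0"
      using tendsto_mult_left[OF power_times_geometric_tendsto_0[of "cmod a / r" k], of C] assms r by simp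
    have "cmod (jterm k a n) / (real (n choose l) * r ^ (n - l)) \<le> C * (real n ^ k * (cmod a / r) ^ n)"
      if n: "n \<ge> max k l" for n
    proof -
      have 1: "real (n choose k) \<le> real n ^ k" using n
        by (metis binomial_le_pow max.boundedE of_nat_le_iff of_nat_power)
      have 2: "1 \<le> real (n choose l)" using n by (simp add: Suc_leI)
      have "real (n choose k) / real (n choose l) \<le> real n ^ k / 1" using 1 2 by (intro frac_le) auto
      hence "(real (n choose k) / real (n choose l)) * (cmod a ^ (n-k) / r ^ (n-l)) \<le> real n ^ k * (cmod a ^ (n-k) / r ^ (n-l))"
        using r by (intro mult_right_mono) auto
      moreover have "cmod a ^ (n-k) / r ^ (n-l) = C * (cmod a / r) ^ n"
        using n False r by (simp add: C_def power_diff power_divide)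
      moreover have "cmod (jterm k a n) / (real (n choose l) * r ^ (n - l))
          = (real (n choose k) / real (n choose l)) * (cmod a ^ (n-k) / r ^ (n-l))"
        by (simp add: norm_jterm)
      ultimately show ?thesis by (simp add: mult_ac)
    qed
    thus "eventually (\<lambda>n. norm (cmod (jterm k a n) / (real (n choose l) * r ^ (n - l))) \<le> C * (real n ^ k * (cmod a / r) ^ n)) sequentially"
      unfolding eventually_sequentially using r by (intro exI[of _ "max k l"]) auto
  qed
qed

text \<open>With equal moduli the powers cancel up to the constant \<open>r ^ (l - k)\<close>, and
  the quotient of the binomial coefficients decides.\<close>

lemma jterm_ratio_smaller_degree:
  assumes "cmod a = r" "r > 0" "k < l"
  shows "(\<lambda>n. cmod (jterm k a n) / (real (n choose l) * r ^ (n - l))) \<longlonglongrightarrow> 0"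
proof (rule Lim_transform_eventually)
  show "(\<lambda>n. r ^ (l - k) * (real (n choose k) / real (n choose l))) \<longlonglongrightarrow> 0"
    using tendsto_mult_left[OF binomial_ratio_tendsto_0[OF assms(3)], of "r ^ (l-k)"] by simp
  have "r ^ (l - k) * (real (n choose k) / real (n choose l)) = cmod (jterm k a n) / (real (n choose l) * r ^ (n - l))" if "n \<ge> l" for n
  proof -
    have "r ^ (n - k) = r ^ (l - k) * r ^ (n - l)" using that assms(3)
      by (simp add: power_add[symmetric])
    thus ?thesis using assms by (simp add: norm_jterm)
  qed
  thus "eventually (\<lambda>n. r ^ (l - k) * (real (n choose k) / real (n choose l)) = cmod (jterm k a n) / (real (n choose l) * r ^ (n - l))) sequentially"
    unfolding eventually_sequentially by auto
qed

text \<open>Among the pairs of maximal modulus \<open>r\<close>, those with the largest index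
  \<open>l\<close> dominate, so the normaliser is eventually
  \<open>(n choose l) * r ^ (n - l)\<close>. A dominated term has normalised limit 0; a dominating
  one becomes the geometric sequence \<open>(a / r) ^ (n - l)\<close>. The pair with
  \<open>a0 \<noteq> 0\<close> ensures \<open>r > 0\<close>.\<close>

lemma cesaro_jterm_convergent:
  assumes fin: "finite E" and ex: "(k0,a0) \<in> E" "a0 \<noteq> 0" and ka: "(k,a) \<in> E"
  shows "\<exists>L. (\<lambda>N. (\<Sum>n=1..N. jterm k a n / complex_of_real (jmax E n)) / of_nat N) \<longlonglongrightarrow> L"
proof -
  define r where "r = Max ((\<lambda>(k,a). cmod a) ` E)"
  have r_ge: "cmod a \<le> r" if "(k,a) \<in> E" for k a
    unfolding r_def using fin that by (intro Max_ge) (auto intro!: image_eqI[of _ _ "(k,a)"])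
  have r0: "r > 0" using r_ge[OF ex(1)] ex(2) by (meson less_le_trans zero_less_norm_iff)
  have "r \<in> (\<lambda>(k,a). cmod a) ` E" unfolding r_def using fin ex by (intro Max_in) auto
  then obtain k1 a1 where ka1: "(k1,a1) \<in> E" "cmod a1 = r" by auto
  define K where "K = {k. \<exists>a. (k,a) \<in> E \<and> cmod a = r}"
  have finK: "finite K" by (rule finite_subset[of _ "fst ` E"]) (auto simp: K_def image_iff fin, force)
  define l where "l = Max K"
  have l_ge: "k \<le> l" if "(k,a) \<in> E" "cmod a = r" for k a
    unfolding l_def using finK that by (intro Max_ge) (auto simp: K_def)
  have "l \<in> K" unfolding l_def using finK ka1 by (intro Max_in) (auto simp: K_def)
  then obtain a2 where a2: "(l,a2) \<in> E" "cmod a2 = r" by (auto simp: K_def)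
  \<comment> \<open>The modulus of the dominating terms, which \<open>jmax E n\<close> is shown to
    equal for all large \<open>n\<close>.\<close>
  define g where "g n = real (n choose l) * r ^ (n - l)" for n
  have g0: "g n \<ge> 0" for n using r0 by (simp add: g_def)
  have gpos: "g n > 0" if "n \<ge> l" for n using r0 that by (simp add: g_def)
  have small: "(\<lambda>n. cmod (jterm k a n) / g n) \<longlonglongrightarrow> 0" if "(k,a) \<in> E" "\<not> (k = l \<and> cmod a = r)" for k a
  proof (cases "cmod a = r")
    case True
    with l_ge[OF that(1)] that(2) have "k < l" by auto
    from jterm_ratio_smaller_degree[OF True r0 this] show ?thesis by (simp add: g_def)
  next
    case False
    with r_ge[OF that(1)] have "cmod a < r" by simp
    from jterm_ratio_smaller_modulus[OF this] show ?thesis by (simp add: g_def)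
  qed
  have ev: "eventually (\<lambda>n. cmod (jterm k a n) \<le> g n) sequentially" if "(k,a) \<in> E" for k a
  proof (cases "k = l \<and> cmod a = r")
    case True thus ?thesis by (simp add: norm_jterm g_def)
  next
    case False
    have "eventually (\<lambda>n. cmod (jterm k a n) / g n < 1) sequentially"
      using order_tendstoD(2)[OF small[OF that False], of 1] by simp
    thus ?thesis using eventually_ge_at_top[of l]
    proof eventually_elim
      case (elim n) thus ?case using gpos[of n] by (simp add: field_simps)
    qed
  qed
  have "eventually (\<lambda>n. \<forall>e\<in>E. cmod (jterm (fst e) (snd e) n) \<le> g n) sequentially"
    using fin ev by (intro eventually_ball_finite) auto
  hence D: "eventually (\<lambda>n. jmax E n = g n) sequentially"
  proof eventually_elim
    case (elim n)
    show ?case unfolding jmax_def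
    proof (rule Max_eqI)
      show "g n \<in> insert 0 ((\<lambda>(k, a). cmod (jterm k a n)) ` E)"
        by (intro insertI2 image_eqI[OF _ a2(1)]) (simp add: norm_jterm g_def a2(2))
    qed (use fin elim g0 in auto)
  qed
  show ?thesis
  proof (cases "k = l \<and> cmod a = r")
    case False
    have "(\<lambda>n. jterm k a n / complex_of_real (jmax E n)) \<longlonglongrightarrow> 0"
    proof (rule tendsto_norm_zero_cancel, rule Lim_transform_eventually)
      show "(\<lambda>n. cmod (jterm k a n) / g n) \<longlonglongrightarrow> 0" by (rule small[OF ka False])
      show "eventually (\<lambda>n. cmod (jterm k a n) / g n = cmod (jterm k a n / complex_of_real (jmax E n))) sequentially"
        using D by eventually_elim (use g0 in \<open>simp add: norm_divide\<close>)
    qed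
    from cesaro_zero[OF this] show ?thesis by blast
  next
    case True
    \<comment> \<open>The normalised term is \<open>w ^ (n - l)\<close> only for large
      \<open>n\<close>; comparing it with \<open>w ^ n / w ^ l\<close>, whose means are known,
      avoids the truncated subtraction.\<close>
    define w where "w = a / of_real r"
    have w: "cmod w = 1" using True r0 by (simp add: w_def norm_divide)
    from cesaro_geometric[OF w] obtain L where L: "(\<lambda>N. (\<Sum>n=1..N. w ^ n) / of_nat N) \<longlonglongrightarrow> L" by blast
    have h1: "(\<lambda>N. (\<Sum>n=1..N. w ^ n / w ^ l) / of_nat N) \<longlonglongrightarrow> L / w ^ l"
      using tendsto_mult_right[OF L, of "1 / w ^ l"] by (simp add: sum_divide_distrib[symmetric] mult_ac)
    have h2: "(\<lambda>n. jterm k a n / complex_of_real (jmax E n) - w ^ n / w ^ l) \<longlonglongrightarrow> 0"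
    proof (rule tendsto_eventually)
      show "eventually (\<lambda>n. jterm k a n / complex_of_real (jmax E n) - w ^ n / w ^ l = 0) sequentially"
        using D eventually_ge_at_top[of l]
      proof eventually_elim
        case (elim n)
        have w0: "w \<noteq> 0" using w by auto
        have a: "a = w * of_real r" using r0 by (simp add: w_def)
        have "jterm k a n / complex_of_real (jmax E n) = w ^ (n - l)"
          using True elim r0 by (simp add: jterm_def g_def a power_mult_distrib)
        thus ?case using w0 elim by (simp add: power_diff)
      qed
    qed
    show ?thesis using cesaro_cong[OF h2 h1] by blast
  qed
qed

section \<open>Powers of Jordan matrices\<close>

text \<open>Position and multiplicity of the blocks are forgotten on purpose: the norms of the
  powers depend only on this set, and the set is a similarity invariant. Blocks of size 0 contribute
  nothing.\<close>

definition jparams :: "(nat \<times> complex) list \<Rightarrow> (nat \<times> complex) set" where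
  "jparams n_as = {(k,a). \<exists>s. (s,a) \<in> set n_as \<and> k < s}"

lemma finite_jparams: "finite (jparams n_as)"
proof -
  have "jparams n_as \<subseteq> (\<Union>(s,a)\<in>set n_as. (\<lambda>k. (k,a)) ` {..<s})"
    by (auto simp: jparams_def)
  thus ?thesis by (rule finite_subset) auto
qed

lemma jparams_Cons: "jparams ((s,a) # n_as) = (\<lambda>k. (k,a)) ` {..<s} \<union> jparams n_as"
  by (auto simp: jparams_def)

lemma jordan_matrix_pow_dim[simp]:
  "dim_row (jordan_matrix n_as ^\<^sub>m r) = sum_list (map fst n_as)"
  "dim_col (jordan_matrix n_as ^\<^sub>m r) = sum_list (map fst n_as)"
  using pow_carrier_mat[OF jordan_matrix_carrier, of n_as r] by auto

lemma jordan_matrix_Cons_pow: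
  "jordan_matrix ((s,a) # n_as) ^\<^sub>m r = four_block_mat (jordan_block s a ^\<^sub>m r)
     (0\<^sub>m s (sum_list (map fst n_as))) (0\<^sub>m (sum_list (map fst n_as)) s) (jordan_matrix n_as ^\<^sub>m r)"
  using jordan_matrix_pow_dim[of n_as r] unfolding jordan_matrix_pow by (simp add: Let_def)

lemma jordan_block_pow_jterm:
  assumes "i < s" "j < s"
  shows "(jordan_block s a ^\<^sub>m n) $$ (i,j) = (if i \<le> j then jterm (j - i) a n else 0)"
  using assms unfolding jordan_block_pow jterm_def by auto

text \<open>The order of the quantifiers matters: \<open>(k,a)\<close> depends on the position
  alone, so each entry is a single sequence \<open>jterm k a\<close> for all exponents. This is what
  lets the scalar Cesaro lemma apply entrywise.\<close>

lemma jordan_matrix_pow_entry: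
  assumes "i < sum_list (map fst n_as)" "j < sum_list (map fst n_as)"
  shows "(\<forall>n. (jordan_matrix n_as ^\<^sub>m n) $$ (i,j) = 0)
    \<or> (\<exists>(k,a)\<in>jparams n_as. \<forall>n. (jordan_matrix n_as ^\<^sub>m n) $$ (i,j) = jterm k a n)"
  using assms
proof (induction n_as arbitrary: i j)
  case (Cons sa n_as)
  obtain s a where sa: "sa = (s,a)" by (cases sa)
  let ?d = "sum_list (map fst n_as)"
  have ent: "(jordan_matrix (sa # n_as) ^\<^sub>m n) $$ (i,j) =
     (if i < s then if j < s then (jordan_block s a ^\<^sub>m n) $$ (i,j) else 0
      else if j < s then 0 else (jordan_matrix n_as ^\<^sub>m n) $$ (i - s, j - s))" for n
    unfolding sa jordan_matrix_Cons_pow using Cons.prems by (subst index_mat_four_block) (auto simp: sa)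
  consider "i < s" "j < s" "i \<le> j" | "i < s" "j < s" "\<not> i \<le> j" | "i < s \<longleftrightarrow> \<not> j < s" | "\<not> i < s" "\<not> j < s" by blast
  thus ?case
  proof cases
    case 1
    hence "(j - i, a) \<in> jparams (sa # n_as)" unfolding sa jparams_Cons by auto
    with 1 show ?thesis unfolding ent jordan_block_pow_jterm[OF 1(1,2)] by auto
  next
    case 4
    have "jparams n_as \<subseteq> jparams (sa # n_as)" unfolding sa jparams_Cons by auto
    moreover have "i - s < sum_list (map fst n_as)" "j - s < sum_list (map fst n_as)"
      using 4 Cons.prems by (auto simp: sa)
    note Cons.IH[OF this]
    ultimately show ?thesis unfolding ent using 4 by auto
  qed (auto simp: ent jordan_block_pow_jterm)
qed simp

text \<open>The witness is column \<open>k\<close> of the first row of a block of size greater than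
  \<open>k\<close>. This gives the lower bound of the maximal entry by \<open>jmax\<close>.\<close>

lemma jordan_matrix_pow_entry_surj:
  assumes "(k,a) \<in> jparams n_as"
  shows "\<exists>i<sum_list (map fst n_as). \<exists>j<sum_list (map fst n_as).
    \<forall>n. (jordan_matrix n_as ^\<^sub>m n) $$ (i,j) = jterm k a n"
  using assms
proof (induction n_as)
  case Nil thus ?case by (simp add: jparams_def)
next
  case (Cons sb n_as)
  obtain s b where sb: "sb = (s,b)" by (cases sb)
  let ?d = "sum_list (map fst n_as)"
  have ent: "(jordan_matrix (sb # n_as) ^\<^sub>m n) $$ (i,j) =
     (if i < s then if j < s then (jordan_block s b ^\<^sub>m n) $$ (i,j) else 0
      else if j < s then 0 else (jordan_matrix n_as ^\<^sub>m n) $$ (i - s, j - s))"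
    if "i < s + ?d" "j < s + ?d" for n i j
    unfolding sb jordan_matrix_Cons_pow using that by (subst index_mat_four_block) (auto simp: sb)
  from Cons.prems consider "k < s" "a = b" | "(k,a) \<in> jparams n_as" unfolding sb jparams_Cons by auto
  thus ?case
  proof cases
    case 1
    thus ?thesis by (intro exI[of _ 0] conjI exI[of _ k]) (auto simp: sb ent[unfolded sb] jordan_block_pow_jterm)
  next
    case 2
    from Cons.IH[OF this] obtain i j where ij: "i < ?d" "j < ?d"
      "\<And>n. (jordan_matrix n_as ^\<^sub>m n) $$ (i,j) = jterm k a n" by blast
    thus ?thesis by (intro exI[of _ "s+i"] conjI exI[of _ "s+j"]) (auto simp: sb ent[unfolded sb])
  qed
qed

lemma jmax_ge: "finite E \<Longrightarrow> (k,a) \<in> E \<Longrightarrow> cmod (jterm k a n) \<le> jmax E n"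
  unfolding jmax_def by (intro Max_ge) (auto intro!: image_eqI[of _ _ "(k,a)"])

lemma jmax_nonneg: "finite E \<Longrightarrow> 0 \<le> jmax E n"
  unfolding jmax_def by (intro Max_ge) auto

lemma jmax_le:
  assumes "finite E" "0 \<le> x" "\<And>k a. (k,a) \<in> E \<Longrightarrow> cmod (jterm k a n) \<le> x"
  shows "jmax E n \<le> x"
  unfolding jmax_def using assms by (subst Max_le_iff) auto

text \<open>A block with eigenvalue \<open>a\<close> has \<open>a ^ n\<close> on its diagonal, so
  \<open>(0,a)\<close> is a parameter as well and its term never vanishes.\<close>

lemma jmax_pos:
  assumes "(k,a) \<in> jparams n_as" "a \<noteq> 0"
  shows "jmax (jparams n_as) n > 0"
proof -
  have "(0,a) \<in> jparams n_as" using assms by (auto simp: jparams_def)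
  from jmax_ge[OF finite_jparams this, of n] have "cmod a ^ n \<le> jmax (jparams n_as) n"
    by (simp add: norm_jterm)
  thus ?thesis using assms by (meson less_le_trans zero_less_norm_iff zero_less_power)
qed

text \<open>Pascal's rule, that is, the multiplication of a power of a Jordan block by the block
  itself, read off on a superdiagonal.\<close>

lemma jterm_Suc:
  assumes "k > 0"
  shows "jterm k a (Suc n) = a * jterm k a n + jterm (k - 1) a n"
proof -
  obtain k' where k: "k = Suc k'" using assms by (cases k) auto
  show ?thesis
  proof (cases "n \<ge> k")
    case True
    hence "n - k' = Suc (n - Suc k')" using k by simp
    thus ?thesis by (simp add: jterm_def k algebra_simps)
  next
    case False thus ?thesis by (simp add: jterm_def k)
  qed
qed

text \<open>By \<open>jterm_Suc\<close> each new term is an eigenvalue times an old term plus the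
  old term one superdiagonal lower, which belongs to the same block. Hence \<open>K = R + 1\<close>
  works, with \<open>R\<close> the largest modulus of an eigenvalue. The bound later controls the
  index shift in the Cesaro means.\<close>

lemma jmax_Suc_le: "\<exists>K>0. \<forall>n. jmax (jparams n_as) (Suc n) \<le> K * jmax (jparams n_as) n"
proof -
  define R where "R = Max (insert 0 ((\<lambda>(k,a). cmod a) ` jparams n_as))"
  let ?E = "jparams n_as"
  have R0: "R \<ge> 0" unfolding R_def by (intro Max_ge) (auto simp: finite_jparams)
  have R: "cmod a \<le> R" if "(k,a) \<in> ?E" for k a
    unfolding R_def using that by (intro Max_ge) (auto simp: finite_jparams intro!: image_eqI[of _ _ "(k,a)"])
  have "jmax ?E (Suc n) \<le> (R + 1) * jmax ?E n" for n
  proof (rule jmax_le[OF finite_jparams])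
    show "0 \<le> (R + 1) * jmax ?E n" using R0 jmax_nonneg[OF finite_jparams] by simp
  next
    fix k a assume ka: "(k,a) \<in> ?E"
    have 1: "cmod (a * jterm k a n) \<le> R * jmax ?E n" unfolding norm_mult
      using R[OF ka] jmax_ge[OF finite_jparams ka] R0 by (intro mult_mono) auto
    show "cmod (jterm k a (Suc n)) \<le> (R + 1) * jmax ?E n"
    proof (cases "k = 0")
      case True
      have "jterm k a (Suc n) = a * jterm k a n" by (simp add: True jterm_def)
      thus ?thesis using 1 jmax_nonneg[OF finite_jparams, of n_as n] by (simp add: algebra_simps)
    next
      case False
      have "(k - 1, a) \<in> ?E" using ka by (auto simp: jparams_def)
      from jmax_ge[OF finite_jparams this, of n]
      have "cmod (jterm (k - 1) a n) \<le> jmax ?E n" .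
      moreover have "cmod (jterm k a (Suc n)) \<le> cmod (a * jterm k a n) + cmod (jterm (k - 1) a n)"
        using False norm_triangle_ineq by (simp add: jterm_Suc)
      ultimately show ?thesis using 1 by (simp add: algebra_simps)
    qed
  qed
  thus ?thesis using R0 by (intro exI[of _ "R+1"]) auto
qed

lemma Max_jordan_matrix_pow:
  assumes d: "d = sum_list (map fst n_as)" "d > 0"
  shows "Max {cmod ((jordan_matrix n_as ^\<^sub>m n) $$ (i,j)) | i j. i < d \<and> j < d} = jmax (jparams n_as) n"
    (is "Max ?A = _")
proof (rule antisym)
  have "?A = (\<lambda>(i,j). cmod ((jordan_matrix n_as ^\<^sub>m n) $$ (i,j))) ` ({..<d} \<times> {..<d})" by auto
  hence fin: "finite ?A" by simp
  show "Max ?A \<le> jmax (jparams n_as) n"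
  proof (subst Max_le_iff[OF fin])
    show "?A \<noteq> {}" using d(2) by blast
    show "\<forall>x\<in>?A. x \<le> jmax (jparams n_as) n"
    proof
      fix x assume "x \<in> ?A"
      then obtain i j where ij: "i < d" "j < d" and x: "x = cmod ((jordan_matrix n_as ^\<^sub>m n) $$ (i,j))" by blast
      from jordan_matrix_pow_entry[of i n_as j] ij d
      show "x \<le> jmax (jparams n_as) n" unfolding x
        using jmax_nonneg[OF finite_jparams] jmax_ge[OF finite_jparams] by fastforce
    qed
  qed
  show "jmax (jparams n_as) n \<le> Max ?A"
  proof (rule jmax_le[OF finite_jparams])
    have "cmod ((jordan_matrix n_as ^\<^sub>m n) $$ (0,0)) \<le> Max ?A" using d(2) by (intro Max_ge[OF fin]) blast
    thus "0 \<le> Max ?A" using norm_ge_zero order_trans by blast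
  next
    fix k a assume "(k,a) \<in> jparams n_as"
    from jordan_matrix_pow_entry_surj[OF this] d(1) obtain i j where
      "i < d" "j < d" "(jordan_matrix n_as ^\<^sub>m n) $$ (i,j) = jterm k a n" by blast
    thus "cmod (jterm k a n) \<le> Max ?A" by (intro Max_ge[OF fin]) force
  qed
qed

section \<open>Invariance of the block data under similarity and under added zero blocks\<close>

lemma jordan_matrix_filter: "jordan_matrix (filter (\<lambda>x. fst x \<noteq> 0) n_as) = jordan_matrix n_as"
proof (induction n_as)
  case (Cons sa n_as)
  obtain s a where sa: "sa = (s,a)" by (cases sa)
  show ?case
  proof (cases "s = 0")
    case True
    have "jordan_matrix ((0,a) # n_as) = jordan_matrix n_as"
      unfolding jordan_matrix_Cons by (rule eq_matI) auto
    thus ?thesis using Cons True sa by simp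
  next
    case False
    have "sum_list (map fst (filter (\<lambda>x. fst x \<noteq> 0) n_as)) = sum_list (map fst n_as)"
      by (induction n_as) auto
    thus ?thesis using Cons False sa by (simp add: jordan_matrix_Cons)
  qed
qed simp

lemma jparams_filter: "jparams (filter (\<lambda>x. fst x \<noteq> 0) n_as) = jparams n_as"
  by (auto simp: jparams_def)

text \<open>Uniqueness of the Jordan normal form. \<open>jordan_nf\<close> excludes blocks of size
  0, which the definition of a Jordan basis admits, so these are filtered out first; neither the
  matrix nor the parameters change.\<close>

lemma jparams_similar:
  assumes "similar_mat (jordan_matrix xs) (jordan_matrix ys)"
  shows "jparams xs = jparams ys"
proof -
  let ?f = "filter (\<lambda>x::nat \<times> complex. fst x \<noteq> 0)"
  have "jordan_nf (jordan_matrix xs) (?f xs)" unfolding jordan_nf_def jordan_matrix_filter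
    using similar_mat_refl[OF jordan_matrix_carrier] by auto
  moreover have "jordan_nf (jordan_matrix xs) (?f ys)" unfolding jordan_nf_def jordan_matrix_filter
    using assms by auto
  ultimately have "set (?f xs) = set (?f ys)" by (rule jordan_nf_unique)
  hence "jparams (?f xs) = jparams (?f ys)" unfolding jparams_def by simp
  thus ?thesis unfolding jparams_filter .
qed

lemma jordan_matrix_replicate_zero:
  fixes n_as :: "(nat \<times> complex) list"
  assumes "i < q + sum_list (map fst n_as)" "j < q + sum_list (map fst n_as)"
  shows "jordan_matrix (replicate q (1,0) @ n_as) $$ (i,j)
    = (if i < q \<or> j < q then 0 else jordan_matrix n_as $$ (i - q, j - q))"
  using assms
proof (induction q arbitrary: i j)
  case (Suc q)
  have [simp]: "sum_list (replicate q (Suc 0)) = q"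
    by (simp add: sum_list_replicate)
  have "jordan_matrix (replicate (Suc q) (1,0) @ n_as) $$ (i,j) = 
    (if i < 1 then if j < 1 then 0 else 0 else if j < 1 then 0 else jordan_matrix (replicate q (1,0) @ n_as) $$ (i - 1, j - 1))"
    using Suc.prems by (simp add: jordan_matrix_Cons)
  thus ?case using Suc.IH[of "i - 1" "j - 1"] Suc.prems by (cases i; cases j) auto
qed simp

text \<open>A zero block of size 1 contributes \<open>0 ^ n\<close>, which vanishes for
  \<open>n \<ge> 1\<close> but is 1 at \<open>n = 0\<close>.\<close>

lemma jmax_replicate_zero:
  assumes "n \<ge> 1"
  shows "jmax (jparams (replicate q (1,0) @ n_as)) n = jmax (jparams n_as) n"
proof (rule antisym)
  show "jmax (jparams (replicate q (1,0) @ n_as)) n \<le> jmax (jparams n_as) n"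
  proof (rule jmax_le[OF finite_jparams jmax_nonneg[OF finite_jparams]])
    fix k a assume "(k,a) \<in> jparams (replicate q (1,0) @ n_as)"
    hence "(k,a) \<in> jparams n_as \<or> k = 0 \<and> a = 0" by (auto simp: jparams_def)
    thus "cmod (jterm k a n) \<le> jmax (jparams n_as) n"
      using jmax_ge[OF finite_jparams] jmax_nonneg[OF finite_jparams] assms
      by (auto simp: norm_jterm power_0_left)
  qed
  show "jmax (jparams n_as) n \<le> jmax (jparams (replicate q (1,0) @ n_as)) n"
    by (rule jmax_le[OF finite_jparams jmax_nonneg[OF finite_jparams]], rule jmax_ge[OF finite_jparams])
       (auto simp: jparams_def)
qed

section \<open>Coordinates in spaces of matrices\<close>

definition msubspace :: "nat \<Rightarrow> complex mat set \<Rightarrow> bool" where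
  "msubspace m V \<longleftrightarrow> V \<subseteq> carrier_mat m m \<and> 0\<^sub>m m m \<in> V \<and>
     (\<forall>X\<in>V. \<forall>Y\<in>V. \<forall>a b. a \<cdot>\<^sub>m X + b \<cdot>\<^sub>m Y \<in> V)"

text \<open>Vector version of \<^const>\<open>lincomb\<close>, so that coordinate changes become matrix-vector products.\<close>

definition comb :: "nat \<Rightarrow> complex mat list \<Rightarrow> complex vec \<Rightarrow> complex mat" where
  "comb m Xs v = mat m m (\<lambda>(i,j). \<Sum>k<length Xs. v $ k * (Xs ! k) $$ (i,j))"

lemma comb_carrier[simp]: "comb m Xs v \<in> carrier_mat m m"
  "dim_row (comb m Xs v) = m" "dim_col (comb m Xs v) = m"
  by (auto simp: comb_def)

lemma comb_index: "i < m \<Longrightarrow> j < m \<Longrightarrow> comb m Xs v $$ (i,j) = (\<Sum>k<length Xs. v $ k * (Xs ! k) $$ (i,j))"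
  by (simp add: comb_def)

lemma lincomb_Cons: "lincomb m (c # cs) (X # Xs) = c \<cdot>\<^sub>m X + lincomb m cs Xs"
  by (simp add: lincomb_def)

lemma lincomb_eq_comb:
  assumes "length cs = length Xs" "set Xs \<subseteq> carrier_mat m m"
  shows "lincomb m cs Xs = comb m Xs (vec_of_list cs)"
  using assms
proof (induction cs Xs rule: list_induct2)
  case Nil show ?case by (rule eq_matI) (auto simp: lincomb_def comb_def)
next
  case (Cons c cs X Xs)
  have X: "X \<in> carrier_mat m m" using Cons.prems by auto
  show ?case unfolding lincomb_Cons
    using Cons X by (intro eq_matI) (auto simp: comb_index sum.lessThan_Suc_shift simp del: sum.lessThan_Suc)
qed

lemma lincomb_list_of_vec:
  assumes "v \<in> carrier_vec (length Xs)" "set Xs \<subseteq> carrier_mat m m"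
  shows "lincomb m (list_of_vec v) Xs = comb m Xs v"
  using lincomb_eq_comb[of "list_of_vec v" Xs m] assms by (simp add: vec_list)

lemma mspan_eq:
  assumes "set Xs \<subseteq> carrier_mat m m"
  shows "mspan m Xs = comb m Xs ` carrier_vec (length Xs)"
proof -
  have "lincomb m cs Xs \<in> comb m Xs ` carrier_vec (length Xs)" if "length cs = length Xs" for cs
    unfolding lincomb_eq_comb[OF that assms] using that by (intro imageI carrier_vecI) simp
  moreover have "\<exists>cs. comb m Xs v = lincomb m cs Xs \<and> length cs = length Xs" if "v \<in> carrier_vec (length Xs)" for v
    using lincomb_list_of_vec[OF that assms] that by (intro exI[of _ "list_of_vec v"]) auto
  ultimately show ?thesis unfolding mspan_def by auto
qed

lemma comb_linear:
  assumes "v \<in> carrier_vec (length Xs)" "w \<in> carrier_vec (length Xs)"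
  shows "comb m Xs (a \<cdot>\<^sub>v v + b \<cdot>\<^sub>v w) = a \<cdot>\<^sub>m comb m Xs v + b \<cdot>\<^sub>m comb m Xs w"
  using assms by (intro eq_matI) (auto simp: comb_index algebra_simps sum.distrib sum_distrib_left)

lemma comb_zero: "comb m Xs (0\<^sub>v (length Xs)) = 0\<^sub>m m m"
  by (intro eq_matI) (auto simp: comb_index)

lemma comb_unit_vec:
  assumes "j < length Xs" "set Xs \<subseteq> carrier_mat m m"
  shows "comb m Xs (unit_vec (length Xs) j) = Xs ! j"
proof -
  have X: "Xs ! j \<in> carrier_mat m m" using assms by auto
  have "(\<Sum>k<length Xs. unit_vec (length Xs) j $ k * Xs ! k $$ (a, b)) = Xs ! j $$ (a,b)" for a b
  proof -
    have "(\<Sum>k<length Xs. unit_vec (length Xs) j $ k * Xs ! k $$ (a, b)) = (\<Sum>k<length Xs. if k = j then Xs ! k $$ (a,b) else 0)"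
      by (rule sum.cong) (use assms in auto)
    thus ?thesis using assms by simp
  qed
  thus ?thesis using X by (intro eq_matI) (auto simp: comb_index)
qed

text \<open>Restates the list-based definition as bijectivity of the coordinate map
  \<open>comb m \<beta>\<close> from vectors onto \<open>V\<close>; the later arguments use only
  this form.\<close>

lemma is_basis_iff:
  "is_basis m V \<beta> \<longleftrightarrow> set \<beta> \<subseteq> carrier_mat m m
     \<and> (\<forall>v\<in>carrier_vec (length \<beta>). comb m \<beta> v = 0\<^sub>m m m \<longrightarrow> v = 0\<^sub>v (length \<beta>))
     \<and> comb m \<beta> ` carrier_vec (length \<beta>) = V"
proof (cases "set \<beta> \<subseteq> carrier_mat m m")
  case True
  have "lin_indep m \<beta> \<longleftrightarrow> (\<forall>v\<in>carrier_vec (length \<beta>). comb m \<beta> v = 0\<^sub>m m m \<longrightarrow> v = 0\<^sub>v (length \<beta>))" (is "?l = ?r")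
  proof
    assume l: ?l
    show ?r
    proof (intro ballI impI)
      fix v assume v: "v \<in> carrier_vec (length \<beta>)" "comb m \<beta> v = 0\<^sub>m m m"
      have "set (list_of_vec v) \<subseteq> {0}" using l v lincomb_list_of_vec[OF v(1) True]
        unfolding lin_indep_def by (metis carrier_vecD length_list_of_vec)
      moreover have "v $ i \<in> set (list_of_vec v)" if "i < length \<beta>" for i
        using that v(1) by (metis carrier_vecD length_list_of_vec list_of_vec_index nth_mem)
      ultimately show "v = 0\<^sub>v (length \<beta>)" using v(1) by (intro eq_vecI) auto
    qed
  next
    assume r: ?r
    show ?l unfolding lin_indep_def
    proof (intro allI impI)
      fix cs assume cs: "length cs = length \<beta>" "lincomb m cs \<beta> = 0\<^sub>m m m"
      have "vec_of_list cs = 0\<^sub>v (length \<beta>)" using r cs lincomb_eq_comb[OF cs(1) True]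
        by (metis carrier_vecI dim_vec_of_list)
      hence "cs = replicate (length \<beta>) 0" by (metis list_of_vec_0 list_vec)
      thus "set cs \<subseteq> {0}" by auto
    qed
  qed
  thus ?thesis unfolding is_basis_def mspan_eq[OF True] by blast
qed (auto simp: is_basis_def)

lemma comb_inj:
  assumes b: "is_basis m V \<beta>" and v: "v \<in> carrier_vec (length \<beta>)" and w: "w \<in> carrier_vec (length \<beta>)"
    and eq: "comb m \<beta> v = comb m \<beta> w"
  shows "v = w"
proof -
  have "comb m \<beta> (1 \<cdot>\<^sub>v v + (-1) \<cdot>\<^sub>v w) = 0\<^sub>m m m"
    unfolding comb_linear[OF v w] eq by (rule eq_matI) auto
  hence "1 \<cdot>\<^sub>v v + (-1) \<cdot>\<^sub>v w = 0\<^sub>v (length \<beta>)"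
    using b v w unfolding is_basis_iff by auto
  hence "(1 \<cdot>\<^sub>v v + (-1) \<cdot>\<^sub>v w) $ i = 0" if "i < length \<beta>" for i using that by simp
  thus ?thesis using v w by (intro eq_vecI) auto
qed

lemma coords_comb:
  assumes b: "is_basis m V \<beta>" and v: "v \<in> carrier_vec (length \<beta>)"
  shows "coords m \<beta> (comb m \<beta> v) = list_of_vec v"
  unfolding coords_def
proof (rule the_equality)
  have c: "set \<beta> \<subseteq> carrier_mat m m" using b by (simp add: is_basis_def)
  show "length (list_of_vec v) = length \<beta> \<and> comb m \<beta> v = lincomb m (list_of_vec v) \<beta>"
    using lincomb_list_of_vec[OF v c] v by simp
  fix cs assume cs: "length cs = length \<beta> \<and> comb m \<beta> v = lincomb m cs \<beta>"
  hence "comb m \<beta> v = comb m \<beta> (vec_of_list cs)" using lincomb_eq_comb[OF _ c] by simp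
  moreover have "vec_of_list cs \<in> carrier_vec (length \<beta>)" using cs by (intro carrier_vecI) simp
  ultimately have "v = vec_of_list cs" using comb_inj[OF b v] by blast
  thus "cs = list_of_vec v" by (simp add: list_vec)
qed

lemma msubspace_mspan:
  assumes "set Xs \<subseteq> carrier_mat m m"
  shows "msubspace m (mspan m Xs)"
proof -
  have "0\<^sub>m m m \<in> mspan m Xs" unfolding mspan_eq[OF assms]
    using comb_zero[of m Xs] by (metis imageI zero_carrier_vec)
  moreover have "a \<cdot>\<^sub>m X + b \<cdot>\<^sub>m Y \<in> mspan m Xs" if "X \<in> mspan m Xs" "Y \<in> mspan m Xs" for X Y a b
    using that unfolding mspan_eq[OF assms] by (auto simp: comb_linear[symmetric])
  ultimately show ?thesis unfolding msubspace_def mspan_eq[OF assms] by auto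
qed

lemma set_subset_mspan:
  assumes "set Xs \<subseteq> carrier_mat m m"
  shows "set Xs \<subseteq> mspan m Xs"
proof
  fix X assume "X \<in> set Xs"
  then obtain j where "j < length Xs" "X = Xs ! j" by (auto simp: in_set_conv_nth)
  thus "X \<in> mspan m Xs" unfolding mspan_eq[OF assms] using comb_unit_vec[OF _ assms]
    by (metis image_eqI unit_vec_carrier)
qed

lemma is_basis_msubspace: "is_basis m V \<beta> \<Longrightarrow> msubspace m V"
  unfolding is_basis_def using msubspace_mspan by auto

lemma is_basis_subset: "is_basis m V \<beta> \<Longrightarrow> set \<beta> \<subseteq> V"
  unfolding is_basis_def using set_subset_mspan by auto

lemma linear_on_zero:
  assumes "msubspace m V" "linear_on m V \<phi>"
  shows "\<phi> (0\<^sub>m m m) = 0\<^sub>m m m"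
proof -
  have V: "0\<^sub>m m m \<in> V" "\<phi> (0\<^sub>m m m) \<in> carrier_mat m m" using assms unfolding msubspace_def linear_on_def by auto
  have "\<phi> (0 \<cdot>\<^sub>m 0\<^sub>m m m + 0 \<cdot>\<^sub>m 0\<^sub>m m m) = 0 \<cdot>\<^sub>m \<phi> (0\<^sub>m m m) + 0 \<cdot>\<^sub>m \<phi> (0\<^sub>m m m)"
    using assms V unfolding linear_on_def by blast
  moreover have "0 \<cdot>\<^sub>m 0\<^sub>m m m + 0 \<cdot>\<^sub>m 0\<^sub>m m m = (0\<^sub>m m m :: complex mat)" by (rule eq_matI) auto
  moreover have "0 \<cdot>\<^sub>m \<phi> (0\<^sub>m m m) + 0 \<cdot>\<^sub>m \<phi> (0\<^sub>m m m) = 0\<^sub>m m m" using V by (intro eq_matI) auto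
  ultimately show ?thesis by simp
qed

lemma linear_on_lincomb:
  assumes V: "msubspace m V" and lin: "linear_on m V \<phi>"
    and "length cs = length Xs" "set Xs \<subseteq> V"
  shows "lincomb m cs Xs \<in> V \<and> \<phi> (lincomb m cs Xs) = lincomb m cs (map \<phi> Xs)"
  using assms(3,4)
proof (induction cs Xs rule: list_induct2)
  case Nil show ?case using V linear_on_zero[OF V lin] by (auto simp: lincomb_def msubspace_def)
next
  case (Cons c cs X Xs)
  hence IH: "lincomb m cs Xs \<in> V" "\<phi> (lincomb m cs Xs) = lincomb m cs (map \<phi> Xs)" and X: "X \<in> V" by auto
  have one: "1 \<cdot>\<^sub>m Y = Y" if "Y \<in> carrier_mat m m" for Y :: "complex mat" using that by (intro eq_matI) auto
  have eq: "lincomb m (c # cs) (X # Xs) = c \<cdot>\<^sub>m X + 1 \<cdot>\<^sub>m lincomb m cs Xs"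
    unfolding lincomb_Cons using one IH(1) V unfolding msubspace_def by auto
  have "\<phi> (c \<cdot>\<^sub>m X + 1 \<cdot>\<^sub>m lincomb m cs Xs) = c \<cdot>\<^sub>m \<phi> X + 1 \<cdot>\<^sub>m \<phi> (lincomb m cs Xs)"
    using lin IH(1) X unfolding linear_on_def by blast
  also have "\<dots> = lincomb m (c # cs) (map \<phi> (X # Xs))"
    using one[of "\<phi> (lincomb m cs Xs)"] IH lin V by (auto simp: lincomb_Cons linear_on_def msubspace_def)
  finally show ?case using V X IH(1) unfolding eq msubspace_def by blast
qed

lemma linear_on_comb:
  assumes V: "msubspace m V" and lin: "linear_on m V \<phi>"
    and v: "v \<in> carrier_vec (length Xs)" and X: "set Xs \<subseteq> V"
  shows "comb m Xs v \<in> V" "\<phi> (comb m Xs v) = comb m (map \<phi> Xs) v"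
proof -
  have c: "set Xs \<subseteq> carrier_mat m m" "set (map \<phi> Xs) \<subseteq> carrier_mat m m"
    using X V lin unfolding msubspace_def linear_on_def by auto
  have l: "length (list_of_vec v) = length Xs" using v by simp
  note * = linear_on_lincomb[OF V lin l X]
  show "comb m Xs v \<in> V" "\<phi> (comb m Xs v) = comb m (map \<phi> Xs) v"
    using * unfolding lincomb_list_of_vec[OF v c(1)]
    using lincomb_list_of_vec[of v "map \<phi> Xs" m] v c by auto
qed

text \<open>The columns of \<open>P\<close> are the \<open>\<beta>\<close>-coordinates of the
  members of \<open>Ys\<close>. With \<open>Ys\<close> the images of \<open>\<beta>\<close> under a
  map, \<open>P\<close> is the matrix of that map; with \<open>Ys\<close> another basis,
  \<open>P\<close> is the change of basis.\<close>

lemma basis_transition: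
  assumes b: "is_basis m V \<beta>" and Y: "set Ys \<subseteq> V"
  obtains P where "P \<in> carrier_mat (length \<beta>) (length Ys)"
    "\<And>v. v \<in> carrier_vec (length Ys) \<Longrightarrow> comb m Ys v = comb m \<beta> (P *\<^sub>v v)"
    "\<And>j. j < length Ys \<Longrightarrow> Ys ! j = comb m \<beta> (col P j)"
proof -
  have "\<forall>j<length Ys. \<exists>w\<in>carrier_vec (length \<beta>). Ys ! j = comb m \<beta> w"
    using b Y unfolding is_basis_iff by (metis imageE nth_mem subset_eq)
  then obtain w where w: "\<And>j. j < length Ys \<Longrightarrow> w j \<in> carrier_vec (length \<beta>)"
    "\<And>j. j < length Ys \<Longrightarrow> Ys ! j = comb m \<beta> (w j)" by metis
  define P where "P = mat (length \<beta>) (length Ys) (\<lambda>(i,j). w j $ i)"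
  have P: "P \<in> carrier_mat (length \<beta>) (length Ys)" by (simp add: P_def)
  have col: "col P j = w j" if "j < length Ys" for j
    using that w(1)[OF that] by (intro eq_vecI) (auto simp: P_def)
  show ?thesis
  proof (rule that[OF P])
    fix j assume "j < length Ys" thus "Ys ! j = comb m \<beta> (col P j)" using w(2) col by simp
  next
    fix v :: "complex vec" assume v: "v \<in> carrier_vec (length Ys)"
    show "comb m Ys v = comb m \<beta> (P *\<^sub>v v)"
    proof (rule eq_matI, goal_cases)
      case (1 a b)
      hence ab: "a < m" "b < m" by auto
      have "comb m Ys v $$ (a,b) = (\<Sum>j<length Ys. v $ j * (\<Sum>k<length \<beta>. w j $ k * \<beta> ! k $$ (a,b)))"
        using ab w(2) by (simp add: comb_index)
      also have "\<dots> = (\<Sum>j<length Ys. \<Sum>k<length \<beta>. v $ j * w j $ k * \<beta> ! k $$ (a,b))"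
        by (simp add: sum_distrib_left mult.assoc)
      also have "\<dots> = (\<Sum>k<length \<beta>. \<Sum>j<length Ys. v $ j * w j $ k * \<beta> ! k $$ (a,b))"
        by (rule sum.swap)
      also have "\<dots> = (\<Sum>k<length \<beta>. (P *\<^sub>v v) $ k * \<beta> ! k $$ (a,b))"
      proof (rule sum.cong[OF refl])
        fix k assume "k \<in> {..<length \<beta>}"
        hence "(P *\<^sub>v v) $ k = (\<Sum>j<length Ys. v $ j * w j $ k)"
          using v by (auto simp: P_def scalar_prod_def atLeast0LessThan mult.commute)
        thus "(\<Sum>j<length Ys. v $ j * w j $ k * \<beta> ! k $$ (a,b)) = (P *\<^sub>v v) $ k * \<beta> ! k $$ (a,b)"
          by (simp add: sum_distrib_right)
      qed
      finally show ?case using ab by (simp add: comb_index)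
    qed auto
  qed
qed

section \<open>The matrix of a linear map in a basis\<close>

lemma map_mat_carrier[simp]: "map_mat m \<beta> \<phi> \<in> carrier_mat (length \<beta>) (length \<beta>)"
  by (simp add: map_mat_def)

lemma map_mat_action:
  assumes b: "is_basis m V \<beta>" and lin: "linear_on m V \<phi>" and v: "v \<in> carrier_vec (length \<beta>)"
  shows "\<phi> (comb m \<beta> v) = comb m \<beta> (map_mat m \<beta> \<phi> *\<^sub>v v)"
proof -
  have Y: "set (map \<phi> \<beta>) \<subseteq> V" using is_basis_subset[OF b] lin unfolding linear_on_def by auto
  from basis_transition[OF b Y] obtain P where P: "P \<in> carrier_mat (length \<beta>) (length \<beta>)"
    "\<And>v. v \<in> carrier_vec (length \<beta>) \<Longrightarrow> comb m (map \<phi> \<beta>) v = comb m \<beta> (P *\<^sub>v v)"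
    "\<And>j. j < length \<beta> \<Longrightarrow> map \<phi> \<beta> ! j = comb m \<beta> (col P j)" by (metis length_map)
  have "map_mat m \<beta> \<phi> = P"
  proof (rule eq_matI, goal_cases)
    case (1 i j)
    hence "\<phi> (\<beta> ! j) = comb m \<beta> (col P j)" using P by auto
    moreover have "col P j \<in> carrier_vec (length \<beta>)" using P(1) by (intro carrier_vecI) auto
    ultimately show ?case using 1 P(1) coords_comb[OF b] by (simp add: map_mat_def list_of_vec_index)
  qed (use P in \<open>auto simp: map_mat_def\<close>)
  thus ?thesis using linear_on_comb(2)[OF is_basis_msubspace[OF b] lin v is_basis_subset[OF b]] P(2)[OF v] by simp
qed

text \<open>Unit vectors recover the columns. Every identification of a coordinate matrix below
  (powers, change of basis, extension by zero) thereby becomes a check of its action on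
  vectors.\<close>

lemma map_mat_eqI:
  assumes b: "is_basis m V \<beta>" and A: "A \<in> carrier_mat (length \<beta>) (length \<beta>)"
    and act: "\<And>v. v \<in> carrier_vec (length \<beta>) \<Longrightarrow> \<phi> (comb m \<beta> v) = comb m \<beta> (A *\<^sub>v v)"
  shows "map_mat m \<beta> \<phi> = A"
proof (rule eq_matI, goal_cases)
  case (1 i j)
  hence j: "j < length \<beta>" "i < length \<beta>" using A by auto
  have "A *\<^sub>v unit_vec (length \<beta>) j = col A j" using A j
    by (intro eq_vecI) (auto simp: scalar_prod_right_unit[of _ "length \<beta>"])
  hence "\<phi> (\<beta> ! j) = comb m \<beta> (col A j)"
    using act[of "unit_vec (length \<beta>) j"] comb_unit_vec[OF j(1)] b by (simp add: is_basis_def)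
  moreover have "col A j \<in> carrier_vec (length \<beta>)" using A by (intro carrier_vecI) auto
  ultimately show ?case using j A coords_comb[OF b] by (simp add: map_mat_def list_of_vec_index)
qed (use A in \<open>auto simp: map_mat_def\<close>)

lemma funpow_comb:
  assumes b: "is_basis m V \<beta>" and lin: "linear_on m V \<phi>" and v: "v \<in> carrier_vec (length \<beta>)"
  shows "(\<phi> ^^ n) (comb m \<beta> v) = comb m \<beta> ((map_mat m \<beta> \<phi> ^\<^sub>m n) *\<^sub>v v)"
  using v
proof (induction n arbitrary: v)
  case 0 thus ?case by (simp add: map_mat_def)
next
  case (Suc n)
  let ?A = "map_mat m \<beta> \<phi>"
  have Av: "?A *\<^sub>v v \<in> carrier_vec (length \<beta>)" using Suc.prems by (rule mult_mat_vec_carrier[OF map_mat_carrier])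
  have "(\<phi> ^^ Suc n) (comb m \<beta> v) = (\<phi> ^^ n) (comb m \<beta> (?A *\<^sub>v v))"
    unfolding funpow_Suc_right o_def map_mat_action[OF b lin Suc.prems] ..
  also have "\<dots> = comb m \<beta> ((?A ^\<^sub>m n) *\<^sub>v (?A *\<^sub>v v))" by (rule Suc.IH[OF Av])
  also have "(?A ^\<^sub>m n) *\<^sub>v (?A *\<^sub>v v) = (?A ^\<^sub>m Suc n) *\<^sub>v v"
    using assoc_mult_mat_vec[OF pow_carrier_mat[OF map_mat_carrier] map_mat_carrier Suc.prems] by simp
  finally show ?case .
qed

lemma map_mat_funpow:
  assumes "is_basis m V \<beta>" "linear_on m V \<phi>"
  shows "map_mat m \<beta> (\<phi> ^^ n) = map_mat m \<beta> \<phi> ^\<^sub>m n"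
  by (rule map_mat_eqI[OF assms(1)]) (auto intro: funpow_comb[OF assms])

section \<open>Change of basis and Jordan bases\<close>

lemma mat_eqI_mult_vec:
  fixes A B :: "complex mat"
  assumes A: "A \<in> carrier_mat n k" and B: "B \<in> carrier_mat n k"
    and eq: "\<And>v. v \<in> carrier_vec k \<Longrightarrow> A *\<^sub>v v = B *\<^sub>v v"
  shows "A = B"
proof (rule eq_matI)
  fix i j assume ij: "i < dim_row B" "j < dim_col B"
  have "(A *\<^sub>v unit_vec k j) $ i = (B *\<^sub>v unit_vec k j) $ i" using eq by simp
  thus "A $$ (i,j) = B $$ (i,j)" using A B ij by auto
qed (use A B in auto)

text \<open>Comparison of traces: \<open>n\<close> is the trace of \<open>P * Q\<close>,
  \<open>k\<close> that of \<open>Q * P\<close>, and the two agree. This shows that two bases of the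
  same space have equal length.\<close>

lemma square_of_mutually_inverse:
  fixes P Q :: "complex mat"
  assumes P: "P \<in> carrier_mat n k" and Q: "Q \<in> carrier_mat k n" and PQ: "P * Q = 1\<^sub>m n" and QP: "Q * P = 1\<^sub>m k"
  shows "n = k"
proof -
  have "of_nat n = (\<Sum>i<n. (P * Q) $$ (i,i))" unfolding PQ by simp
  also have "\<dots> = (\<Sum>i<n. \<Sum>j<k. P $$ (i,j) * Q $$ (j,i))"
    using P Q by (intro sum.cong refl) (auto simp: scalar_prod_def atLeast0LessThan)
  also have "\<dots> = (\<Sum>j<k. \<Sum>i<n. P $$ (i,j) * Q $$ (j,i))" by (rule sum.swap)
  also have "\<dots> = (\<Sum>j<k. (Q * P) $$ (j,j))"
    using P Q by (intro sum.cong refl) (auto simp: scalar_prod_def atLeast0LessThan mult.commute)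
  also have "\<dots> = of_nat k" unfolding QP by simp
  finally have "(of_nat n :: complex) = of_nat k" .
  thus ?thesis by simp
qed

lemma basis_transition_inverse:
  assumes b: "is_basis m V \<beta>" and P: "P \<in> carrier_mat (length \<beta>) k" and Q: "Q \<in> carrier_mat k (length \<beta>)"
    and eq: "\<And>v. v \<in> carrier_vec (length \<beta>) \<Longrightarrow> comb m \<beta> v = comb m \<beta> (P *\<^sub>v (Q *\<^sub>v v))"
  shows "P * Q = 1\<^sub>m (length \<beta>)"
proof (rule mat_eqI_mult_vec[of _ "length \<beta>" "length \<beta>"])
  fix v :: "complex vec" assume v: "v \<in> carrier_vec (length \<beta>)"
  have "P *\<^sub>v (Q *\<^sub>v v) \<in> carrier_vec (length \<beta>)" using P Q v by auto
  from comb_inj[OF b v this eq[OF v]] show "P * Q *\<^sub>v v = 1\<^sub>m (length \<beta>) *\<^sub>v v" using P Q v by simp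
qed (use P Q in auto)

text \<open>The transition matrices in both directions are mutually inverse because coordinates are
  unique, and they conjugate one coordinate matrix into the other.\<close>

lemma map_mat_similar:
  assumes b: "is_basis m V \<beta>" and b': "is_basis m V \<beta>'" and lin: "linear_on m V \<phi>"
  shows "similar_mat (map_mat m \<beta>' \<phi>) (map_mat m \<beta> \<phi>)"
proof -
  obtain P where P: "P \<in> carrier_mat (length \<beta>) (length \<beta>')"
    "\<And>v. v \<in> carrier_vec (length \<beta>') \<Longrightarrow> comb m \<beta>' v = comb m \<beta> (P *\<^sub>v v)"
    using basis_transition[OF b is_basis_subset[OF b']] by metis
  obtain Q where Q: "Q \<in> carrier_mat (length \<beta>') (length \<beta>)"
    "\<And>v. v \<in> carrier_vec (length \<beta>) \<Longrightarrow> comb m \<beta> v = comb m \<beta>' (Q *\<^sub>v v)"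
    using basis_transition[OF b' is_basis_subset[OF b]] by metis
  have PQ: "P * Q = 1\<^sub>m (length \<beta>)"
    by (rule basis_transition_inverse[OF b P(1) Q(1)]) (metis P(2) Q mult_mat_vec_carrier)
  have QP: "Q * P = 1\<^sub>m (length \<beta>')"
    by (rule basis_transition_inverse[OF b' Q(1) P(1)]) (metis P Q(2) mult_mat_vec_carrier)
  have len: "length \<beta> = length \<beta>'" by (rule square_of_mutually_inverse[OF P(1) Q(1) PQ QP])
  define A where "A = map_mat m \<beta> \<phi>"
  have A: "A \<in> carrier_mat (length \<beta>) (length \<beta>)" by (simp add: A_def)
  have "map_mat m \<beta>' \<phi> = Q * A * P"
  proof (rule map_mat_eqI[OF b'])
    show "Q * A * P \<in> carrier_mat (length \<beta>') (length \<beta>')" using P Q A by auto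
    fix v :: "complex vec" assume v: "v \<in> carrier_vec (length \<beta>')"
    have Pv: "P *\<^sub>v v \<in> carrier_vec (length \<beta>)" using P v by auto
    have "\<phi> (comb m \<beta>' v) = comb m \<beta>' (Q *\<^sub>v (A *\<^sub>v (P *\<^sub>v v)))"
      unfolding P(2)[OF v] map_mat_action[OF b lin Pv] A_def[symmetric]
      using A Pv by (intro Q(2)) auto
    also have "Q *\<^sub>v (A *\<^sub>v (P *\<^sub>v v)) = Q * A * P *\<^sub>v v"
      using assoc_mult_mat_vec[OF mult_carrier_mat[OF Q(1) A] P(1) v] assoc_mult_mat_vec[OF Q(1) A Pv] by simp
    finally show "\<phi> (comb m \<beta>' v) = comb m \<beta>' (Q * A * P *\<^sub>v v)" .
  qed
  thus ?thesis using A P(1) Q(1) PQ QP len A_def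
    by (intro similar_matI[of _ _ Q P "length \<beta>'"]) auto
qed

text \<open>Over the complex numbers the characteristic polynomial splits, so the coordinate matrix
  has the form \<open>P * J * Q\<close> with \<open>J\<close> a Jordan matrix and \<open>Q\<close>
  inverse to \<open>P\<close>.\<close>

lemma jordan_basis_exists:
  assumes b: "is_basis m V \<beta>" and lin: "linear_on m V \<phi>"
  obtains \<beta>' where "jordan_basis m V \<phi> \<beta>'"
proof -
  define d where "d = length \<beta>"
  define A where "A = map_mat m \<beta> \<phi>"
  have A: "A \<in> carrier_mat d d" by (simp add: A_def d_def)
  from char_poly_factorized[OF A] obtain as where "char_poly A = (\<Prod>a\<leftarrow>as. [:- a, 1:])" by auto
  from jordan_nf_exists[OF A this] obtain n_as where "jordan_nf A n_as" ..
  hence "similar_mat A (jordan_matrix n_as)" by (simp add: jordan_nf_def)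
  then obtain d' P Q where 1: "{A, jordan_matrix n_as, P, Q} \<subseteq> carrier_mat d' d'"
    and PQ: "P * Q = 1\<^sub>m d'" and QP: "Q * P = 1\<^sub>m d'" and APQ: "A = P * jordan_matrix n_as * Q"
    using similar_matD by blast
  define J where "J = jordan_matrix n_as"
  have d': "d' = d" using 1 A by auto
  have P: "P \<in> carrier_mat d d" and Q: "Q \<in> carrier_mat d d" and J: "J \<in> carrier_mat d d"
    using 1 by (auto simp: d' J_def)
  note PQ = PQ[unfolded d'] and QP = QP[unfolded d']
  \<comment> \<open>The new basis has the columns of \<open>P\<close> as its
    \<open>\<beta>\<close>-coordinates, so \<open>P\<close> carries new coordinates to old
    ones.\<close>
  define \<beta>' where "\<beta>' = map (\<lambda>j. comb m \<beta> (col P j)) [0..<d]"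
  have len: "length \<beta>' = d" by (simp add: \<beta>'_def)
  have c: "comb m \<beta>' v = comb m \<beta> (P *\<^sub>v v)" if v: "v \<in> carrier_vec d" for v
  proof (rule eq_matI, goal_cases)
    case (1 a b)
    hence ab: "a < m" "b < m" by auto
    have "comb m \<beta>' v $$ (a,b) = (\<Sum>j<d. v $ j * (\<Sum>k<d. P $$ (k,j) * \<beta> ! k $$ (a,b)))"
      using ab P by (auto simp: comb_index len d_def[symmetric] \<beta>'_def intro!: sum.cong)
    also have "\<dots> = (\<Sum>j<d. \<Sum>k<d. P $$ (k,j) * v $ j * \<beta> ! k $$ (a,b))"
      by (simp add: sum_distrib_left mult_ac)
    also have "\<dots> = (\<Sum>k<d. \<Sum>j<d. P $$ (k,j) * v $ j * \<beta> ! k $$ (a,b))"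
      by (rule sum.swap)
    also have "\<dots> = (\<Sum>k<d. (P *\<^sub>v v) $ k * \<beta> ! k $$ (a,b))"
    proof (rule sum.cong[OF refl])
      fix k assume "k \<in> {..<d}"
      hence "(P *\<^sub>v v) $ k = (\<Sum>j<d. P $$ (k,j) * v $ j)"
        using v P by (auto simp: scalar_prod_def atLeast0LessThan)
      thus "(\<Sum>j<d. P $$ (k,j) * v $ j * \<beta> ! k $$ (a,b)) = (P *\<^sub>v v) $ k * \<beta> ! k $$ (a,b)"
        by (simp add: sum_distrib_right)
    qed
    finally show ?case using ab by (simp add: comb_index d_def)
  qed auto
  have inv: "Q *\<^sub>v (P *\<^sub>v v) = v" "P *\<^sub>v (Q *\<^sub>v v) = v" if "v \<in> carrier_vec d" for v
    using assoc_mult_mat_vec[OF Q P that] assoc_mult_mat_vec[OF P Q that] PQ QP that by simp_all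
  have b': "is_basis m V \<beta>'" unfolding is_basis_iff len
  proof (intro conjI ballI impI)
    show "set \<beta>' \<subseteq> carrier_mat m m" by (auto simp: \<beta>'_def)
  next
    fix v assume v: "v \<in> carrier_vec d" "comb m \<beta>' v = 0\<^sub>m m m"
    have "P *\<^sub>v v \<in> carrier_vec d" using P v(1) by auto
    hence "P *\<^sub>v v = 0\<^sub>v d" using b v c[OF v(1)] unfolding is_basis_iff d_def by auto
    hence "v = Q *\<^sub>v 0\<^sub>v d" using inv(1)[OF v(1)] by simp
    thus "v = 0\<^sub>v d" using Q by (auto intro!: eq_vecI)
  next
    have "comb m \<beta>' ` carrier_vec d = comb m \<beta> ` carrier_vec d"
    proof (intro equalityI subsetI)
      fix X assume "X \<in> comb m \<beta>' ` carrier_vec d"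
      then obtain v where v: "v \<in> carrier_vec d" "X = comb m \<beta>' v" by auto
      thus "X \<in> comb m \<beta> ` carrier_vec d" unfolding v(2) c[OF v(1)] using P by (intro imageI) auto
    next
      fix X assume "X \<in> comb m \<beta> ` carrier_vec d"
      then obtain v where v: "v \<in> carrier_vec d" "X = comb m \<beta> v" by auto
      have Qv: "Q *\<^sub>v v \<in> carrier_vec d" using Q v by auto
      have "X = comb m \<beta>' (Q *\<^sub>v v)" unfolding c[OF Qv] inv(2)[OF v(1)] v(2) ..
      thus "X \<in> comb m \<beta>' ` carrier_vec d" using Qv by auto
    qed
    thus "comb m \<beta>' ` carrier_vec d = V" using b unfolding is_basis_iff d_def by simp
  qed
  have "map_mat m \<beta>' \<phi> = J"
  proof (rule map_mat_eqI[OF b'], unfold len)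
    show "J \<in> carrier_mat d d" by (rule J)
    fix v :: "complex vec" assume v: "v \<in> carrier_vec d"
    have Pv: "P *\<^sub>v v \<in> carrier_vec d" using P v by auto
    have Jv: "J *\<^sub>v v \<in> carrier_vec d" using J v by auto
    have "A *\<^sub>v (P *\<^sub>v v) = P *\<^sub>v (J *\<^sub>v (Q *\<^sub>v (P *\<^sub>v v)))"
      unfolding APQ J_def[symmetric]
      using assoc_mult_mat_vec[OF mult_carrier_mat[OF P J] Q Pv] assoc_mult_mat_vec[OF P J, of "Q *\<^sub>v (P *\<^sub>v v)"] Q Pv
      by simp
    also have "\<dots> = P *\<^sub>v (J *\<^sub>v v)" unfolding inv(1)[OF v] ..
    finally have *: "A *\<^sub>v (P *\<^sub>v v) = P *\<^sub>v (J *\<^sub>v v)" .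
    show "\<phi> (comb m \<beta>' v) = comb m \<beta>' (J *\<^sub>v v)"
      unfolding c[OF v] c[OF Jv] using map_mat_action[OF b lin] Pv * unfolding A_def d_def by simp
  qed
  with b' show ?thesis by (intro that[of \<beta>']) (auto simp: jordan_basis_def J_def)
qed

section \<open>Existence of bases\<close>

lemma msubspace_add_smult:
  assumes "msubspace m V" "X \<in> V" "Y \<in> V"
  shows "1 \<cdot>\<^sub>m X + c \<cdot>\<^sub>m Y \<in> V"
  using assms unfolding msubspace_def by blast

lemma vec_Suc_cases:
  fixes v :: "'a vec"
  assumes "v \<in> carrier_vec (Suc n)"
  obtains c w where "v = vCons c w" "w \<in> carrier_vec n"
proof (rule that)
  show "v = vCons (v $ 0) (vec n (\<lambda>i. v $ Suc i))"
    using assms by (intro eq_vecI) (auto simp: vec_index_vCons)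
qed simp

text \<open>Gaussian elimination, one matrix position at a time.\<close>

lemma msubspace_has_basis_aux:
  assumes "finite S" "msubspace m V" "\<And>X i j. X \<in> V \<Longrightarrow> i < m \<Longrightarrow> j < m \<Longrightarrow> (i,j) \<notin> S \<Longrightarrow> X $$ (i,j) = 0"
    "S \<subseteq> {..<m} \<times> {..<m}"
  shows "\<exists>\<beta>. is_basis m V \<beta>"
  using assms
proof (induction S arbitrary: V rule: finite_induct)
  case empty
  have "V = {0\<^sub>m m m}"
  proof (intro equalityI subsetI)
    fix X assume X: "X \<in> V"
    hence "X \<in> carrier_mat m m" using empty.prems(1) unfolding msubspace_def by auto
    hence "X = 0\<^sub>m m m" using empty.prems(2)[OF X] by (intro eq_matI) auto
    thus "X \<in> {0\<^sub>m m m}" by simp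
  qed (use empty.prems(1) in \<open>auto simp: msubspace_def\<close>)
  moreover have "comb m [] v = 0\<^sub>m m m" for v by (rule eq_matI) (auto simp: comb_index)
  ultimately have "is_basis m V []" unfolding is_basis_iff
    by (auto intro!: eq_vecI image_eqI[of _ _ "0\<^sub>v 0"])
  thus ?case by blast
next
  case (insert p S)
  obtain p1 p2 where p: "p = (p1,p2)" by (cases p)
  have pm: "p1 < m" "p2 < m" using insert.prems(3) p by auto
  \<comment> \<open>The kernel of evaluation at \<open>p\<close> has codimension at most 1 in
    \<open>V\<close>: either it is all of \<open>V\<close>, or a single \<open>X0\<close> not
    vanishing at \<open>p\<close> completes its basis.\<close>
  define W where "W = {X \<in> V. X $$ p = 0}"
  have Vc: "X \<in> carrier_mat m m" if "X \<in> V" for X using insert.prems(1) that unfolding msubspace_def by auto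
  have "(a \<cdot>\<^sub>m X + b \<cdot>\<^sub>m Y) $$ p = a * X $$ p + b * Y $$ p" if "X \<in> V" "Y \<in> V" for X Y a b
    using Vc[OF that(1)] Vc[OF that(2)] pm by (simp add: p)
  hence W: "msubspace m W"
    using insert.prems(1) pm unfolding msubspace_def W_def by (auto simp: p)
  have "\<exists>\<beta>. is_basis m W \<beta>"
  proof (rule insert.IH[OF W])
    fix X i j assume "X \<in> W" "i < m" "j < m" "(i,j) \<notin> S"
    thus "X $$ (i,j) = 0" using insert.prems(2)[of X i j] p unfolding W_def by (cases "(i,j) = p") auto
  qed (use insert.prems(3) in auto)
  then obtain \<beta> where \<beta>: "is_basis m W \<beta>" by blast
  show ?case
  proof (cases "W = V")
    case True thus ?thesis using \<beta> by auto
  next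
    case False
    then obtain X0 where X0: "X0 \<in> V" "X0 $$ p \<noteq> 0" by (auto simp: W_def)
    have X0c: "X0 \<in> carrier_mat m m" by (rule Vc[OF X0(1)])
    have bc: "set \<beta> \<subseteq> carrier_mat m m" using \<beta> by (simp add: is_basis_def)
    have cc: "comb m (X0 # \<beta>) (vCons c w) = c \<cdot>\<^sub>m X0 + 1 \<cdot>\<^sub>m comb m \<beta> w" for c w
      using X0c by (intro eq_matI) (auto simp: comb_index sum.lessThan_Suc_shift simp del: sum.lessThan_Suc)
    have inW: "comb m \<beta> w \<in> W" if "w \<in> carrier_vec (length \<beta>)" for w using \<beta> that unfolding is_basis_iff by blast
    have "is_basis m V (X0 # \<beta>)" unfolding is_basis_iff
    proof (intro conjI ballI impI)
      show "set (X0 # \<beta>) \<subseteq> carrier_mat m m" using X0c bc by simp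
    next
      fix v assume v: "v \<in> carrier_vec (length (X0 # \<beta>))" "comb m (X0 # \<beta>) v = 0\<^sub>m m m"
      from v(1) obtain c w where cw: "v = vCons c w" "w \<in> carrier_vec (length \<beta>)"
        using vec_Suc_cases[of v "length \<beta>"] by auto
      have "(c \<cdot>\<^sub>m X0 + 1 \<cdot>\<^sub>m comb m \<beta> w) $$ p = 0" using v(2) pm unfolding cw(1) cc p by simp
      hence "c * X0 $$ p = 0" using X0c pm inW[OF cw(2)] unfolding p W_def by simp
      hence c: "c = 0" using X0(2) by simp
      have "comb m \<beta> w = c \<cdot>\<^sub>m X0 + 1 \<cdot>\<^sub>m comb m \<beta> w" using X0c c by (intro eq_matI) auto
      hence "comb m \<beta> w = 0\<^sub>m m m" using v(2) unfolding cw(1) cc by simp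
      hence "w = 0\<^sub>v (length \<beta>)" using \<beta> cw(2) unfolding is_basis_iff by auto
      thus "v = 0\<^sub>v (length (X0 # \<beta>))" unfolding cw(1) c by (simp add: zero_vec_Suc)
    next
      show "comb m (X0 # \<beta>) ` carrier_vec (length (X0 # \<beta>)) = V"
      proof (intro equalityI subsetI)
        fix X assume "X \<in> comb m (X0 # \<beta>) ` carrier_vec (length (X0 # \<beta>))"
        then obtain v where v: "v \<in> carrier_vec (Suc (length \<beta>))" "X = comb m (X0 # \<beta>) v" by auto
        from v(1) obtain c w where cw: "v = vCons c w" "w \<in> carrier_vec (length \<beta>)"
          using vec_Suc_cases[of v "length \<beta>"] by auto
        show "X \<in> V" unfolding v(2) cw(1) cc
          using insert.prems(1) X0(1) inW[OF cw(2)] unfolding msubspace_def W_def by blast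
      next
        fix X assume X: "X \<in> V"
        \<comment> \<open>Chosen so that \<open>X - c * X0\<close> vanishes at \<open>p\<close> and
          thus lies in \<open>W\<close>.\<close>
        define c where "c = X $$ p / X0 $$ p"
        have Xc: "X \<in> carrier_mat m m" by (rule Vc[OF X])
        have "1 \<cdot>\<^sub>m X + (-c) \<cdot>\<^sub>m X0 \<in> W" unfolding W_def
          using msubspace_add_smult[OF insert.prems(1) X X0(1), of "-c"] X0(2) pm Xc X0c
          by (auto simp: p c_def)
        then obtain w where w: "w \<in> carrier_vec (length \<beta>)" "1 \<cdot>\<^sub>m X + (-c) \<cdot>\<^sub>m X0 = comb m \<beta> w"
          using \<beta> unfolding is_basis_iff by (metis imageE)
        have "X = c \<cdot>\<^sub>m X0 + 1 \<cdot>\<^sub>m comb m \<beta> w" unfolding w(2)[symmetric] using Xc X0c by (intro eq_matI) auto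
        hence "X = comb m (X0 # \<beta>) (vCons c w)" unfolding cc .
        thus "X \<in> comb m (X0 # \<beta>) ` carrier_vec (length (X0 # \<beta>))"
          using w(1) by (intro image_eqI) auto
      qed
    qed
    thus ?thesis by blast
  qed
qed

lemma msubspace_has_basis:
  assumes "msubspace m V"
  obtains \<beta> where "is_basis m V \<beta>"
proof -
  have "\<exists>\<beta>. is_basis m V \<beta>"
    by (rule msubspace_has_basis_aux[of "{..<m} \<times> {..<m}", OF _ assms]) auto
  with that show ?thesis by blast
qed

section \<open>Direct sums, and Jordan bases of a map extended by zero\<close>

lemma sum_lessThan_add:
  fixes f :: "nat \<Rightarrow> 'a :: comm_monoid_add"
  shows "(\<Sum>k<q+d. f k) = (\<Sum>k<q. f k) + (\<Sum>k<d. f (q+k))"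
  by (induction d) (auto simp: add.assoc)

lemma comb_append:
  assumes "w \<in> carrier_vec (length \<gamma>)" "v \<in> carrier_vec (length \<beta>)"
  shows "comb m (\<gamma> @ \<beta>) (w @\<^sub>v v) = comb m \<gamma> w + comb m \<beta> v"
proof (rule eq_matI, goal_cases)
  case (1 i j)
  have "(\<Sum>k<length \<gamma>. (w @\<^sub>v v) $ k * (\<gamma> @ \<beta>) ! k $$ (i,j)) = (\<Sum>k<length \<gamma>. w $ k * \<gamma> ! k $$ (i,j))"
    using assms by (intro sum.cong refl) (auto simp: nth_append)
  moreover have "(\<Sum>k<length \<beta>. (w @\<^sub>v v) $ (length \<gamma> + k) * (\<gamma> @ \<beta>) ! (length \<gamma> + k) $$ (i,j))
      = (\<Sum>k<length \<beta>. v $ k * \<beta> ! k $$ (i,j))"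
    using assms by (intro sum.cong refl) (auto simp: nth_append)
  ultimately show ?case using 1 by (simp add: comb_index sum_lessThan_add)
qed auto

lemma vec_append_cases:
  fixes u :: "'a vec"
  assumes "u \<in> carrier_vec (q + d)"
  obtains w v where "u = w @\<^sub>v v" "w \<in> carrier_vec q" "v \<in> carrier_vec d"
  using assms vec_first_last_append[OF assms] by (metis vec_first_carrier vec_last_carrier)

lemma is_basis_append:
  assumes g: "is_basis m W \<gamma>" and b: "is_basis m V \<beta>"
    and int: "W \<inter> V \<subseteq> {0\<^sub>m m m}" and U: "U = {X + Y | X Y. X \<in> W \<and> Y \<in> V}"
  shows "is_basis m U (\<gamma> @ \<beta>)"
  unfolding is_basis_iff
proof (intro conjI ballI impI)
  show "set (\<gamma> @ \<beta>) \<subseteq> carrier_mat m m" using g b by (auto simp: is_basis_def)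
next
  fix u assume u: "u \<in> carrier_vec (length (\<gamma> @ \<beta>))" "comb m (\<gamma> @ \<beta>) u = 0\<^sub>m m m"
  from u(1) have "u \<in> carrier_vec (length \<gamma> + length \<beta>)" by simp
  from vec_append_cases[OF this] obtain w v where wv: "u = w @\<^sub>v v" "w \<in> carrier_vec (length \<gamma>)" "v \<in> carrier_vec (length \<beta>)" .
  from u(2) have sum0: "comb m \<gamma> w + comb m \<beta> v = 0\<^sub>m m m" unfolding wv(1) comb_append[OF wv(2,3)] .
  \<comment> \<open>The negative of the \<open>V\<close>-part, written with two summands to fit the
    closure condition of \<open>msubspace\<close>. The \<open>W\<close>-part therefore also lies in
    \<open>V\<close>, hence is 0.\<close>
  have "comb m \<gamma> w = 0 \<cdot>\<^sub>m comb m \<beta> v + (-1) \<cdot>\<^sub>m comb m \<beta> v"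
  proof (rule eq_matI, goal_cases)
    case (1 i j)
    have "(comb m \<gamma> w + comb m \<beta> v) $$ (i,j) = 0" unfolding sum0 using 1 by simp
    thus ?case using 1 by (simp add: eq_neg_iff_add_eq_0)
  qed auto
  moreover have vV: "comb m \<beta> v \<in> V" and wW: "comb m \<gamma> w \<in> W" using g b wv unfolding is_basis_iff by blast+
  ultimately have "comb m \<gamma> w \<in> V" using is_basis_msubspace[OF b] unfolding msubspace_def by auto
  with wW int have w0: "comb m \<gamma> w = 0\<^sub>m m m" by auto
  with sum0 have "comb m \<beta> v = 0\<^sub>m m m" by simp
  hence "v = 0\<^sub>v (length \<beta>)" using b wv(3) unfolding is_basis_iff by auto
  moreover have "w = 0\<^sub>v (length \<gamma>)" using w0 g wv(2) unfolding is_basis_iff by auto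
  ultimately show "u = 0\<^sub>v (length (\<gamma> @ \<beta>))" unfolding wv(1) by (intro eq_vecI) auto
next
  show "comb m (\<gamma> @ \<beta>) ` carrier_vec (length (\<gamma> @ \<beta>)) = U"
  proof (intro equalityI subsetI)
    fix X assume "X \<in> comb m (\<gamma> @ \<beta>) ` carrier_vec (length (\<gamma> @ \<beta>))"
    then obtain u where u: "u \<in> carrier_vec (length \<gamma> + length \<beta>)" "X = comb m (\<gamma> @ \<beta>) u" by auto
    from vec_append_cases[OF u(1)] obtain w v where wv: "u = w @\<^sub>v v" "w \<in> carrier_vec (length \<gamma>)" "v \<in> carrier_vec (length \<beta>)" .
    have "comb m \<beta> v \<in> V" "comb m \<gamma> w \<in> W" using g b wv unfolding is_basis_iff by blast+
    thus "X \<in> U" unfolding u(2) wv(1) comb_append[OF wv(2,3)] U by blast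
  next
    fix X assume "X \<in> U"
    then obtain Y Z where YZ: "X = Y + Z" "Y \<in> W" "Z \<in> V" unfolding U by blast
    obtain w where w: "w \<in> carrier_vec (length \<gamma>)" "Y = comb m \<gamma> w" using g YZ(2) unfolding is_basis_iff by blast
    obtain v where v: "v \<in> carrier_vec (length \<beta>)" "Z = comb m \<beta> v" using b YZ(3) unfolding is_basis_iff by blast
    show "X \<in> comb m (\<gamma> @ \<beta>) ` carrier_vec (length (\<gamma> @ \<beta>))"
      unfolding YZ(1) w(2) v(2) comb_append[OF w(1) v(1), symmetric] using w v by (intro imageI) auto
  qed
qed

text \<open>\<open>\<psi>\<close> kills \<open>W\<close> and acts as \<open>\<phi>\<close> on
  \<open>V\<close>, so each member of \<open>\<gamma>\<close> is a Jordan block of size 1 with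
  eigenvalue 0, placed before the blocks of \<open>\<phi>\<close>.\<close>

lemma jordan_basis_append_kernel:
  assumes g: "is_basis m W \<gamma>" and b: "is_basis m V \<beta>" and lin: "linear_on m V \<phi>"
    and J: "map_mat m \<beta> \<phi> = jordan_matrix n_as"
    and int: "W \<inter> V \<subseteq> {0\<^sub>m m m}" and U: "U = {X + Y | X Y. X \<in> W \<and> Y \<in> V}"
    and act: "\<And>X Y. X \<in> W \<Longrightarrow> Y \<in> V \<Longrightarrow> \<psi> (X + Y) = \<phi> Y"
  shows "is_basis m U (\<gamma> @ \<beta>)"
    "map_mat m (\<gamma> @ \<beta>) \<psi> = jordan_matrix (replicate (length \<gamma>) (1,0) @ n_as)"
proof -
  show ub: "is_basis m U (\<gamma> @ \<beta>)" by (rule is_basis_append[OF g b int U])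
  let ?q = "length \<gamma>" and ?d = "length \<beta>"
  define B :: "complex mat" where "B = jordan_matrix (replicate ?q (1,0) @ n_as)"
  have d: "sum_list (map fst n_as) = ?d" using J by (metis carrier_matD(1) jordan_matrix_dim(1) map_mat_carrier)
  have dB: "sum_list (map fst (replicate ?q (1::nat,0::complex) @ n_as)) = ?q + ?d" by (simp add: d sum_list_replicate)
  have B: "B \<in> carrier_mat (?q + ?d) (?q + ?d)" using jordan_matrix_carrier[of "replicate ?q (1,0) @ n_as"]
    unfolding dB B_def .
  show "map_mat m (\<gamma> @ \<beta>) \<psi> = jordan_matrix (replicate (length \<gamma>) (1,0) @ n_as)"
    unfolding B_def[symmetric]
  proof (rule map_mat_eqI[OF ub], unfold length_append)
    show "B \<in> carrier_mat (?q + ?d) (?q + ?d)" by (rule B)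
    fix u :: "complex vec" assume "u \<in> carrier_vec (?q + ?d)"
    from vec_append_cases[OF this] obtain w v where wv: "u = w @\<^sub>v v" "w \<in> carrier_vec ?q" "v \<in> carrier_vec ?d" .
    have vV: "comb m \<beta> v \<in> V" "comb m \<gamma> w \<in> W" using g b wv unfolding is_basis_iff by blast+
    define J' where "J' = jordan_matrix n_as"
    have J': "J' \<in> carrier_mat ?d ?d" unfolding J'_def J[symmetric] by simp
    have Bij: "B $$ (i,j) = (if i < ?q \<or> j < ?q then 0 else J' $$ (i - ?q, j - ?q))" if "i < ?q + ?d" "j < ?q + ?d" for i j
      unfolding B_def J'_def using that by (intro jordan_matrix_replicate_zero) (auto simp: d)
    have Bu: "B *\<^sub>v u = 0\<^sub>v ?q @\<^sub>v (J' *\<^sub>v v)"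
    proof (rule eq_vecI, goal_cases)
      case (1 i)
      hence i: "i < ?q + ?d" using J' by simp
      have "(B *\<^sub>v u) $ i = (\<Sum>j<?q+?d. B $$ (i,j) * u $ j)"
        using i B wv by (auto simp: scalar_prod_def atLeast0LessThan)
      also have "\<dots> = (\<Sum>j<?d. B $$ (i,?q+j) * u $ (?q+j))"
        unfolding sum_lessThan_add using i by (simp add: Bij)
      also have "\<dots> = (0\<^sub>v ?q @\<^sub>v (J' *\<^sub>v v)) $ i"
        using i J' wv by (auto simp: Bij scalar_prod_def atLeast0LessThan)
      finally show ?case .
    qed (use B J' in auto)
    have "\<psi> (comb m (\<gamma> @ \<beta>) u) = \<phi> (comb m \<beta> v)"
      unfolding wv(1) comb_append[OF wv(2,3)] by (rule act[OF vV(2,1)])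
    also have "\<dots> = comb m \<beta> (J' *\<^sub>v v)" unfolding J'_def J[symmetric] by (rule map_mat_action[OF b lin wv(3)])
    also have "\<dots> = comb m \<gamma> (0\<^sub>v ?q) + comb m \<beta> (J' *\<^sub>v v)" unfolding comb_zero by simp
    also have "\<dots> = comb m (\<gamma> @ \<beta>) (0\<^sub>v ?q @\<^sub>v (J' *\<^sub>v v))"
      using J' wv by (intro comb_append[symmetric]) auto
    finally show "\<psi> (comb m (\<gamma> @ \<beta>) u) = comb m (\<gamma> @ \<beta>) (B *\<^sub>v u)" unfolding Bu .
  qed
qed

section \<open>The maximal part\<close>

text \<open>The denominators do not depend on \<open>x\<close>, so normalised means pass through
  fixed finite linear combinations. This transports convergence to entries of maps, Choi forms,
  traces and compositions.\<close>

lemma cesaro_sum: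
  fixes D :: "nat \<Rightarrow> complex"
  assumes "\<And>x. x \<in> S \<Longrightarrow> (\<lambda>N. (\<Sum>n=1..N. g x n / D n) / of_nat N) \<longlonglongrightarrow> L x"
  shows "(\<lambda>N. (\<Sum>n=1..N. (\<Sum>x\<in>S. c x * g x n) / D n) / of_nat N) \<longlonglongrightarrow> (\<Sum>x\<in>S. c x * L x)"
proof -
  have "(\<lambda>N. \<Sum>x\<in>S. c x * ((\<Sum>n=1..N. g x n / D n) / of_nat N)) \<longlonglongrightarrow> (\<Sum>x\<in>S. c x * L x)"
    using assms by (intro tendsto_sum tendsto_mult_left)
  moreover have "(\<Sum>x\<in>S. c x * ((\<Sum>n=1..N. g x n / D n) / of_nat N))
      = (\<Sum>n=1..N. (\<Sum>x\<in>S. c x * g x n) / D n) / of_nat N" for N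
  proof -
    have "(\<Sum>n=1..N. (\<Sum>x\<in>S. c x * g x n) / D n) = (\<Sum>n=1..N. \<Sum>x\<in>S. c x * (g x n / D n))"
      by (simp add: sum_divide_distrib)
    also have "\<dots> = (\<Sum>x\<in>S. \<Sum>n=1..N. c x * (g x n / D n))" by (rule sum.swap)
    finally show ?thesis by (simp add: sum_divide_distrib sum_distrib_left)
  qed
  ultimately show ?thesis by simp
qed

text \<open>Independence of the norm from the Jordan basis: by similarity any two Jordan bases have
  the same \<open>jparams\<close>. The nonempty parameter set forces \<open>\<beta>'\<close> to be
  nonempty, so the maximum in \<open>beta_norm\<close> is a genuine one.\<close>

lemma beta_norm_funpow:
  assumes b: "is_basis m V \<beta>" and lin: "linear_on m V \<phi>"
    and J: "map_mat m \<beta> \<phi> = jordan_matrix n_as" and ne: "jparams n_as \<noteq> {}"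
    and jb: "jordan_basis m V \<phi> \<beta>'"
  shows "beta_norm m \<beta>' (\<phi> ^^ n) = jmax (jparams n_as) n"
proof -
  from jb obtain n_as' where b': "is_basis m V \<beta>'" and J': "map_mat m \<beta>' \<phi> = jordan_matrix n_as'"
    unfolding jordan_basis_def by blast
  have eq: "jparams n_as' = jparams n_as"
    using map_mat_similar[OF b b' lin] unfolding J J' by (rule jparams_similar)
  have d: "length \<beta>' = sum_list (map fst n_as')" using J' by (metis carrier_matD(1) jordan_matrix_dim(1) map_mat_carrier)
  from ne have "jparams n_as' \<noteq> {}" unfolding eq .
  then obtain s a where "(s,a) \<in> set n_as'" "s > 0" by (auto simp: jparams_def)
  hence "s \<in> set (map fst n_as')" by force
  hence "s \<le> sum_list (map fst n_as')" by (rule member_le_sum_list) simp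
  with \<open>s > 0\<close> d have "length \<beta>' > 0" by simp
  from Max_jordan_matrix_pow[OF d this] show ?thesis
    unfolding beta_norm_def map_mat_funpow[OF b' lin] J' eq by simp
qed

text \<open>In coordinates, an entry of the \<open>n\<close>-th iterate at \<open>X\<close> is a
  linear combination of the entries of the \<open>n\<close>-th power of the Jordan matrix, with
  coefficients independent of \<open>n\<close>.\<close>

lemma cesaro_funpow_convergent:
  assumes b: "is_basis m V \<beta>" and lin: "linear_on m V \<phi>"
    and J: "map_mat m \<beta> \<phi> = jordan_matrix n_as" and ka: "(k,a) \<in> jparams n_as" "a \<noteq> 0"
    and X: "X \<in> V" and ij: "i < m" "j < m"
  shows "\<exists>L. (\<lambda>N. (\<Sum>n=1..N. (\<phi> ^^ n) X $$ (i,j) / complex_of_real (jmax (jparams n_as) n)) / of_nat N) \<longlonglongrightarrow> L"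
proof -
  let ?d = "length \<beta>" and ?D = "\<lambda>n. complex_of_real (jmax (jparams n_as) n)"
  let ?J = "jordan_matrix n_as"
  obtain v where v: "v \<in> carrier_vec ?d" "X = comb m \<beta> v" using b X unfolding is_basis_iff by blast
  have d: "sum_list (map fst n_as) = ?d" using J by (metis carrier_matD(1) jordan_matrix_dim(1) map_mat_carrier)
  have Jn: "?J ^\<^sub>m n \<in> carrier_mat ?d ?d" for n
    using pow_carrier_mat[OF jordan_matrix_carrier, of n_as n] unfolding d .
  have "\<exists>L. (\<lambda>N. (\<Sum>n=1..N. (?J ^\<^sub>m n) $$ (p,q) / ?D n) / of_nat N) \<longlonglongrightarrow> L" if "p < ?d" "q < ?d" for p q
    using jordan_matrix_pow_entry[of p n_as q, unfolded d, OF that]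
  proof (elim disjE)
    assume "\<forall>n. (?J ^\<^sub>m n) $$ (p,q) = 0" thus ?thesis by (intro exI[of _ 0]) simp
  next
    assume "\<exists>(k,a)\<in>jparams n_as. \<forall>n. (?J ^\<^sub>m n) $$ (p,q) = jterm k a n"
    then obtain k' a' where ka': "(k',a') \<in> jparams n_as" "\<And>n. (?J ^\<^sub>m n) $$ (p,q) = jterm k' a' n" by auto
    show ?thesis unfolding ka'(2) by (rule cesaro_jterm_convergent[OF finite_jparams ka ka'(1)])
  qed
  then obtain L where L: "(\<lambda>N. (\<Sum>n=1..N. (?J ^\<^sub>m n) $$ (p,q) / ?D n) / of_nat N) \<longlonglongrightarrow> L p q"
    if "p < ?d" "q < ?d" for p q
    by (intro that[of "\<lambda>p q. lim (\<lambda>N. (\<Sum>n=1..N. (?J ^\<^sub>m n) $$ (p,q) / ?D n) / of_nat N)"])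
       (simp add: convergent_def convergent_LIMSEQ_iff[symmetric])
  let ?S = "{..<?d} \<times> {..<?d}"
  have ent: "(\<phi> ^^ n) X $$ (i,j) = (\<Sum>x\<in>?S. (v $ snd x * \<beta> ! fst x $$ (i,j)) * (?J ^\<^sub>m n) $$ (fst x, snd x))" for n
  proof -
    have "(\<phi> ^^ n) X $$ (i,j) = (\<Sum>p<?d. ((?J ^\<^sub>m n) *\<^sub>v v) $ p * \<beta> ! p $$ (i,j))"
      unfolding v(2) funpow_comb[OF b lin v(1)] J using ij by (rule comb_index)
    also have "\<dots> = (\<Sum>p<?d. \<Sum>q<?d. (v $ q * \<beta> ! p $$ (i,j)) * (?J ^\<^sub>m n) $$ (p, q))"
    proof (rule sum.cong[OF refl])
      fix p assume "p \<in> {..<?d}"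
      hence "((?J ^\<^sub>m n) *\<^sub>v v) $ p = (\<Sum>q<?d. (?J ^\<^sub>m n) $$ (p,q) * v $ q)"
        using Jn[of n] v(1) by (auto simp: scalar_prod_def atLeast0LessThan)
      thus "((?J ^\<^sub>m n) *\<^sub>v v) $ p * \<beta> ! p $$ (i,j) = (\<Sum>q<?d. (v $ q * \<beta> ! p $$ (i,j)) * (?J ^\<^sub>m n) $$ (p, q))"
        by (simp only: sum_distrib_right) (simp add: mult_ac)
    qed
    also have "\<dots> = (\<Sum>x\<in>?S. (v $ snd x * \<beta> ! fst x $$ (i,j)) * (?J ^\<^sub>m n) $$ (fst x, snd x))"
      by (simp add: sum.cartesian_product case_prod_beta)
    finally show ?thesis .
  qed
  have "(\<lambda>N. (\<Sum>n=1..N. (\<phi> ^^ n) X $$ (i,j) / ?D n) / of_nat N)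
      \<longlonglongrightarrow> (\<Sum>x\<in>?S. (v $ snd x * \<beta> ! fst x $$ (i,j)) * L (fst x) (snd x))"
    unfolding ent by (rule cesaro_sum) (use L in auto)
  thus ?thesis by blast
qed

text \<open>Shows that the definite description in \<open>maximal_part\<close> denotes: the limits
  exist by the preceding lemma and determine the map, whose values outside \<open>V\<close> are
  fixed to be 0.\<close>

lemma maximal_part_limit:
  assumes b: "is_basis m V \<beta>" and lin: "linear_on m V \<phi>"
    and J: "map_mat m \<beta> \<phi> = jordan_matrix n_as" and ka: "(k,a) \<in> jparams n_as" "a \<noteq> 0"
    and X: "X \<in> V"
  shows "maximal_part m V \<phi> X \<in> carrier_mat m m"
    "i < m \<Longrightarrow> j < m \<Longrightarrow> (\<lambda>N. (\<Sum>n=1..N. (\<phi> ^^ n) X $$ (i,j) / complex_of_real (jmax (jparams n_as) n)) / of_nat N)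
       \<longlonglongrightarrow> maximal_part m V \<phi> X $$ (i,j)"
proof -
  let ?s = "\<lambda>X i j N. (\<Sum>n=1..N. (\<phi> ^^ n) X $$ (i,j) / complex_of_real (jmax (jparams n_as) n)) / of_nat N"
  let ?P = "\<lambda>\<psi>. (\<forall>X. X \<notin> V \<longrightarrow> \<psi> X = 0\<^sub>m m m) \<and> (\<forall>X\<in>V. \<psi> X \<in> carrier_mat m m) \<and>
      (\<forall>\<beta>. jordan_basis m V \<phi> \<beta> \<longrightarrow> (\<forall>X\<in>V. \<forall>i<m. \<forall>j<m.
         (\<lambda>N. (\<Sum>n=1..N. ((\<phi>^^n) X $$ (i,j)) / complex_of_real (beta_norm m \<beta> (\<phi>^^n))) / of_nat N)
              \<longlonglongrightarrow> \<psi> X $$ (i,j)))"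
  let ?R = "\<lambda>\<psi>. (\<forall>X. X \<notin> V \<longrightarrow> \<psi> X = 0\<^sub>m m m) \<and> (\<forall>X\<in>V. \<psi> X \<in> carrier_mat m m) \<and>
      (\<forall>X\<in>V. \<forall>i<m. \<forall>j<m. ?s X i j \<longlonglongrightarrow> \<psi> X $$ (i,j))"
  have ne: "jparams n_as \<noteq> {}" using ka by auto
  have jb: "jordan_basis m V \<phi> \<beta>" using b J unfolding jordan_basis_def by blast
  \<comment> \<open>All Jordan bases give the same sequence, so the quantifier over them collapses;
    \<open>jb\<close> supplies one basis, so that it is not vacuous.\<close>
  have PR: "?P = ?R"
  proof (rule ext)
    fix \<psi>
    show "?P \<psi> = ?R \<psi>" using jb by (simp add: beta_norm_funpow[OF b lin J ne] cong: conj_cong) blast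
  qed
  have mp: "maximal_part m V \<phi> = (THE \<psi>. ?R \<psi>)"
    unfolding maximal_part_def PR[THEN fun_cong] ..
  define \<psi>0 where "\<psi>0 X = (if X \<in> V then mat m m (\<lambda>(i,j). lim (?s X i j)) else 0\<^sub>m m m)" for X
  have conv: "?s X i j \<longlonglongrightarrow> lim (?s X i j)" if "X \<in> V" "i < m" "j < m" for X i j
    using cesaro_funpow_convergent[OF b lin J ka that] by (simp add: convergent_def convergent_LIMSEQ_iff[symmetric])
  have R0: "?R \<psi>0" using conv by (auto simp: \<psi>0_def)
  have uniq: "\<psi> = \<psi>0" if R: "?R \<psi>" for \<psi>
  proof (rule ext)
    fix X
    show "\<psi> X = \<psi>0 X"
    proof (cases "X \<in> V")
      case True
      hence c: "\<psi> X \<in> carrier_mat m m" "\<psi>0 X \<in> carrier_mat m m" using R R0 by blast+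
      moreover have "\<psi> X $$ (i,j) = \<psi>0 X $$ (i,j)" if "i < m" "j < m" for i j
      proof -
        have "?s X i j \<longlonglongrightarrow> \<psi> X $$ (i,j)" using R True that by blast
        moreover have "?s X i j \<longlonglongrightarrow> \<psi>0 X $$ (i,j)" using R0 True that by blast
        ultimately show ?thesis by (rule LIMSEQ_unique)
      qed
      ultimately show ?thesis by (intro eq_matI) auto
    next
      case False thus ?thesis using R R0 by auto
    qed
  qed
  have "?R (maximal_part m V \<phi>)" unfolding mp by (rule theI[of ?R, OF R0 uniq])
  thus "maximal_part m V \<phi> X \<in> carrier_mat m m"
    "i < m \<Longrightarrow> j < m \<Longrightarrow> ?s X i j \<longlonglongrightarrow> maximal_part m V \<phi> X $$ (i,j)"
    using X by blast+
qed

lemma smult_one_mat: "(1::complex) \<cdot>\<^sub>m X = X"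
  by (rule eq_matI) auto

lemma linear_on_smult:
  assumes V: "msubspace m V" and lin: "linear_on m V \<phi>" and X: "X \<in> V"
  shows "\<phi> (c \<cdot>\<^sub>m X) = c \<cdot>\<^sub>m \<phi> X"
proof -
  have c: "X \<in> carrier_mat m m" "\<phi> X \<in> carrier_mat m m" using V lin X unfolding msubspace_def linear_on_def by auto
  have "\<phi> (c \<cdot>\<^sub>m X + 0 \<cdot>\<^sub>m X) = c \<cdot>\<^sub>m \<phi> X + 0 \<cdot>\<^sub>m \<phi> X" using lin X unfolding linear_on_def by blast
  moreover have "c \<cdot>\<^sub>m X + 0 \<cdot>\<^sub>m X = c \<cdot>\<^sub>m X" using c by (intro eq_matI) auto
  moreover have "c \<cdot>\<^sub>m \<phi> X + 0 \<cdot>\<^sub>m \<phi> X = c \<cdot>\<^sub>m \<phi> X" using c by (intro eq_matI) auto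
  ultimately show ?thesis by simp
qed

lemma smult_mem:
  assumes V: "msubspace m V" and X: "X \<in> V"
  shows "c \<cdot>\<^sub>m X \<in> V"
proof -
  have c: "X \<in> carrier_mat m m" using V X unfolding msubspace_def by auto
  have "c \<cdot>\<^sub>m X + 0 \<cdot>\<^sub>m X \<in> V" using V X unfolding msubspace_def by blast
  moreover have "c \<cdot>\<^sub>m X + 0 \<cdot>\<^sub>m X = c \<cdot>\<^sub>m X" using c by (intro eq_matI) auto
  ultimately show ?thesis by simp
qed

text \<open>If all blocks had eigenvalue 0, the map would be nilpotent, 0 would be its only
  eigenvalue, and the spectral radius would be 0.\<close>

lemma spectral_radius_pos_nonzero_block:
  assumes b: "is_basis m V \<beta>" and lin: "linear_on m V \<phi>"
    and J: "map_mat m \<beta> \<phi> = jordan_matrix n_as" and ne: "\<beta> \<noteq> []"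
    and r: "map_spectral_radius V \<phi> > 0"
  shows "\<exists>(k,a)\<in>jparams n_as. a \<noteq> 0"
proof (rule ccontr)
  assume "\<not> ?thesis"
  hence zero: "a = 0" if "(k,a) \<in> jparams n_as" for k a using that by auto
  let ?d = "length \<beta>" and ?J = "jordan_matrix n_as"
  have V: "msubspace m V" by (rule is_basis_msubspace[OF b])
  have d: "sum_list (map fst n_as) = ?d" using J by (metis carrier_matD(1) jordan_matrix_dim(1) map_mat_carrier)
  have Jc: "?J \<in> carrier_mat ?d ?d" using jordan_matrix_carrier[of n_as] unfolding d .
  \<comment> \<open>Larger than every superdiagonal index, so that each \<open>jterm k 0 n\<close>
    vanishes.\<close>
  define n where "n = Suc (Max (insert 0 (fst ` jparams n_as)))"
  have n: "k < n" if "(k,a) \<in> jparams n_as" for k a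
  proof -
    have "k \<le> Max (insert 0 (fst ` jparams n_as))"
      using that by (intro Max_ge) (auto simp: finite_jparams intro!: image_eqI[of _ _ "(k,a)"])
    thus ?thesis by (simp add: n_def)
  qed
  have J0: "?J ^\<^sub>m n = 0\<^sub>m ?d ?d"
  proof (rule eq_matI)
    fix i j assume ij: "i < dim_row (0\<^sub>m ?d ?d :: complex mat)" "j < dim_col (0\<^sub>m ?d ?d :: complex mat)"
    have "(?J ^\<^sub>m n) $$ (i,j) = 0 \<or> (\<exists>(k,a)\<in>jparams n_as. (?J ^\<^sub>m n) $$ (i,j) = jterm k a n)"
      using jordan_matrix_pow_entry[of i n_as j] ij unfolding d by fastforce
    moreover have "jterm k a n = 0" if "(k,a) \<in> jparams n_as" for k a
      using n[OF that] zero[OF that] by (simp add: jterm_def)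
    ultimately show "(?J ^\<^sub>m n) $$ (i,j) = 0\<^sub>m ?d ?d $$ (i,j)" using ij by auto
  qed (use pow_carrier_mat[OF Jc, of n] in auto)
  have nil: "(\<phi> ^^ n) X = 0\<^sub>m m m" if "X \<in> V" for X
  proof -
    obtain v where v: "v \<in> carrier_vec ?d" "X = comb m \<beta> v" using b \<open>X \<in> V\<close> unfolding is_basis_iff by blast
    have "0\<^sub>m ?d ?d *\<^sub>v v = 0\<^sub>v ?d" using v(1) by (intro eq_vecI) auto
    thus ?thesis unfolding v(2) funpow_comb[OF b lin v(1)] J J0 by (simp add: comb_zero)
  qed
  let ?S = "{cmod c | c. \<exists>X\<in>V. X \<noteq> 0\<^sub>m (dim_row X) (dim_col X) \<and> \<phi> X = c \<cdot>\<^sub>m X}"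
  have "c = 0" if X: "X \<in> V" "X \<noteq> 0\<^sub>m (dim_row X) (dim_col X)" "\<phi> X = c \<cdot>\<^sub>m X" for c X
  proof -
    have Xc: "X \<in> carrier_mat m m" using V X unfolding msubspace_def by auto
    have "(\<phi> ^^ l) X = c ^ l \<cdot>\<^sub>m X" for l
    proof (induction l)
      case (Suc l)
      have "(\<phi> ^^ Suc l) X = c ^ l \<cdot>\<^sub>m (c \<cdot>\<^sub>m X)" using Suc linear_on_smult[OF V lin X(1)] X(3) by simp
      also have "\<dots> = c ^ Suc l \<cdot>\<^sub>m X" by (rule eq_matI) auto
      finally show ?case .
    qed (simp add: smult_one_mat)
    with nil[OF X(1)] have eq: "c ^ n \<cdot>\<^sub>m X = 0\<^sub>m m m" by metis
    obtain i j where ij: "i < m" "j < m" "X $$ (i,j) \<noteq> 0"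
    proof -
      have "\<exists>i<m. \<exists>j<m. X $$ (i,j) \<noteq> 0"
      proof (rule ccontr)
        assume "\<not> ?thesis"
        hence "X = 0\<^sub>m m m" using Xc by (intro eq_matI) auto
        thus False using X(2) by auto
      qed
      with that show ?thesis by blast
    qed
    have "(c ^ n \<cdot>\<^sub>m X) $$ (i,j) = 0" unfolding eq using ij by simp
    thus "c = 0" using ij Xc by simp
  qed
  hence sub: "?S \<subseteq> {0}" by auto
  \<comment> \<open>An eigenvector must be exhibited: the set of moduli has to be exactly
    \<open>{0}\<close>, since a supremum over the empty set of reals would say nothing.\<close>
  have "spectrum ?J \<noteq> {}" using spectrum_non_empty[OF Jc] ne by simp
  then obtain c v where "eigenvector ?J v c" unfolding spectrum_def eigenvalue_def by auto
  hence v: "v \<in> carrier_vec ?d" "v \<noteq> 0\<^sub>v ?d" "?J *\<^sub>v v = c \<cdot>\<^sub>v v"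
    using Jc unfolding eigenvector_def by auto
  have "comb m \<beta> v \<in> V" using b v(1) unfolding is_basis_iff by blast
  moreover have "comb m \<beta> v \<noteq> 0\<^sub>m m m" using b v unfolding is_basis_iff by blast
  moreover have "\<phi> (comb m \<beta> v) = c \<cdot>\<^sub>m comb m \<beta> v"
    unfolding map_mat_action[OF b lin v(1)] J v(3)
    using v(1) by (intro eq_matI) (auto simp: comb_index sum_distrib_left mult.assoc)
  ultimately have "cmod c \<in> ?S" by force
  moreover have "A = {0}" if "x \<in> A" "A \<subseteq> {0}" for A and x :: real using that by auto
  ultimately have "?S = {0}" using sub by blast
  hence "map_spectral_radius V \<phi> = Sup {0}" unfolding map_spectral_radius_def by (rule arg_cong)
  with r show False by simp
qed

section \<open>The block algebra and the canonical extension\<close>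

lemma block_alg_carrier: "X \<in> block_alg ns \<Longrightarrow> X \<in> carrier_mat (sum_list ns) (sum_list ns)"
  by (simp add: block_alg_def)

lemma bd_part_carrier[simp]: "bd_part ns X \<in> carrier_mat (sum_list ns) (sum_list ns)"
  "dim_row (bd_part ns X) = sum_list ns" "dim_col (bd_part ns X) = sum_list ns"
  by (auto simp: bd_part_def)

lemma bd_part_mem[simp]: "bd_part ns X \<in> block_alg ns"
  by (auto simp: block_alg_def bd_part_def)

lemma bd_part_id: "X \<in> block_alg ns \<Longrightarrow> bd_part ns X = X"
  by (rule eq_matI) (auto simp: block_alg_def bd_part_def)

lemma bd_part_linear:
  assumes "X \<in> carrier_mat (sum_list ns) (sum_list ns)" "Y \<in> carrier_mat (sum_list ns) (sum_list ns)"
  shows "bd_part ns (a \<cdot>\<^sub>m X + b \<cdot>\<^sub>m Y) = a \<cdot>\<^sub>m bd_part ns X + b \<cdot>\<^sub>m bd_part ns Y"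
  using assms by (intro eq_matI) (auto simp: bd_part_def)

lemma msubspace_block_alg: "msubspace (sum_list ns) (block_alg ns)"
  by (auto simp: msubspace_def block_alg_def)

lemma linear_on_can_ext:
  assumes "linear_on (sum_list ns) (block_alg ns) \<tau>"
  shows "linear_on (sum_list ns) (carrier_mat (sum_list ns) (sum_list ns)) (can_ext ns \<tau>)"
  unfolding linear_on_def
proof (intro conjI ballI allI)
  fix X Y :: "complex mat" and a b
  assume "X \<in> carrier_mat (sum_list ns) (sum_list ns)" "Y \<in> carrier_mat (sum_list ns) (sum_list ns)"
  thus "can_ext ns \<tau> (a \<cdot>\<^sub>m X + b \<cdot>\<^sub>m Y) = a \<cdot>\<^sub>m can_ext ns \<tau> X + b \<cdot>\<^sub>m can_ext ns \<tau> Y"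
    using assms unfolding can_ext_def linear_on_def by (simp add: bd_part_linear)
qed (use assms in \<open>auto simp: can_ext_def linear_on_def intro: block_alg_carrier\<close>)

text \<open>After one application everything lies in the block algebra, where \<open>bd_part\<close>
  is the identity. Exponent 0 is excluded: there the left side would be \<open>X\<close> and the
  right side \<open>bd_part ns X\<close>.\<close>

lemma can_ext_funpow:
  assumes "linear_on (sum_list ns) (block_alg ns) \<tau>"
  shows "(can_ext ns \<tau> ^^ Suc n) X = (\<tau> ^^ Suc n) (bd_part ns X)"
proof -
  have mem: "(\<tau> ^^ n) (bd_part ns X) \<in> block_alg ns" for n
    using assms by (induction n) (auto simp: linear_on_def)
  show ?thesis
  proof (induction n)
    case (Suc n)
    have "(can_ext ns \<tau> ^^ Suc (Suc n)) X = \<tau> (bd_part ns ((\<tau> ^^ Suc n) (bd_part ns X)))"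
      using Suc by (simp add: can_ext_def)
    thus ?case by (simp only: bd_part_id[OF mem]) simp
  qed (simp add: can_ext_def)
qed

text \<open>Contains the first claim and collects what the algebraic half takes from the Jordan
  analysis: a positive normaliser \<open>D\<close> with bounded growth ratio, convergence of the
  means to \<open>\<psi>\<close>, and a basis in which \<open>D\<close> is the norm of the
  powers.\<close>

lemma can_ext_maximal_part:
  fixes \<tau> :: "complex mat \<Rightarrow> complex mat"
  assumes ns: "ns \<noteq> []" "\<forall>n\<in>set ns. 0 < n"
    and m: "m = sum_list ns"
    and lin: "linear_on m (block_alg ns) \<tau>"
    and r: "map_spectral_radius (block_alg ns) \<tau> > 0"
  defines "T \<equiv> can_ext ns \<tau>" and "\<psi> \<equiv> can_ext ns (maximal_part m (block_alg ns) \<tau>)"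
  obtains D K \<gamma> where
    "\<And>n. D n > 0" "K > 0" "\<And>n. D (Suc n) \<le> K * D n"
    "\<And>X. X \<in> carrier_mat m m \<Longrightarrow> \<psi> X \<in> carrier_mat m m"
    "\<And>X i j. X \<in> carrier_mat m m \<Longrightarrow> i < m \<Longrightarrow> j < m \<Longrightarrow>
       (\<lambda>N. (\<Sum>n=1..N. (T ^^ n) X $$ (i,j) / complex_of_real (D n)) / of_nat N) \<longlonglongrightarrow> \<psi> X $$ (i,j)"
    "\<And>X. X \<in> carrier_mat m m \<Longrightarrow> \<psi> X = maximal_part m (carrier_mat m m) T X"
    "is_basis m (carrier_mat m m) \<gamma>" "\<And>n. n \<ge> 1 \<Longrightarrow> D n = beta_norm m \<gamma> (T ^^ n)" "\<gamma> \<noteq> []"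
proof -
  let ?V = "block_alg ns"
  have m0: "m > 0" using ns m by (cases ns) auto
  have V: "msubspace m ?V" unfolding m by (rule msubspace_block_alg)
  have linT: "linear_on m (carrier_mat m m) T" using lin unfolding m T_def by (rule linear_on_can_ext)
  obtain \<beta>0 where "is_basis m ?V \<beta>0" using msubspace_has_basis[OF V] .
  from jordan_basis_exists[OF this lin] obtain \<beta> where "jordan_basis m ?V \<tau> \<beta>" .
  then obtain n_as where b: "is_basis m ?V \<beta>" and J: "map_mat m \<beta> \<tau> = jordan_matrix n_as"
    unfolding jordan_basis_def by blast
  have ne: "\<beta> \<noteq> []"
  proof
    assume "\<beta> = []"
    hence "comb m \<beta> v = 0\<^sub>m m m" for v by (intro eq_matI) (auto simp: comb_index)
    moreover have "1\<^sub>m m \<in> ?V" by (auto simp: block_alg_def m)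
    ultimately have "1\<^sub>m m = (0\<^sub>m m m :: complex mat)" using b unfolding is_basis_iff by auto
    hence "1\<^sub>m m $$ (0,0) = (0\<^sub>m m m :: complex mat) $$ (0,0)" by simp
    thus False using m0 by simp
  qed
  from spectral_radius_pos_nonzero_block[OF b lin J ne r] obtain k a where
    ka: "(k,a) \<in> jparams n_as" "a \<noteq> 0" by auto
  \<comment> \<open>The matrices with zero block-diagonal part: a complement of the block algebra in
    \<open>M_m\<close> that \<open>T\<close> annihilates.\<close>
  define W where "W = {X \<in> carrier_mat m m. bd_part ns X = 0\<^sub>m m m}"
  have W: "msubspace m W" unfolding msubspace_def W_def
  proof (intro conjI ballI allI)
    show "0\<^sub>m m m \<in> {X \<in> carrier_mat m m. bd_part ns X = 0\<^sub>m m m}"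
      using bd_part_id[of "0\<^sub>m m m" ns] V by (simp add: msubspace_def)
    fix X Y :: "complex mat" and a b
    assume "X \<in> {X \<in> carrier_mat m m. bd_part ns X = 0\<^sub>m m m}" "Y \<in> {X \<in> carrier_mat m m. bd_part ns X = 0\<^sub>m m m}"
    thus "a \<cdot>\<^sub>m X + b \<cdot>\<^sub>m Y \<in> {X \<in> carrier_mat m m. bd_part ns X = 0\<^sub>m m m}"
      using bd_part_linear[of X ns Y a b] by (simp add: m)
  qed auto
  obtain \<delta> where g: "is_basis m W \<delta>" using msubspace_has_basis[OF W] .
  have int: "W \<inter> ?V \<subseteq> {0\<^sub>m m m}" using bd_part_id by (auto simp: W_def)
  have bd_diff: "bd_part ns (1 \<cdot>\<^sub>m X + (-1) \<cdot>\<^sub>m bd_part ns X) = 0\<^sub>m m m" if "X \<in> carrier_mat m m" for X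
    using that bd_part_linear[of X ns "bd_part ns X" 1 "-1"] bd_part_id[OF bd_part_mem, of ns X]
    by (intro eq_matI) (auto simp: m)
  have U: "carrier_mat m m = {X + Y | X Y. X \<in> W \<and> Y \<in> ?V}"
  proof (intro equalityI subsetI)
    fix X :: "complex mat" assume X: "X \<in> carrier_mat m m"
    have "X = (1 \<cdot>\<^sub>m X + (-1) \<cdot>\<^sub>m bd_part ns X) + bd_part ns X" using X by (intro eq_matI) (auto simp: m)
    moreover have "1 \<cdot>\<^sub>m X + (-1) \<cdot>\<^sub>m bd_part ns X \<in> W" unfolding W_def using bd_diff[OF X] X by (auto simp: m)
    ultimately show "X \<in> {X + Y | X Y. X \<in> W \<and> Y \<in> ?V}" using bd_part_mem by blast
  qed (use V in \<open>auto simp: W_def msubspace_def\<close>)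
  have act: "T (X + Y) = \<tau> Y" if "X \<in> W" "Y \<in> ?V" for X Y
  proof -
    have c: "X \<in> carrier_mat m m" "Y \<in> carrier_mat m m" using that V by (auto simp: W_def msubspace_def)
    have "bd_part ns (X + Y) = bd_part ns X + bd_part ns Y"
      using bd_part_linear[of X ns Y 1 1] c by (simp add: m smult_one_mat)
    also have "\<dots> = Y" using that bd_part_id[of Y ns] c by (simp add: W_def)
    finally show ?thesis by (simp add: T_def can_ext_def)
  qed
  let ?n_as = "replicate (length \<delta>) (1,0) @ n_as"
  have ext: "is_basis m (carrier_mat m m) (\<delta> @ \<beta>)" "map_mat m (\<delta> @ \<beta>) T = jordan_matrix ?n_as"
    by (rule jordan_basis_append_kernel[OF g b lin J int U], rule act, assumption+)+
  have jb: "jordan_basis m (carrier_mat m m) T (\<delta> @ \<beta>)" using ext unfolding jordan_basis_def by blast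
  have ka': "(k,a) \<in> jparams ?n_as" using ka(1) by (auto simp: jparams_def)
  \<comment> \<open>The norms of the powers of \<open>\<tau>\<close>. For \<open>n \<ge> 1\<close>
    they are also those of \<open>T\<close>, whose Jordan matrix has only zero blocks of size 1 in
    addition; the means start at \<open>n = 1\<close>.\<close>
  define D where "D = jmax (jparams n_as)"
  obtain K where K: "K > 0" "\<And>n. D (Suc n) \<le> K * D n" using jmax_Suc_le[of n_as] unfolding D_def by blast
  have D': "jmax (jparams ?n_as) n = D n" if "n \<ge> 1" for n
    unfolding D_def using that by (rule jmax_replicate_zero)
  have lim: "(\<lambda>N. (\<Sum>n=1..N. (T ^^ n) X $$ (i,j) / complex_of_real (D n)) / of_nat N) \<longlonglongrightarrow> \<psi> X $$ (i,j)"
    if "X \<in> carrier_mat m m" "i < m" "j < m" for X i j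
  proof -
    have "(\<Sum>n=1..N. (T ^^ n) X $$ (i,j) / complex_of_real (D n)) = (\<Sum>n=1..N. (\<tau> ^^ n) (bd_part ns X) $$ (i,j) / complex_of_real (D n))" for N
    proof (rule sum.cong[OF refl])
      fix n assume "n \<in> {1..N}"
      then obtain n' where "n = Suc n'" by (cases n) auto
      thus "(T ^^ n) X $$ (i,j) / complex_of_real (D n) = (\<tau> ^^ n) (bd_part ns X) $$ (i,j) / complex_of_real (D n)"
        unfolding T_def using can_ext_funpow[OF lin[unfolded m], of n' X] by simp
    qed
    thus ?thesis using maximal_part_limit(2)[OF b lin J ka bd_part_mem that(2,3)]
      unfolding D_def \<psi>_def can_ext_def by simp
  qed
  have car: "\<psi> X \<in> carrier_mat m m" for X
    unfolding \<psi>_def can_ext_def by (rule maximal_part_limit(1)[OF b lin J ka bd_part_mem])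
  have eq: "\<psi> X = maximal_part m (carrier_mat m m) T X" if X: "X \<in> carrier_mat m m" for X
  proof (rule eq_matI)
    note mp = maximal_part_limit[OF ext(1) linT ext(2) ka' ka(2) X]
    show "dim_row (\<psi> X) = dim_row (maximal_part m (carrier_mat m m) T X)"
      "dim_col (\<psi> X) = dim_col (maximal_part m (carrier_mat m m) T X)" using car[of X] mp(1) by auto
    fix i j assume "i < dim_row (maximal_part m (carrier_mat m m) T X)" "j < dim_col (maximal_part m (carrier_mat m m) T X)"
    hence ij: "i < m" "j < m" using mp(1) by auto
    have "(\<Sum>n=1..N. (T ^^ n) X $$ (i,j) / complex_of_real (jmax (jparams ?n_as) n))
       = (\<Sum>n=1..N. (T ^^ n) X $$ (i,j) / complex_of_real (D n))" for N
      by (rule sum.cong) (use D' in auto)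
    with mp(2)[OF ij] have "(\<lambda>N. (\<Sum>n=1..N. (T ^^ n) X $$ (i,j) / complex_of_real (D n)) / of_nat N)
        \<longlonglongrightarrow> maximal_part m (carrier_mat m m) T X $$ (i,j)" by simp
    from LIMSEQ_unique[OF lim[OF X ij] this]
    show "\<psi> X $$ (i,j) = maximal_part m (carrier_mat m m) T X $$ (i,j)" .
  qed
  show ?thesis
  proof (rule that[of D K "\<delta> @ \<beta>"])
    show "D n > 0" for n unfolding D_def by (rule jmax_pos[OF ka])
    show "D n = beta_norm m (\<delta> @ \<beta>) (T ^^ n)" if "n \<ge> 1" for n
    proof -
      have "jparams ?n_as \<noteq> {}" using ka' by blast
      from beta_norm_funpow[OF ext(1) linT ext(2) this jb, of n] show ?thesis unfolding D'[OF that] by simp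
    qed
    show "\<delta> @ \<beta> \<noteq> []" using ne by simp
  qed (fact K | rule car | rule ext | (rule lim eq; assumption))+
qed

section \<open>Kraus decompositions and the Choi form\<close>

definition unitm :: "nat \<Rightarrow> nat \<Rightarrow> nat \<Rightarrow> complex mat" where
  "unitm m a b = mat m m (\<lambda>(i,j). if i = a \<and> j = b then 1 else 0)"

lemma unitm_carrier[simp]: "unitm m a b \<in> carrier_mat m m"
  by (simp add: unitm_def)

lemma unitm_index: "i < m \<Longrightarrow> j < m \<Longrightarrow> unitm m a b $$ (i,j) = (if i = a \<and> j = b then 1 else 0)"
  by (simp add: unitm_def)

abbreviation pos :: "nat \<Rightarrow> (nat \<times> nat) set" where
  "pos m \<equiv> {..<m} \<times> {..<m}"

text \<open>The Hilbert-Schmidt inner product, linear in \<open>A\<close> and conjugate-linear in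
  \<open>v\<close>.\<close>

definition ip :: "nat \<Rightarrow> complex mat \<Rightarrow> complex mat \<Rightarrow> complex" where
  "ip m A v = (\<Sum>x\<in>pos m. A $$ x * cnj (v $$ x))"

text \<open>The quadratic form of the Choi matrix.\<close>

definition choi_form :: "nat \<Rightarrow> (complex mat \<Rightarrow> complex mat) \<Rightarrow> complex mat \<Rightarrow> complex" where
  "choi_form m F v = (\<Sum>z\<in>pos m \<times> pos m. (v $$ fst z * cnj (v $$ snd z))
      * F (unitm m (fst (fst z)) (fst (snd z))) $$ (snd (fst z), snd (snd z)))"

lemma mat_adjoint_index:
  fixes A :: "complex mat"
  assumes "A \<in> carrier_mat m m"
  shows "mat_adjoint A \<in> carrier_mat m m" "i < m \<Longrightarrow> j < m \<Longrightarrow> mat_adjoint A $$ (i,j) = cnj (A $$ (j,i))"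
  using assms by (auto simp: mat_adjoint_def mat_of_rows_index conjugate_complex_def)

lemma mat_adjoint_mult:
  fixes A B :: "complex mat"
  assumes "A \<in> carrier_mat m m" "B \<in> carrier_mat m m"
  shows "mat_adjoint (A * B) = mat_adjoint B * mat_adjoint A"
proof (rule eq_matI, goal_cases)
  case (1 i j)
  hence ij: "i < m" "j < m" using mat_adjoint_index(1)[OF assms(1)] mat_adjoint_index(1)[OF assms(2)] by auto
  have "mat_adjoint (A * B) $$ (i,j) = cnj ((A * B) $$ (j,i))"
    using ij assms by (intro mat_adjoint_index(2)) auto
  also have "\<dots> = (\<Sum>k<m. mat_adjoint B $$ (i,k) * mat_adjoint A $$ (k,j))"
    using ij assms by (simp add: scalar_prod_def atLeast0LessThan mat_adjoint_index mult.commute)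
  also have "\<dots> = (mat_adjoint B * mat_adjoint A) $$ (i,j)"
    using ij mat_adjoint_index(1)[OF assms(1)] mat_adjoint_index(1)[OF assms(2)]
    by (simp add: scalar_prod_def atLeast0LessThan)
  finally show ?case .
qed (use assms mat_adjoint_index(1)[of "A * B" m] mat_adjoint_index(1)[OF assms(1)] mat_adjoint_index(1)[OF assms(2)] in auto)

lemma kraus_sum_Cons: "kraus_sum m (A # As) X = mat_adjoint A * X * A + kraus_sum m As X"
  by (simp add: kraus_sum_def)

lemma kraus_sum_Nil: "kraus_sum m [] X = 0\<^sub>m m m"
  by (simp add: kraus_sum_def)

lemma kraus_sum_carrier:
  assumes "set As \<subseteq> carrier_mat m m" "X \<in> carrier_mat m m"
  shows "kraus_sum m As X \<in> carrier_mat m m"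
  using assms mat_adjoint_index(1)[of _ m]
  by (induction As) (auto simp: kraus_sum_Cons kraus_sum_Nil intro!: add_carrier_mat mult_carrier_mat)

lemma sandwich_index:
  fixes A X :: "complex mat"
  assumes A: "A \<in> carrier_mat m m" and X: "X \<in> carrier_mat m m" and ij: "i < m" "j < m"
  shows "(mat_adjoint A * X * A) $$ (i,j) = (\<Sum>x\<in>pos m. X $$ x * (cnj (A $$ (fst x,i)) * A $$ (snd x,j)))"
proof -
  note A' = mat_adjoint_index(1)[OF A]
  have "(mat_adjoint A * X * A) $$ (i,j) = (\<Sum>b<m. (mat_adjoint A * X) $$ (i,b) * A $$ (b,j))"
  proof -
    have "(Y * A) $$ (i,j) = (\<Sum>b<m. Y $$ (i,b) * A $$ (b,j))" if "Y \<in> carrier_mat m m" for Y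
      using A that ij by (simp add: scalar_prod_def atLeast0LessThan)
    from this[OF mult_carrier_mat[OF A' X]] show ?thesis .
  qed
  also have "\<dots> = (\<Sum>b<m. (\<Sum>a<m. cnj (A $$ (a,i)) * X $$ (a,b)) * A $$ (b,j))"
    using carrier_matD[OF A'] X ij by (intro sum.cong refl) (simp add: scalar_prod_def atLeast0LessThan mat_adjoint_index(2)[OF A])
  also have "\<dots> = (\<Sum>b<m. \<Sum>a<m. X $$ (a,b) * (cnj (A $$ (a,i)) * A $$ (b,j)))"
    by (simp only: sum_distrib_right) (simp add: mult_ac)
  also have "\<dots> = (\<Sum>a<m. \<Sum>b<m. X $$ (a,b) * (cnj (A $$ (a,i)) * A $$ (b,j)))" by (rule sum.swap)
  finally show ?thesis by (simp add: sum.cartesian_product case_prod_beta)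
qed

lemma sum_sum_list_swap:
  fixes f :: "'a \<Rightarrow> 'b \<Rightarrow> 'c :: comm_monoid_add"
  shows "(\<Sum>x\<in>S. \<Sum>A\<leftarrow>As. f x A) = (\<Sum>A\<leftarrow>As. \<Sum>x\<in>S. f x A)"
  by (induction As) (auto simp: sum.distrib)

lemma kraus_sum_index:
  assumes As: "set As \<subseteq> carrier_mat m m" and X: "X \<in> carrier_mat m m" and ij: "i < m" "j < m"
  shows "kraus_sum m As X $$ (i,j) = (\<Sum>x\<in>pos m. X $$ x * (\<Sum>A\<leftarrow>As. cnj (A $$ (fst x,i)) * A $$ (snd x,j)))"
  using As
proof (induction As)
  case (Cons A As)
  have c: "mat_adjoint A * X * A \<in> carrier_mat m m" "kraus_sum m As X \<in> carrier_mat m m"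
    using mat_adjoint_index(1)[of A m] kraus_sum_carrier[of As m X] Cons.prems X by auto
  have "kraus_sum m (A # As) X $$ (i,j) = (mat_adjoint A * X * A) $$ (i,j) + kraus_sum m As X $$ (i,j)"
    unfolding kraus_sum_Cons using c ij by simp
  also have "(mat_adjoint A * X * A) $$ (i,j) = (\<Sum>x\<in>pos m. X $$ x * (cnj (A $$ (fst x,i)) * A $$ (snd x,j)))"
    using Cons.prems X ij by (intro sandwich_index) auto
  also have "kraus_sum m As X $$ (i,j) = (\<Sum>x\<in>pos m. X $$ x * (\<Sum>A\<leftarrow>As. cnj (A $$ (fst x,i)) * A $$ (snd x,j)))"
    using Cons by simp
  finally show ?case by (simp add: sum.distrib distrib_left)
qed (use ij in \<open>simp add: kraus_sum_Nil\<close>)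

lemma sum_unitm:
  assumes "a < m" "b < m"
  shows "(\<Sum>x\<in>pos m. unitm m a b $$ x * f x) = f (a,b)"
proof -
  have "(\<Sum>x\<in>pos m. unitm m a b $$ x * f x) = (\<Sum>x\<in>pos m. if x = (a,b) then f x else 0)"
    by (rule sum.cong) (auto simp: unitm_index split: if_splits)
  also have "\<dots> = f (a,b)" using assms by simp
  finally show ?thesis .
qed

lemma kraus_unitm:
  assumes k: "is_kraus m F As" and "a < m" "b < m" "i < m" "j < m"
  shows "F (unitm m a b) $$ (i,j) = (\<Sum>A\<leftarrow>As. cnj (A $$ (a,i)) * A $$ (b,j))"
proof -
  have "F (unitm m a b) $$ (i,j) = kraus_sum m As (unitm m a b) $$ (i,j)"
    using k by (simp add: is_kraus_def)
  also have "\<dots> = (\<Sum>A\<leftarrow>As. cnj (A $$ (a,i)) * A $$ (b,j))"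
    using k assms by (subst kraus_sum_index) (auto simp: is_kraus_def sum_unitm)
  finally show ?thesis .
qed

text \<open>Linearity in coordinates with coefficients independent of \<open>X\<close>, in the shape
  that \<open>cesaro_sum\<close> needs to move a limit through \<open>F\<close>.\<close>

lemma kraus_expand:
  assumes k: "is_kraus m F As" and X: "X \<in> carrier_mat m m" and ij: "i < m" "j < m"
  shows "F X $$ (i,j) = (\<Sum>x\<in>pos m. F (unitm m (fst x) (snd x)) $$ (i,j) * X $$ x)"
proof -
  have "F X $$ (i,j) = (\<Sum>x\<in>pos m. X $$ x * (\<Sum>A\<leftarrow>As. cnj (A $$ (fst x,i)) * A $$ (snd x,j)))"
    using k X ij kraus_sum_index[of As m X i j] by (simp add: is_kraus_def)
  also have "\<dots> = (\<Sum>x\<in>pos m. F (unitm m (fst x) (snd x)) $$ (i,j) * X $$ x)"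
    using ij by (intro sum.cong refl) (auto simp: kraus_unitm[OF k] mult.commute)
  finally show ?thesis .
qed

lemma is_kraus_carrier: "is_kraus m F As \<Longrightarrow> X \<in> carrier_mat m m \<Longrightarrow> F X \<in> carrier_mat m m"
  unfolding is_kraus_def by (simp add: kraus_sum_carrier)

text \<open>On matrix units a single Kraus operator gives a product of one entry with the conjugate
  of another, so its double sum factors into an inner product times its conjugate.\<close>

lemma choi_form_kraus:
  assumes k: "is_kraus m F As"
  shows "choi_form m F v = complex_of_real (\<Sum>A\<leftarrow>As. (cmod (ip m A v))\<^sup>2)"
proof -
  have "choi_form m F v = (\<Sum>z\<in>pos m \<times> pos m. \<Sum>A\<leftarrow>As. (v $$ fst z * cnj (A $$ fst z)) * (A $$ snd z * cnj (v $$ snd z)))"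
    unfolding choi_form_def
  proof (rule sum.cong[OF refl])
    fix z :: "(nat \<times> nat) \<times> (nat \<times> nat)" assume z: "z \<in> pos m \<times> pos m"
    obtain a i b j where ab: "z = ((a,i),(b,j))" by (metis surj_pair)
    have "F (unitm m a b) $$ (i,j) = (\<Sum>A\<leftarrow>As. cnj (A $$ (a,i)) * A $$ (b,j))"
      using z by (intro kraus_unitm[OF k]) (auto simp: ab)
    thus "(v $$ fst z * cnj (v $$ snd z)) * F (unitm m (fst (fst z)) (fst (snd z))) $$ (snd (fst z), snd (snd z))
      = (\<Sum>A\<leftarrow>As. (v $$ fst z * cnj (A $$ fst z)) * (A $$ snd z * cnj (v $$ snd z)))"
      by (simp add: ab sum_list_const_mult[symmetric] mult_ac)
  qed
  also have "\<dots> = (\<Sum>A\<leftarrow>As. \<Sum>z\<in>pos m \<times> pos m. (v $$ fst z * cnj (A $$ fst z)) * (A $$ snd z * cnj (v $$ snd z)))"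
    by (rule sum_sum_list_swap)
  also have "\<dots> = (\<Sum>A\<leftarrow>As. complex_of_real ((cmod (ip m A v))\<^sup>2))"
  proof (rule arg_cong[of _ _ sum_list], rule map_cong[OF refl])
    fix A
    have "(\<Sum>z\<in>pos m \<times> pos m. (v $$ fst z * cnj (A $$ fst z)) * (A $$ snd z * cnj (v $$ snd z)))
      = (\<Sum>x\<in>pos m. v $$ x * cnj (A $$ x)) * (\<Sum>x\<in>pos m. A $$ x * cnj (v $$ x))"
      unfolding sum_product sum.cartesian_product by (rule sum.cong) auto
    also have "(\<Sum>x\<in>pos m. v $$ x * cnj (A $$ x)) = cnj (ip m A v)" by (simp add: ip_def mult.commute)
    also have "cnj (ip m A v) * (\<Sum>x\<in>pos m. A $$ x * cnj (v $$ x)) = complex_of_real ((cmod (ip m A v))\<^sup>2)"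
      unfolding ip_def[symmetric] complex_norm_square by (simp add: mult.commute)
    finally show "(\<Sum>z\<in>pos m \<times> pos m. (v $$ fst z * cnj (A $$ fst z)) * (A $$ snd z * cnj (v $$ snd z)))
      = complex_of_real ((cmod (ip m A v))\<^sup>2)" .
  qed
  also have "\<dots> = complex_of_real (\<Sum>A\<leftarrow>As. (cmod (ip m A v))\<^sup>2)" by (induction As) auto
  finally show ?thesis .
qed

lemma choi_form_eq_0_iff:
  assumes k: "is_kraus m F As"
  shows "choi_form m F v = 0 \<longleftrightarrow> (\<forall>A\<in>set As. ip m A v = 0)"
proof -
  have "choi_form m F v = 0 \<longleftrightarrow> (\<Sum>A\<leftarrow>As. (cmod (ip m A v))\<^sup>2) = 0"
    unfolding choi_form_kraus[OF k] by (rule of_real_eq_0_iff)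
  also have "\<dots> \<longleftrightarrow> (\<forall>A\<in>set As. ip m A v = 0)"
    by (subst sum_list_nonneg_eq_0_iff) auto
  finally show ?thesis .
qed

lemma kraus_sum_append:
  assumes "set As \<subseteq> carrier_mat m m" "set Bs \<subseteq> carrier_mat m m" "X \<in> carrier_mat m m"
  shows "kraus_sum m (As @ Bs) X = kraus_sum m As X + kraus_sum m Bs X"
  using assms(1)
proof (induction As)
  case Nil show ?case using kraus_sum_carrier[OF assms(2,3)] by (simp add: kraus_sum_Nil)
next
  case (Cons A As)
  have c: "mat_adjoint A * X * A \<in> carrier_mat m m"
    using mat_adjoint_index(1)[of A m] Cons.prems assms(3) by auto
  show ?case using Cons kraus_sum_carrier[OF assms(2,3)] kraus_sum_carrier[OF _ assms(3), of As] c
    by (simp add: kraus_sum_Cons assoc_add_mat[of _ m m])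
qed

lemma kraus_sum_sandwich:
  assumes A: "A \<in> carrier_mat m m" and X: "X \<in> carrier_mat m m" and "set Bs \<subseteq> carrier_mat m m"
  shows "mat_adjoint A * kraus_sum m Bs X * A = kraus_sum m (map (\<lambda>B. B * A) Bs) X"
  using assms(3)
proof (induction Bs)
  case Nil show ?case using A mat_adjoint_index(1)[OF A] by (simp add: kraus_sum_Nil)
next
  case (Cons B Bs)
  note A' = mat_adjoint_index(1)[OF A]
  have B: "B \<in> carrier_mat m m" using Cons.prems by auto
  note B' = mat_adjoint_index(1)[OF B]
  define Y where "Y = kraus_sum m Bs X"
  have Y: "Y \<in> carrier_mat m m" unfolding Y_def using kraus_sum_carrier[of Bs m X] Cons.prems X by auto
  have BX: "mat_adjoint B * X * B \<in> carrier_mat m m" using B' X B by auto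
  have "mat_adjoint A * kraus_sum m (B # Bs) X * A = mat_adjoint A * (mat_adjoint B * X * B) * A + mat_adjoint A * Y * A"
    unfolding kraus_sum_Cons Y_def[symmetric]
    using A A' Y BX by (simp add: mult_add_distrib_mat[of _ m m] add_mult_distrib_mat[of _ m m])
  also have "mat_adjoint A * (mat_adjoint B * X * B) * A = mat_adjoint (B * A) * X * (B * A)"
    unfolding mat_adjoint_mult[OF B A] using A A' B B' X
    by (simp add: assoc_mult_mat[of _ m m _ m _ m])
  finally show ?case using Cons by (simp add: kraus_sum_Cons Y_def)
qed

text \<open>The order reverses: sandwiching \<open>mat_adjoint B * X * B\<close> by \<open>A\<close>
  is sandwiching \<open>X\<close> by \<open>B * A\<close>, with \<open>B\<close> from the inner map.
  Hence \<open>T \<circ> \<psi>\<close> and \<open>\<psi> \<circ> T\<close> yield the two kinds of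
  products in the ideal property.\<close>

lemma is_kraus_comp:
  assumes F: "is_kraus m F As" and G: "is_kraus m G Bs"
  shows "is_kraus m (F \<circ> G) (concat (map (\<lambda>A. map (\<lambda>B. B * A) Bs) As))"
proof -
  have Bs: "set Bs \<subseteq> carrier_mat m m" using G by (simp add: is_kraus_def)
  have car: "set (concat (map (\<lambda>A. map (\<lambda>B. B * A) Bs) Cs)) \<subseteq> carrier_mat m m"
    if "set Cs \<subseteq> carrier_mat m m" for Cs
    using that Bs by auto (meson mult_carrier_mat subsetD)
  have "kraus_sum m Cs (kraus_sum m Bs X) = kraus_sum m (concat (map (\<lambda>A. map (\<lambda>B. B * A) Bs) Cs)) X"
    if "set Cs \<subseteq> carrier_mat m m" "X \<in> carrier_mat m m" for Cs X
    using that(1)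
  proof (induction Cs)
    case (Cons C Cs)
    have "set (map (\<lambda>B. B * C) Bs) \<subseteq> carrier_mat m m" using Cons.prems Bs by auto
    thus ?case using Cons that(2) Bs car[of Cs]
      by (simp add: kraus_sum_Cons kraus_sum_append kraus_sum_sandwich del: set_map set_concat)
  qed (simp add: kraus_sum_Nil)
  thus ?thesis using F G car[of As] unfolding is_kraus_def by (auto simp: kraus_sum_carrier)
qed

section \<open>Orthogonality in \<open>M_m\<close> and membership in a span\<close>

lemma ip_linear:
  assumes "X \<in> carrier_mat m m" "Y \<in> carrier_mat m m"
  shows "ip m (a \<cdot>\<^sub>m X + b \<cdot>\<^sub>m Y) v = a * ip m X v + b * ip m Y v"
  unfolding ip_def sum_distrib_left sum.distrib[symmetric]
  using assms by (intro sum.cong) (auto simp: algebra_simps)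

lemma ip_commute: "ip m v A = cnj (ip m A v)"
  by (simp add: ip_def mult.commute)

lemma ip_self_eq_0:
  assumes "w \<in> carrier_mat m m" "ip m w w = 0"
  shows "w = 0\<^sub>m m m"
proof -
  have "ip m w w = complex_of_real (\<Sum>x\<in>pos m. (cmod (w $$ x))\<^sup>2)"
    unfolding ip_def of_real_sum complex_norm_square ..
  hence "(\<Sum>x\<in>pos m. (cmod (w $$ x))\<^sup>2) = 0" using assms(2) by (metis of_real_eq_0_iff)
  hence "\<forall>x\<in>pos m. (cmod (w $$ x))\<^sup>2 = 0" by (subst (asm) sum_nonneg_eq_0_iff) auto
  thus ?thesis using assms(1) by (intro eq_matI) auto
qed

lemma mspan_least:
  assumes V: "msubspace m V" and "set Xs \<subseteq> V"
  shows "mspan m Xs \<subseteq> V"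
proof -
  \<comment> \<open>For the identity map, \<open>linear_on_lincomb\<close> is closure of
    \<open>V\<close> under linear combinations.\<close>
  have "linear_on m V (\<lambda>X. X)" by (simp add: linear_on_def)
  from linear_on_lincomb[OF V this _ assms(2)] show ?thesis by (auto simp: mspan_def)
qed

lemma ip_zero: "ip m (0\<^sub>m m m) v = 0"
  by (auto simp: ip_def intro!: sum.neutral)

lemma ip_mspan_eq_0:
  assumes "set Bs \<subseteq> carrier_mat m m" "\<And>B. B \<in> set Bs \<Longrightarrow> ip m B w = 0" "A \<in> mspan m Bs"
  shows "ip m A w = 0"
proof -
  have "msubspace m {A \<in> carrier_mat m m. ip m A w = 0}" unfolding msubspace_def
  proof (intro conjI ballI allI)
    fix Y Z :: "complex mat" and a b assume "Y \<in> {A \<in> carrier_mat m m. ip m A w = 0}" "Z \<in> {A \<in> carrier_mat m m. ip m A w = 0}"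
    thus "a \<cdot>\<^sub>m Y + b \<cdot>\<^sub>m Z \<in> {A \<in> carrier_mat m m. ip m A w = 0}" by (auto simp: ip_linear)
  qed (auto simp: ip_zero)
  from mspan_least[OF this, of Bs] assms show ?thesis by auto
qed

text \<open>Gram-Schmidt along the list: the part of \<open>B\<close> orthogonal to the remaining
  members is used to correct the part of \<open>X\<close> orthogonal to them.\<close>

lemma orthogonal_decomposition:
  assumes "set Bs \<subseteq> carrier_mat m m" "X \<in> carrier_mat m m"
  shows "\<exists>w\<in>carrier_mat m m. (\<forall>B\<in>set Bs. ip m B w = 0) \<and> 1 \<cdot>\<^sub>m X + (-1) \<cdot>\<^sub>m w \<in> mspan m Bs"
  using assms
proof (induction Bs arbitrary: X)
  case Nil
  have "1 \<cdot>\<^sub>m X + (-1) \<cdot>\<^sub>m X = 0\<^sub>m m m" using Nil.prems by (intro eq_matI) auto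
  thus ?case using Nil.prems msubspace_mspan[of "[]" m] by (intro bexI[of _ X]) (auto simp: msubspace_def)
next
  case (Cons B Bs)
  have B: "B \<in> carrier_mat m m" and Bs: "set Bs \<subseteq> carrier_mat m m" using Cons.prems by auto
  have V: "msubspace m (mspan m (B # Bs))" by (rule msubspace_mspan[OF Cons.prems(1)])
  have sub: "mspan m Bs \<subseteq> mspan m (B # Bs)" and BV: "B \<in> mspan m (B # Bs)"
    using mspan_least[OF V, of Bs] set_subset_mspan[OF Cons.prems(1)] by auto
  from Cons.IH[OF Bs B] obtain wB where wB: "wB \<in> carrier_mat m m" "\<forall>A\<in>set Bs. ip m A wB = 0"
    "1 \<cdot>\<^sub>m B + (-1) \<cdot>\<^sub>m wB \<in> mspan m Bs" by blast
  from Cons.IH[OF Bs Cons.prems(2)] obtain w where w: "w \<in> carrier_mat m m" "\<forall>A\<in>set Bs. ip m A w = 0"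
    "1 \<cdot>\<^sub>m X + (-1) \<cdot>\<^sub>m w \<in> mspan m Bs" by blast
  \<comment> \<open>The projection coefficient on \<open>wB\<close>. If \<open>B\<close> already
    lies in the span of the others, then \<open>wB = 0\<close>, and the division by 0 does no
    harm.\<close>
  define c where "c = ip m w wB / ip m wB wB"
  define w' where "w' = 1 \<cdot>\<^sub>m w + (-c) \<cdot>\<^sub>m wB"
  have w'c: "w' \<in> carrier_mat m m" using w wB by (simp add: w'_def)
  have w'Bs: "ip m A w' = 0" if "A \<in> set Bs" for A
    using ip_linear[OF w(1) wB(1), of 1 "-c" A] that w(2) wB(2) ip_commute[of m A w'] ip_commute[of m w A] ip_commute[of m wB A]
    by (simp add: w'_def)
  have w'wB: "ip m wB w' = 0"
  proof (cases "ip m wB wB = 0")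
    case True
    hence "wB = 0\<^sub>m m m" using ip_self_eq_0[OF wB(1)] by simp
    thus ?thesis by (simp add: ip_zero)
  next
    case False
    have "ip m w' wB = 0" unfolding w'_def ip_linear[OF w(1) wB(1)] using False by (simp add: c_def)
    thus ?thesis using ip_commute[of m wB w'] by simp
  qed
  have "ip m B w' = 0"
  proof -
    have "ip m (1 \<cdot>\<^sub>m B + (-1) \<cdot>\<^sub>m wB) w' = 0" by (rule ip_mspan_eq_0[OF Bs w'Bs wB(3)])
    thus ?thesis unfolding ip_linear[OF B wB(1)] using w'wB by simp
  qed
  moreover have "1 \<cdot>\<^sub>m X + (-1) \<cdot>\<^sub>m w' \<in> mspan m (B # Bs)"
  proof -
    have "1 \<cdot>\<^sub>m B + (-1) \<cdot>\<^sub>m (1 \<cdot>\<^sub>m B + (-1) \<cdot>\<^sub>m wB) \<in> mspan m (B # Bs)"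
      using msubspace_add_smult[OF V BV] wB(3) sub by blast
    moreover have "1 \<cdot>\<^sub>m B + (-1) \<cdot>\<^sub>m (1 \<cdot>\<^sub>m B + (-1) \<cdot>\<^sub>m wB) = wB" using B wB(1) by (intro eq_matI) auto
    ultimately have "wB \<in> mspan m (B # Bs)" by simp
    hence "1 \<cdot>\<^sub>m (1 \<cdot>\<^sub>m X + (-1) \<cdot>\<^sub>m w) + c \<cdot>\<^sub>m wB \<in> mspan m (B # Bs)"
      using msubspace_add_smult[OF V] w(3) sub by blast
    moreover have "1 \<cdot>\<^sub>m (1 \<cdot>\<^sub>m X + (-1) \<cdot>\<^sub>m w) + c \<cdot>\<^sub>m wB = 1 \<cdot>\<^sub>m X + (-1) \<cdot>\<^sub>m w'"
      unfolding w'_def using Cons.prems(2) w(1) wB(1) by (intro eq_matI) auto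
    ultimately show ?thesis by simp
  qed
  ultimately show ?case using w'c w'Bs by (intro bexI[of _ w']) auto
qed

text \<open>A span equals its double orthogonal complement: the orthogonal part \<open>w\<close> of
  \<open>X\<close> satisfies \<open>ip m w w = 0\<close>.\<close>

lemma mem_mspanI:
  assumes Bs: "set Bs \<subseteq> carrier_mat m m" and X: "X \<in> carrier_mat m m"
    and orth: "\<And>v. v \<in> carrier_mat m m \<Longrightarrow> (\<And>B. B \<in> set Bs \<Longrightarrow> ip m B v = 0) \<Longrightarrow> ip m X v = 0"
  shows "X \<in> mspan m Bs"
proof -
  from orthogonal_decomposition[OF Bs X] obtain w where w: "w \<in> carrier_mat m m" "\<forall>B\<in>set Bs. ip m B w = 0"
    "1 \<cdot>\<^sub>m X + (-1) \<cdot>\<^sub>m w \<in> mspan m Bs" by blast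
  have "ip m X w = 0" using orth[OF w(1)] w(2) by blast
  moreover have "ip m (1 \<cdot>\<^sub>m X + (-1) \<cdot>\<^sub>m w) w = 0" using ip_mspan_eq_0[OF Bs _ w(3)] w(2) by blast
  ultimately have "ip m w w = 0" unfolding ip_linear[OF X w(1)] by simp
  hence w0: "w = 0\<^sub>m m m" by (rule ip_self_eq_0[OF w(1)])
  have "1 \<cdot>\<^sub>m X + (-1) \<cdot>\<^sub>m w = X" unfolding w0 using X by (intro eq_matI) auto
  thus ?thesis using w(3) by simp
qed

section \<open>The ideal spanned by the Kraus operators of the maximal part\<close>

lemma subalg_msubspace: "subalg m S \<Longrightarrow> msubspace m S"
  unfolding subalg_def msubspace_def by blast

lemma subalg_gen_alg:
  assumes "set As \<subseteq> carrier_mat m m"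
  shows "subalg m (gen_alg m As)" "set As \<subseteq> gen_alg m As"
proof -
  have "subalg m (carrier_mat m m)" by (auto simp: subalg_def)
  hence "gen_alg m As \<subseteq> carrier_mat m m" using assms unfolding gen_alg_def by blast
  thus "subalg m (gen_alg m As)" unfolding subalg_def gen_alg_def by auto
  show "set As \<subseteq> gen_alg m As" unfolding gen_alg_def by auto
qed

lemma gen_alg_least: "subalg m S \<Longrightarrow> set As \<subseteq> S \<Longrightarrow> gen_alg m As \<subseteq> S"
  unfolding gen_alg_def by blast

text \<open>The operators of an iterate are nonempty words in \<open>As\<close>. The count starts at
  \<open>Suc n\<close> because \<open>S\<close> may lack the identity matrix, the empty
  word.\<close>

lemma kraus_funpow:
  assumes k: "is_kraus m T As" and S: "subalg m S" "set As \<subseteq> S"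
  shows "\<exists>Ws. is_kraus m (T ^^ Suc n) Ws \<and> set Ws \<subseteq> S"
proof (induction n)
  case 0 show ?case using k S(2) by (auto simp: fun_eq_iff)
next
  case (Suc n)
  then obtain Ws where Ws: "is_kraus m (T ^^ Suc n) Ws" "set Ws \<subseteq> S" by blast
  have "set (concat (map (\<lambda>A. map (\<lambda>B. B * A) Ws) As)) \<subseteq> S"
    using S Ws(2) unfolding subalg_def by auto blast
  moreover have "T ^^ Suc (Suc n) = T \<circ> T ^^ Suc n" by simp
  ultimately show ?case using is_kraus_comp[OF k Ws(1)] by metis
qed

section \<open>Bounds by the trace of the Choi matrix\<close>

lemma cmod_sum_list_le:
  fixes f :: "'a \<Rightarrow> complex" and g :: "'a \<Rightarrow> real"
  assumes "\<And>A. A \<in> set As \<Longrightarrow> cmod (f A) \<le> g A"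
  shows "cmod (\<Sum>A\<leftarrow>As. f A) \<le> (\<Sum>A\<leftarrow>As. g A)"
  using assms
proof (induction As)
  case (Cons A As)
  have "cmod (f A + (\<Sum>A\<leftarrow>As. f A)) \<le> cmod (f A) + cmod (\<Sum>A\<leftarrow>As. f A)" by (rule norm_triangle_ineq)
  also have "\<dots> \<le> g A + (\<Sum>A\<leftarrow>As. g A)" using Cons by (intro add_mono) auto
  finally show ?case by simp
qed simp

text \<open>A completely positive map is dominated by the trace of its Choi matrix.\<close>

definition choi_trace :: "nat \<Rightarrow> (complex mat \<Rightarrow> complex mat) \<Rightarrow> complex" where
  "choi_trace m F = (\<Sum>x\<in>pos m. F (unitm m (fst x) (fst x)) $$ (snd x, snd x))"

lemma choi_trace_kraus:
  assumes k: "is_kraus m F As"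
  shows "choi_trace m F = complex_of_real (\<Sum>A\<leftarrow>As. \<Sum>x\<in>pos m. (cmod (A $$ x))\<^sup>2)"
proof -
  have "choi_trace m F = (\<Sum>x\<in>pos m. \<Sum>A\<leftarrow>As. complex_of_real ((cmod (A $$ x))\<^sup>2))"
    unfolding choi_trace_def
  proof (rule sum.cong[OF refl])
    fix x assume "x \<in> pos m"
    hence "F (unitm m (fst x) (fst x)) $$ (snd x, snd x) = (\<Sum>A\<leftarrow>As. cnj (A $$ (fst x, snd x)) * A $$ (fst x, snd x))"
      by (intro kraus_unitm[OF k]) auto
    thus "F (unitm m (fst x) (fst x)) $$ (snd x, snd x) = (\<Sum>A\<leftarrow>As. complex_of_real ((cmod (A $$ x))\<^sup>2))"
      unfolding complex_norm_square by (simp add: mult.commute)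
  qed
  also have "\<dots> = (\<Sum>A\<leftarrow>As. \<Sum>x\<in>pos m. complex_of_real ((cmod (A $$ x))\<^sup>2))" by (rule sum_sum_list_swap)
  also have "\<dots> = complex_of_real (\<Sum>A\<leftarrow>As. \<Sum>x\<in>pos m. (cmod (A $$ x))\<^sup>2)" by (induction As) auto
  finally show ?thesis .
qed

text \<open>A product of two moduli is at most half the sum of their squares, hence at most the
  squared Hilbert-Schmidt norm of the operator; the trace sums these norms.\<close>

lemma kraus_unitm_bound:
  assumes k: "is_kraus m F As" and "a < m" "b < m" "i < m" "j < m"
  shows "cmod (F (unitm m a b) $$ (i,j)) \<le> Re (choi_trace m F)"
  unfolding kraus_unitm[OF assms] choi_trace_kraus[OF k] Re_complex_of_real
proof (rule cmod_sum_list_le)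
  fix A :: "complex mat"
  let ?s = "\<Sum>x\<in>pos m. (cmod (A $$ x))\<^sup>2"
  have le: "(cmod (A $$ (p,q)))\<^sup>2 \<le> ?s" if "p < m" "q < m" for p q
    using that by (intro member_le_sum) auto
  have "2 * cmod (A $$ (a,i)) * cmod (A $$ (b,j)) \<le> (cmod (A $$ (a,i)))\<^sup>2 + (cmod (A $$ (b,j)))\<^sup>2"
    by (rule sum_squares_bound)
  also have "\<dots> \<le> 2 * ?s" using le[of a i] le[of b j] assms by simp
  finally show "cmod (cnj (A $$ (a,i)) * A $$ (b,j)) \<le> ?s" by (simp add: norm_mult)
qed

lemma kraus_bound:
  assumes k: "is_kraus m F As" and X: "X \<in> carrier_mat m m" and ij: "i < m" "j < m"
  shows "cmod (F X $$ (i,j)) \<le> (\<Sum>x\<in>pos m. cmod (X $$ x)) * Re (choi_trace m F)"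
proof -
  have "cmod (F X $$ (i,j)) \<le> (\<Sum>x\<in>pos m. cmod (F (unitm m (fst x) (snd x)) $$ (i,j) * X $$ x))"
    unfolding kraus_expand[OF k X ij] by (rule norm_sum)
  also have "\<dots> \<le> (\<Sum>x\<in>pos m. cmod (X $$ x) * Re (choi_trace m F))"
  proof (rule sum_mono)
    fix x assume "x \<in> pos m"
    hence "cmod (F (unitm m (fst x) (snd x)) $$ (i,j)) \<le> Re (choi_trace m F)"
      using ij by (intro kraus_unitm_bound[OF k]) auto
    from mult_right_mono[OF this norm_ge_zero[of "X $$ x"]]
    show "cmod (F (unitm m (fst x) (snd x)) $$ (i,j) * X $$ x) \<le> cmod (X $$ x) * Re (choi_trace m F)"
      by (simp add: norm_mult mult.commute)
  qed
  finally show ?thesis by (simp add: sum_distrib_right)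
qed

text \<open>\<open>X\<close> is the combination of the matrix units with its own entries as
  coefficients, so the coordinates of the matrix units bound those of \<open>X\<close>.\<close>

lemma coords_bounded:
  assumes b: "is_basis m (carrier_mat m m) \<gamma>"
  shows "\<exists>C\<ge>0. \<forall>X\<in>carrier_mat m m. \<forall>p<length \<gamma>.
    cmod (coords m \<gamma> X ! p) \<le> C * (\<Sum>x\<in>pos m. cmod (X $$ x))"
proof -
  let ?d = "length \<gamma>"
  have "\<forall>x. \<exists>w\<in>carrier_vec ?d. unitm m (fst x) (snd x) = comb m \<gamma> w"
    using b unitm_carrier unfolding is_basis_iff by (metis imageE)
  then obtain w where w: "\<And>x. w x \<in> carrier_vec ?d" "\<And>x. unitm m (fst x) (snd x) = comb m \<gamma> (w x)" by metis
  define C where "C = (\<Sum>x\<in>pos m. \<Sum>p<?d. cmod (w x $ p))"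
  have C0: "C \<ge> 0" unfolding C_def by (intro sum_nonneg) auto
  show ?thesis
  proof (intro exI[of _ C] conjI C0 ballI allI impI)
    fix X :: "complex mat" and p assume X: "X \<in> carrier_mat m m" and p: "p < ?d"
    define u where "u = vec ?d (\<lambda>p. \<Sum>x\<in>pos m. X $$ x * w x $ p)"
    have u: "u \<in> carrier_vec ?d" by (simp add: u_def)
    have "X = comb m \<gamma> u"
    proof (rule eq_matI, goal_cases)
      case (1 i j)
      hence ij: "i < m" "j < m" by auto
      have "comb m \<gamma> u $$ (i,j) = (\<Sum>p<?d. \<Sum>x\<in>pos m. X $$ x * (w x $ p * \<gamma> ! p $$ (i,j)))"
        using ij by (simp add: comb_index u_def sum_distrib_right mult.assoc)
      also have "\<dots> = (\<Sum>x\<in>pos m. \<Sum>p<?d. X $$ x * (w x $ p * \<gamma> ! p $$ (i,j)))" by (rule sum.swap)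
      also have "\<dots> = (\<Sum>x\<in>pos m. X $$ x * unitm m (fst x) (snd x) $$ (i,j))"
        using ij by (simp add: w(2) comb_index sum_distrib_left)
      also have "\<dots> = (\<Sum>x\<in>pos m. if x = (i,j) then X $$ x else 0)"
        using ij by (intro sum.cong) (auto simp: unitm_index split: if_splits)
      also have "\<dots> = X $$ (i,j)" using ij by simp
      finally show ?case by simp
    qed (use X in auto)
    hence "coords m \<gamma> X ! p = u $ p" using coords_comb[OF b u] by (simp add: list_of_vec_index)
    also have "cmod (u $ p) \<le> (\<Sum>x\<in>pos m. cmod (X $$ x * w x $ p))"
      unfolding u_def using p by (simp add: norm_sum)
    also have "\<dots> \<le> (\<Sum>x\<in>pos m. C * cmod (X $$ x))"
    proof (rule sum_mono)
      fix x assume x: "x \<in> pos m"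
      have "cmod (w x $ p) \<le> (\<Sum>p<?d. cmod (w x $ p))" using p by (intro member_le_sum) auto
      also have "\<dots> \<le> C" unfolding C_def using x
        by (intro member_le_sum[of x "pos m" "\<lambda>x. \<Sum>p<?d. cmod (w x $ p)"]) (auto intro: sum_nonneg)
      finally have "cmod (w x $ p) * cmod (X $$ x) \<le> C * cmod (X $$ x)" by (intro mult_right_mono) auto
      thus "cmod (X $$ x * w x $ p) \<le> C * cmod (X $$ x)" by (simp add: norm_mult mult.commute)
    qed
    finally show "cmod (coords m \<gamma> X ! p) \<le> C * (\<Sum>x\<in>pos m. cmod (X $$ x))" by (simp add: sum_distrib_left)
  qed
qed

text \<open>The constant depends on \<open>\<gamma>\<close> alone and so serves all powers of
  \<open>T\<close> at once. Entries of the coordinate matrix are coordinates of images of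
  \<open>\<gamma>\<close>, and both passages are bounded by the lemmas above.\<close>

lemma beta_norm_le_choi_trace:
  assumes b: "is_basis m (carrier_mat m m) \<gamma>" and ne: "\<gamma> \<noteq> []"
  shows "\<exists>C>0. \<forall>F As. is_kraus m F As \<longrightarrow> beta_norm m \<gamma> F \<le> C * Re (choi_trace m F)"
proof -
  obtain C where C: "C \<ge> 0" "\<And>X p. X \<in> carrier_mat m m \<Longrightarrow> p < length \<gamma> \<Longrightarrow>
    cmod (coords m \<gamma> X ! p) \<le> C * (\<Sum>x\<in>pos m. cmod (X $$ x))" using coords_bounded[OF b] by blast
  let ?d = "length \<gamma>"
  define M where "M = (\<Sum>q<?d. \<Sum>x\<in>pos m. cmod (\<gamma> ! q $$ x))"
  have M0: "M \<ge> 0" unfolding M_def by (intro sum_nonneg) auto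
  \<comment> \<open>The added 1 makes the constant strictly positive.\<close>
  define C' where "C' = C * (real (card (pos m)) * M) + 1"
  have C': "C' > 0" unfolding C'_def using C(1) M0 by (intro add_nonneg_pos mult_nonneg_nonneg) auto
  show ?thesis
  proof (intro exI[of _ C'] conjI C' allI impI)
    fix F As assume k: "is_kraus m F As"
    let ?t = "Re (choi_trace m F)"
    have t0: "?t \<ge> 0" unfolding choi_trace_kraus[OF k] Re_complex_of_real
      by (intro sum_list_nonneg) (auto intro: sum_nonneg)
    let ?A = "{cmod (map_mat m \<gamma> F $$ (i,j)) | i j. i < ?d \<and> j < ?d}"
    have "?A = (\<lambda>(i,j). cmod (map_mat m \<gamma> F $$ (i,j))) ` ({..<?d} \<times> {..<?d})" by auto
    hence fin: "finite ?A" by simp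
    have "Max ?A \<le> C' * ?t"
    proof (subst Max_le_iff[OF fin])
      show "?A \<noteq> {}" using ne by blast
      show "\<forall>x\<in>?A. x \<le> C' * ?t"
      proof
        fix y assume "y \<in> ?A"
        then obtain p q where pq: "p < ?d" "q < ?d" and y: "y = cmod (map_mat m \<gamma> F $$ (p,q))" by blast
        have g: "\<gamma> ! q \<in> carrier_mat m m" using b pq(2) by (auto simp: is_basis_def)
        have "y = cmod (coords m \<gamma> (F (\<gamma> ! q)) ! p)" using pq by (simp add: y map_mat_def)
        also have "\<dots> \<le> C * (\<Sum>x\<in>pos m. cmod (F (\<gamma> ! q) $$ x))"
          using is_kraus_carrier[OF k g] pq(1) by (rule C(2))
        also have "\<dots> \<le> C * (\<Sum>x\<in>pos m. M * ?t)"
        proof (intro mult_left_mono[OF _ C(1)] sum_mono)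
          fix x assume x: "x \<in> pos m"
          hence "cmod (F (\<gamma> ! q) $$ x) \<le> (\<Sum>x\<in>pos m. cmod (\<gamma> ! q $$ x)) * ?t"
            using kraus_bound[OF k g, of "fst x" "snd x"] by auto
          also have "(\<Sum>x\<in>pos m. cmod (\<gamma> ! q $$ x)) \<le> M" unfolding M_def using pq(2)
            by (intro member_le_sum[of q "{..<?d}" "\<lambda>q. \<Sum>x\<in>pos m. cmod (\<gamma> ! q $$ x)"]) (auto intro: sum_nonneg)
          finally show "cmod (F (\<gamma> ! q) $$ x) \<le> M * ?t" using t0 by (simp add: mult_right_mono)
        qed
        also have "\<dots> = (C * (real (card (pos m)) * M)) * ?t" by simp
        also have "\<dots> \<le> C' * ?t" using t0 unfolding C'_def by (intro mult_right_mono) auto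
        finally show "y \<le> C' * ?t" .
      qed
    qed
    thus "beta_norm m \<gamma> F \<le> C' * ?t" by (simp add: beta_norm_def)
  qed
qed

text \<open>The mean of \<open>u\<close> up to \<open>N\<close> is at most \<open>2 * K\<close>
  times the mean of \<open>h\<close> up to \<open>N + 1\<close>; the factor 2 comes from
  \<open>1 / N \<le> 2 / (N + 1)\<close>.\<close>

lemma cesaro_shift_le_zero:
  fixes h u :: "nat \<Rightarrow> real"
  assumes h: "\<And>n. h n \<ge> 0" "(\<lambda>N. (\<Sum>n=1..N. h n) / real N) \<longlonglongrightarrow> 0"
    and u: "\<And>n. u n \<le> K * h (Suc n)" "(\<lambda>N. (\<Sum>n=1..N. u n) / real N) \<longlonglongrightarrow> L" and K: "K \<ge> 0"
  shows "L \<le> 0"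
proof (rule LIMSEQ_le[OF u(2)])
  have "(\<lambda>N. (\<Sum>n=1..Suc N. h n) / real (Suc N)) \<longlonglongrightarrow> 0" using LIMSEQ_Suc[OF h(2)] .
  hence "(\<lambda>N. K * (2 * ((\<Sum>n=1..Suc N. h n) / real (Suc N)))) \<longlonglongrightarrow> K * (2 * 0)" by (intro tendsto_intros)
  thus "(\<lambda>N. K * (2 * ((\<Sum>n=1..Suc N. h n) / real (Suc N)))) \<longlonglongrightarrow> 0" by simp
  show "\<exists>N0. \<forall>N\<ge>N0. (\<Sum>n=1..N. u n) / real N \<le> K * (2 * ((\<Sum>n=1..Suc N. h n) / real (Suc N)))"
  proof (intro exI allI impI)
    fix N :: nat assume N: "N \<ge> 1"
    let ?H = "\<Sum>n=1..Suc N. h n"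
    have H0: "?H \<ge> 0" using h(1) by (intro sum_nonneg)
    have "(\<Sum>n=1..N. u n) \<le> (\<Sum>n=1..N. K * h (Suc n))" by (rule sum_mono) (rule u(1))
    also have "\<dots> = K * (\<Sum>n=2..Suc N. h n)"
      unfolding sum_distrib_left[symmetric] by (simp add: sum.shift_bounds_cl_Suc_ivl[symmetric] numeral_2_eq_2)
    also have "\<dots> \<le> K * ?H" using h(1) by (intro mult_left_mono[OF _ K] sum_mono2) auto
    finally have "(\<Sum>n=1..N. u n) / real N \<le> K * ?H / real N" by (rule divide_right_mono) simp
    also have "\<dots> \<le> K * ?H * (2 / real (Suc N))"
    proof -
      have "1 / real N \<le> 2 / real (Suc N)" using N by (simp add: field_simps)
      from mult_left_mono[OF this, of "K * ?H"] show ?thesis using K H0 by simp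
    qed
    finally show "(\<Sum>n=1..N. u n) / real N \<le> K * (2 * (?H / real (Suc N)))" by (simp add: mult_ac)
  qed
qed

lemma cesaro_choi_form:
  assumes "\<And>X i j. X \<in> carrier_mat m m \<Longrightarrow> i < m \<Longrightarrow> j < m \<Longrightarrow>
       (\<lambda>N. (\<Sum>n=1..N. F n X $$ (i,j) / complex_of_real (D n)) / of_nat N) \<longlonglongrightarrow> G X $$ (i,j)"
  shows "(\<lambda>N. (\<Sum>n=1..N. choi_form m (F n) v / complex_of_real (D n)) / of_nat N) \<longlonglongrightarrow> choi_form m G v"
  unfolding choi_form_def
  by (rule cesaro_sum) (use assms in auto)

text \<open>Membership in a span is always tested on its orthogonal complement, where it becomes
  vanishing of a limit of Choi forms.\<close>

lemma kraus_ideal: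
  assumes T: "is_kraus m T As" and \<psi>: "is_kraus m \<psi> Bs"
    and D: "\<And>n. D n > 0" and K: "K > 0" "\<And>n. D (Suc n) \<le> K * D n"
    and lim: "\<And>X i j. X \<in> carrier_mat m m \<Longrightarrow> i < m \<Longrightarrow> j < m \<Longrightarrow>
       (\<lambda>N. (\<Sum>n=1..N. (T ^^ n) X $$ (i,j) / complex_of_real (D n)) / of_nat N) \<longlonglongrightarrow> \<psi> X $$ (i,j)"
  shows "mspan m Bs \<subseteq> gen_alg m As" "is_ideal m (mspan m Bs) (gen_alg m As)"
proof -
  have As: "set As \<subseteq> carrier_mat m m" and Bs: "set Bs \<subseteq> carrier_mat m m"
    using T \<psi> by (auto simp: is_kraus_def)
  note alg = subalg_gen_alg[OF As]
  have V: "msubspace m (mspan m Bs)" by (rule msubspace_mspan[OF Bs])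
  have Bspan: "set Bs \<subseteq> mspan m Bs" by (rule set_subset_mspan[OF Bs])
  have gc: "gen_alg m As \<subseteq> carrier_mat m m" using alg(1) by (simp add: subalg_def)
  have limc: "(\<lambda>N. (\<Sum>n=1..N. choi_form m (T ^^ n) v / complex_of_real (D n)) / of_nat N) \<longlonglongrightarrow> choi_form m \<psi> v" for v
    by (rule cesaro_choi_form[OF lim])
  \<comment> \<open>A finite basis presents the generated algebra as a span, so that
    \<open>mem_mspanI\<close> applies to it.\<close>
  obtain \<beta> where \<beta>: "is_basis m (gen_alg m As) \<beta>" using msubspace_has_basis[OF subalg_msubspace[OF alg(1)]] .
  have bc: "set \<beta> \<subseteq> carrier_mat m m" and bs: "mspan m \<beta> = gen_alg m As" using \<beta> by (auto simp: is_basis_def)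
  have "B \<in> mspan m \<beta>" if B: "B \<in> set Bs" for B
  proof (rule mem_mspanI[OF bc])
    show "B \<in> carrier_mat m m" using B Bs by auto
    fix v assume v: "\<And>A. A \<in> set \<beta> \<Longrightarrow> ip m A v = 0"
    have orth: "ip m A v = 0" if "A \<in> gen_alg m As" for A
      using ip_mspan_eq_0[OF bc v, of A] that bs by simp
    have "choi_form m (T ^^ n) v = 0" if "n \<ge> 1" for n
    proof -
      from that obtain n' where n': "n = Suc n'" by (cases n) auto
      obtain Ws where "is_kraus m (T ^^ n) Ws" "set Ws \<subseteq> gen_alg m As"
        using kraus_funpow[OF T alg, of n'] n' by blast
      thus ?thesis using choi_form_eq_0_iff orth by blast
    qed
    hence "(\<lambda>N. (\<Sum>n=1..N. choi_form m (T ^^ n) v / complex_of_real (D n)) / of_nat N) = (\<lambda>N. 0)" by simp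
    with limc[of v] have "choi_form m \<psi> v = 0" using LIMSEQ_unique tendsto_const by metis
    thus "ip m B v = 0" using choi_form_eq_0_iff[OF \<psi>] B by blast
  qed
  hence "set Bs \<subseteq> gen_alg m As" using bs by auto
  thus sub: "mspan m Bs \<subseteq> gen_alg m As" by (rule mspan_least[OF subalg_msubspace[OF alg(1)]])
  \<comment> \<open>Any Kraus-form limit \<open>G\<close> of the index-shifted means has its
    operators in \<open>mspan m Bs\<close>. For \<open>v\<close> orthogonal to \<open>Bs\<close> the
    means of \<open>h\<close> tend to 0, and \<open>D (Suc n) \<le> K * D n\<close> bounds the
    shifted forms by \<open>K * h (Suc n)\<close>.\<close>
  have key: "C \<in> mspan m Bs" if G: "is_kraus m G Cs" and C: "C \<in> set Cs"
    and Glim: "\<And>X i j. X \<in> carrier_mat m m \<Longrightarrow> i < m \<Longrightarrow> j < m \<Longrightarrow>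
       (\<lambda>N. (\<Sum>n=1..N. (T ^^ Suc n) X $$ (i,j) / complex_of_real (D n)) / of_nat N) \<longlonglongrightarrow> G X $$ (i,j)" for G Cs C
  proof (rule mem_mspanI[OF Bs])
    show "C \<in> carrier_mat m m" using G C by (auto simp: is_kraus_def)
    fix v assume v: "\<And>B. B \<in> set Bs \<Longrightarrow> ip m B v = 0"
    have q0: "choi_form m \<psi> v = 0" using choi_form_eq_0_iff[OF \<psi>] v by blast
    define f where "f n = Re (choi_form m (T ^^ n) v)" for n
    have "choi_form m (T ^^ Suc n) v = complex_of_real (f (Suc n)) \<and> f (Suc n) \<ge> 0" for n
    proof -
      obtain Ws where "is_kraus m (T ^^ Suc n) Ws" using kraus_funpow[OF T alg, of n] by blast
      from choi_form_kraus[OF this, of v] show ?thesis unfolding f_def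
        by (simp del: funpow.simps) (auto intro!: sum_list_nonneg)
    qed
    hence fS: "choi_form m (T ^^ Suc n) v = complex_of_real (f (Suc n))" "f (Suc n) \<ge> 0" for n by blast+
    have f: "choi_form m (T ^^ n) v = complex_of_real (f n)" "f n \<ge> 0" if "n \<ge> 1" for n
      using fS[of "n - 1"] that by (simp_all del: funpow.simps)
    \<comment> \<open>The value at 0 is set to 0 because \<open>f n \<ge> 0\<close> is available
      only for \<open>n \<ge> 1\<close>; the means start at 1 anyway.\<close>
    define h where "h n = (if n = 0 then 0 else f n / D n)" for n
    have h0: "h n \<ge> 0" for n using f(2)[of n] D[of n] by (auto simp: h_def)
    have "(\<lambda>N. complex_of_real ((\<Sum>n=1..N. h n) / real N)) \<longlonglongrightarrow> complex_of_real 0"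
    proof -
      have e: "(\<Sum>n=1..N. choi_form m (T ^^ n) v / complex_of_real (D n)) / of_nat N = complex_of_real ((\<Sum>n=1..N. h n) / real N)" for N
        by (simp add: f(1) h_def)
      show ?thesis using limc[of v] unfolding e q0 of_real_0 .
    qed
    hence hlim: "(\<lambda>N. (\<Sum>n=1..N. h n) / real N) \<longlonglongrightarrow> 0" by (simp only: tendsto_of_real_iff)
    define u where "u n = f (Suc n) / D n" for n
    have u: "u n \<le> K * h (Suc n)" for n
    proof -
      have "1 / D n \<le> K / D (Suc n)" using D[of n] D[of "Suc n"] K(2)[of n] by (simp add: field_simps)
      from mult_left_mono[OF this fS(2)[of n]] show ?thesis by (simp add: u_def h_def mult.commute)
    qed
    have "choi_form m G v = complex_of_real (\<Sum>A\<leftarrow>Cs. (cmod (ip m A v))\<^sup>2)" by (rule choi_form_kraus[OF G])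
    moreover define L where "L = (\<Sum>A\<leftarrow>Cs. (cmod (ip m A v))\<^sup>2)"
    ultimately have L: "choi_form m G v = complex_of_real L" by simp
    have L0: "L \<ge> 0" unfolding L_def by (auto intro!: sum_list_nonneg)
    have "(\<lambda>N. complex_of_real ((\<Sum>n=1..N. u n) / real N)) \<longlonglongrightarrow> complex_of_real L"
    proof -
      have e: "(\<Sum>n=1..N. choi_form m (T ^^ Suc n) v / complex_of_real (D n)) / of_nat N = complex_of_real ((\<Sum>n=1..N. u n) / real N)" for N
        by (simp add: fS(1) u_def del: funpow.simps)
      have "(\<lambda>N. (\<Sum>n=1..N. choi_form m (T ^^ Suc n) v / complex_of_real (D n)) / of_nat N) \<longlonglongrightarrow> choi_form m G v"
        by (rule cesaro_choi_form[OF Glim])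
      thus ?thesis unfolding e L .
    qed
    hence "(\<lambda>N. (\<Sum>n=1..N. u n) / real N) \<longlonglongrightarrow> L" by (simp only: tendsto_of_real_iff)
    from cesaro_shift_le_zero[OF h0 hlim u this] K(1) have "L \<le> 0" by simp
    with L0 L have "choi_form m G v = 0" by simp
    thus "ip m C v = 0" using choi_form_eq_0_iff[OF G] C by blast
  qed
  have Tc: "T X \<in> carrier_mat m m" if "X \<in> carrier_mat m m" for X by (rule is_kraus_carrier[OF T that])
  have Tnc: "(T ^^ n) X \<in> carrier_mat m m" if "X \<in> carrier_mat m m" for n X
    using that Tc by (induction n) auto
  \<comment> \<open>Here \<open>G = T \<circ> \<psi>\<close>: the outer \<open>T\<close> is pulled
    out of the limit by its expansion on matrix units.\<close>
  have BA: "B * A \<in> mspan m Bs" if "A \<in> set As" "B \<in> set Bs" for A B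
  proof (rule key[OF is_kraus_comp[OF T \<psi>]])
    show "B * A \<in> set (concat (map (\<lambda>A. map (\<lambda>B. B * A) Bs) As))" using that by auto
    fix X :: "complex mat" and i j assume X: "X \<in> carrier_mat m m" and ij: "i < m" "j < m"
    have 1: "(T ^^ Suc n) X $$ (i,j) = (\<Sum>x\<in>pos m. T (unitm m (fst x) (snd x)) $$ (i,j) * (T ^^ n) X $$ x)" for n
      using kraus_expand[OF T Tnc[OF X] ij, of n] by simp
    have 2: "(T \<circ> \<psi>) X $$ (i,j) = (\<Sum>x\<in>pos m. T (unitm m (fst x) (snd x)) $$ (i,j) * \<psi> X $$ x)"
      using kraus_expand[OF T is_kraus_carrier[OF \<psi> X] ij] by simp
    show "(\<lambda>N. (\<Sum>n=1..N. (T ^^ Suc n) X $$ (i,j) / complex_of_real (D n)) / of_nat N) \<longlonglongrightarrow> (T \<circ> \<psi>) X $$ (i,j)"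
      unfolding 1 2 by (rule cesaro_sum) (use lim[OF X] in auto)
  qed
  \<comment> \<open>Here \<open>G = \<psi> \<circ> T\<close>: the limit is taken at the argument
    \<open>T X\<close>.\<close>
  have AB: "A * B \<in> mspan m Bs" if "A \<in> set As" "B \<in> set Bs" for A B
  proof (rule key[OF is_kraus_comp[OF \<psi> T]])
    show "A * B \<in> set (concat (map (\<lambda>A. map (\<lambda>B. B * A) As) Bs))" using that by auto
    fix X :: "complex mat" and i j assume X: "X \<in> carrier_mat m m" and ij: "i < m" "j < m"
    show "(\<lambda>N. (\<Sum>n=1..N. (T ^^ Suc n) X $$ (i,j) / complex_of_real (D n)) / of_nat N) \<longlonglongrightarrow> (\<psi> \<circ> T) X $$ (i,j)"
      using lim[OF Tc[OF X] ij] by (simp add: funpow_swap1)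
  qed
  \<comment> \<open>The two-sided multipliers of the span form an algebra, so it suffices to place
    the generators \<open>As\<close> in it.\<close>
  define S where "S = {Y \<in> carrier_mat m m. \<forall>Z\<in>mspan m Bs. Y * Z \<in> mspan m Bs \<and> Z * Y \<in> mspan m Bs}"
  have spc: "mspan m Bs \<subseteq> carrier_mat m m" using V by (simp add: msubspace_def)
  have addV: "X + Y \<in> mspan m Bs" if "X \<in> mspan m Bs" "Y \<in> mspan m Bs" for X Y
  proof -
    have "1 \<cdot>\<^sub>m X + 1 \<cdot>\<^sub>m Y \<in> mspan m Bs" using V that unfolding msubspace_def by blast
    thus ?thesis by (simp add: smult_one_mat)
  qed
  have zeroV: "0\<^sub>m m m \<in> mspan m Bs" using V by (simp add: msubspace_def)
  have "subalg m S" unfolding subalg_def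
  proof (intro conjI ballI allI)
    show "0\<^sub>m m m \<in> S" unfolding S_def
    proof (intro CollectI conjI ballI)
      fix Z assume "Z \<in> mspan m Bs"
      hence "Z \<in> carrier_mat m m" using spc by auto
      thus "0\<^sub>m m m * Z \<in> mspan m Bs" "Z * 0\<^sub>m m m \<in> mspan m Bs" using zeroV by auto
    qed auto
    fix X Y assume X: "X \<in> S" and Y: "Y \<in> S"
    have c: "X \<in> carrier_mat m m" "Y \<in> carrier_mat m m" using X Y by (auto simp: S_def)
    show "X + Y \<in> S" unfolding S_def
    proof (intro CollectI conjI ballI)
      fix Z assume Z: "Z \<in> mspan m Bs"
      hence Zc: "Z \<in> carrier_mat m m" using spc by auto
      show "(X + Y) * Z \<in> mspan m Bs" "Z * (X + Y) \<in> mspan m Bs"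
        unfolding add_mult_distrib_mat[OF c Zc] mult_add_distrib_mat[OF Zc c]
        using X Y Z by (auto simp: S_def intro: addV)
    qed (use c in auto)
    show "X * Y \<in> S" unfolding S_def
    proof (intro CollectI conjI ballI)
      fix Z assume Z: "Z \<in> mspan m Bs"
      hence Zc: "Z \<in> carrier_mat m m" using spc by auto
      show "X * Y * Z \<in> mspan m Bs" "Z * (X * Y) \<in> mspan m Bs"
        unfolding assoc_mult_mat[OF c Zc] assoc_mult_mat[OF Zc c, symmetric]
        using X Y Z by (auto simp: S_def)
    qed (use c in auto)
  next
    fix a X assume X: "X \<in> S"
    have c: "X \<in> carrier_mat m m" using X by (auto simp: S_def)
    show "a \<cdot>\<^sub>m X \<in> S" unfolding S_def
    proof (intro CollectI conjI ballI)
      fix Z assume Z: "Z \<in> mspan m Bs"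
      hence Zc: "Z \<in> carrier_mat m m" using spc by auto
      show "a \<cdot>\<^sub>m X * Z \<in> mspan m Bs" "Z * (a \<cdot>\<^sub>m X) \<in> mspan m Bs"
        unfolding mult_smult_assoc_mat[OF c Zc] mult_smult_distrib[OF Zc c]
        using X Z by (auto simp: S_def intro: smult_mem[OF V])
    qed (use c in auto)
  qed (auto simp: S_def)
  moreover have "set As \<subseteq> S"
  proof
    fix A assume A: "A \<in> set As"
    hence Ac: "A \<in> carrier_mat m m" using As by auto
    \<comment> \<open>For fixed \<open>A\<close> the condition is linear in \<open>Z\<close>, so it
      passes from the products with \<open>Bs\<close> to the whole span.\<close>
    let ?Z = "{Z \<in> carrier_mat m m. A * Z \<in> mspan m Bs \<and> Z * A \<in> mspan m Bs}"
    have "msubspace m ?Z" unfolding msubspace_def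
    proof (intro conjI ballI allI)
      show "0\<^sub>m m m \<in> ?Z" using Ac zeroV by auto
      fix X Y a b assume X: "X \<in> ?Z" and Y: "Y \<in> ?Z"
      have c: "X \<in> carrier_mat m m" "Y \<in> carrier_mat m m" using X Y by auto
      have c': "a \<cdot>\<^sub>m X \<in> carrier_mat m m" "b \<cdot>\<^sub>m Y \<in> carrier_mat m m" using c by auto
      show "a \<cdot>\<^sub>m X + b \<cdot>\<^sub>m Y \<in> ?Z"
      proof (intro CollectI conjI)
        show "A * (a \<cdot>\<^sub>m X + b \<cdot>\<^sub>m Y) \<in> mspan m Bs" "(a \<cdot>\<^sub>m X + b \<cdot>\<^sub>m Y) * A \<in> mspan m Bs"
          unfolding add_mult_distrib_mat[OF c' Ac] mult_add_distrib_mat[OF Ac c']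
            mult_smult_assoc_mat[OF c(1) Ac] mult_smult_distrib[OF Ac c(1)]
            mult_smult_assoc_mat[OF c(2) Ac] mult_smult_distrib[OF Ac c(2)]
          using X Y by (auto intro!: addV smult_mem[OF V])
      qed (use c in auto)
    qed auto
    from mspan_least[OF this, of Bs] AB[OF A] BA[OF A] Bs have "mspan m Bs \<subseteq> ?Z" by auto
    thus "A \<in> S" using Ac by (auto simp: S_def)
  qed
  ultimately have "gen_alg m As \<subseteq> S" by (rule gen_alg_least)
  thus "is_ideal m (mspan m Bs) (gen_alg m As)" unfolding is_ideal_def
    using sub zeroV addV smult_mem[OF V] by (auto simp: S_def)
qed

text \<open>A zero span would make the Choi trace of \<open>\<psi>\<close> vanish. But that trace is
  the limit of the means of the normalised traces of the powers, each with real part at least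
  \<open>1 / C\<close> since \<open>D n\<close> is the norm of the power.\<close>

lemma kraus_nonzero:
  assumes T: "is_kraus m T As" and \<psi>: "is_kraus m \<psi> Bs"
    and D: "\<And>n. D n > 0"
    and lim: "\<And>X i j. X \<in> carrier_mat m m \<Longrightarrow> i < m \<Longrightarrow> j < m \<Longrightarrow>
       (\<lambda>N. (\<Sum>n=1..N. (T ^^ n) X $$ (i,j) / complex_of_real (D n)) / of_nat N) \<longlonglongrightarrow> \<psi> X $$ (i,j)"
    and \<gamma>: "is_basis m (carrier_mat m m) \<gamma>" "\<gamma> \<noteq> []"
    and Dn: "\<And>n. n \<ge> 1 \<Longrightarrow> D n = beta_norm m \<gamma> (T ^^ n)"
  shows "mspan m Bs \<noteq> {0\<^sub>m m m}"
proof
  assume span0: "mspan m Bs = {0\<^sub>m m m}"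
  have As: "set As \<subseteq> carrier_mat m m" and Bs: "set Bs \<subseteq> carrier_mat m m"
    using T \<psi> by (auto simp: is_kraus_def)
  have B0: "B = 0\<^sub>m m m" if "B \<in> set Bs" for B using set_subset_mspan[OF Bs] span0 that by auto
  have "choi_trace m \<psi> = 0"
  proof -
    have "(\<Sum>x\<in>pos m. (cmod (B $$ x))\<^sup>2) = 0" if "B \<in> set Bs" for B
      unfolding B0[OF that] by (rule sum.neutral) auto
    hence "(\<Sum>B\<leftarrow>Bs. \<Sum>x\<in>pos m. (cmod (B $$ x))\<^sup>2) = (\<Sum>B\<leftarrow>Bs. 0)" by (intro arg_cong[of _ _ sum_list] map_cong) auto
    thus ?thesis unfolding choi_trace_kraus[OF \<psi>] by simp
  qed
  moreover have "(\<lambda>N. (\<Sum>n=1..N. (\<Sum>x\<in>pos m. 1 * (T ^^ n) (unitm m (fst x) (fst x)) $$ (snd x, snd x)) / complex_of_real (D n)) / of_nat N)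
     \<longlonglongrightarrow> (\<Sum>x\<in>pos m. 1 * \<psi> (unitm m (fst x) (fst x)) $$ (snd x, snd x))"
    by (rule cesaro_sum) (use lim in auto)
  ultimately have lim0: "(\<lambda>N. (\<Sum>n=1..N. choi_trace m (T ^^ n) / complex_of_real (D n)) / of_nat N) \<longlonglongrightarrow> 0"
    by (simp add: choi_trace_def)
  obtain C where C: "C > 0" "\<And>F As. is_kraus m F As \<Longrightarrow> beta_norm m \<gamma> F \<le> C * Re (choi_trace m F)"
    using beta_norm_le_choi_trace[OF \<gamma>] by blast
  have low: "1 / C \<le> Re (choi_trace m (T ^^ n) / complex_of_real (D n))" if "n \<ge> 1" for n
  proof -
    from that obtain n' where n': "n = Suc n'" by (cases n) auto
    obtain Ws where "is_kraus m (T ^^ n) Ws" using kraus_funpow[OF T subalg_gen_alg[OF As], of n'] n' by blast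
    from C(2)[OF this] have "D n \<le> C * Re (choi_trace m (T ^^ n))" using Dn[OF that] by simp
    thus ?thesis using C(1) D[of n] by (simp add: field_simps)
  qed
  have "(\<lambda>N. Re ((\<Sum>n=1..N. choi_trace m (T ^^ n) / complex_of_real (D n)) / of_nat N)) \<longlonglongrightarrow> 0"
    using tendsto_Re[OF lim0] by simp
  moreover have "1 / C \<le> Re ((\<Sum>n=1..N. choi_trace m (T ^^ n) / complex_of_real (D n)) / of_nat N)" if N: "N \<ge> 1" for N
  proof -
    have "real N * (1 / C) = (\<Sum>n=1..N. 1 / C)" by simp
    also have "\<dots> \<le> (\<Sum>n=1..N. Re (choi_trace m (T ^^ n) / complex_of_real (D n)))"
      by (rule sum_mono) (use low in auto)
    finally have "real N * (1 / C) \<le> Re (\<Sum>n=1..N. choi_trace m (T ^^ n) / complex_of_real (D n))" by simp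
    moreover have "Re (z / of_nat N) = Re z / real N" for z using Re_divide_of_real[of z "real N"] by simp
    ultimately show ?thesis using N by (simp only:) (simp add: field_simps)
  qed
  ultimately have "1 / C \<le> 0" by (intro LIMSEQ_le_const) auto
  with C(1) show False by (simp add: field_simps)
qed

theorem theorem5p15:
  fixes ns :: "nat list" and m :: nat and \<tau> :: "complex mat \<Rightarrow> complex mat"
  assumes ns: "ns \<noteq> []" "\<forall>n\<in>set ns. 0 < n"
    and m: "m = sum_list ns"
    and cp: "completely_positive_on m (block_alg ns) \<tau>"
    and r: "map_spectral_radius (block_alg ns) \<tau> > 0"
  shows "(\<forall>X\<in>carrier_mat m m.
            can_ext ns (maximal_part m (block_alg ns) \<tau>) X
            = maximal_part m (carrier_mat m m) (can_ext ns \<tau>) X)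
      \<and> (\<forall>As Bs. is_kraus m (can_ext ns \<tau>) As
              \<longrightarrow> is_kraus m (can_ext ns (maximal_part m (block_alg ns) \<tau>)) Bs
              \<longrightarrow> subalg m (mspan m Bs)
                \<and> is_ideal m (mspan m Bs) (gen_alg m As)
                \<and> mspan m Bs \<noteq> {0\<^sub>m m m})"
proof -
  let ?T = "can_ext ns \<tau>" and ?\<psi> = "can_ext ns (maximal_part m (block_alg ns) \<tau>)"
  have lin: "linear_on m (block_alg ns) \<tau>" using cp by (simp add: completely_positive_on_def)
  show ?thesis
  proof (rule can_ext_maximal_part[OF ns m lin r])
    fix D :: "nat \<Rightarrow> real" and K :: real and \<gamma>
    assume D: "\<And>n. D n > 0" and K: "K > 0" "\<And>n. D (Suc n) \<le> K * D n"
      and lim: "\<And>X i j. X \<in> carrier_mat m m \<Longrightarrow> i < m \<Longrightarrow> j < m \<Longrightarrow>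
         (\<lambda>N. (\<Sum>n=1..N. (?T ^^ n) X $$ (i,j) / complex_of_real (D n)) / of_nat N) \<longlonglongrightarrow> ?\<psi> X $$ (i,j)"
      and eq: "\<And>X. X \<in> carrier_mat m m \<Longrightarrow> ?\<psi> X = maximal_part m (carrier_mat m m) ?T X"
      and \<gamma>: "is_basis m (carrier_mat m m) \<gamma>"
      and Dn: "\<And>n. n \<ge> 1 \<Longrightarrow> D n = beta_norm m \<gamma> (?T ^^ n)" and \<gamma>ne: "\<gamma> \<noteq> []"
    show ?thesis
    proof (intro conjI allI impI ballI)
      fix X :: "complex mat" assume "X \<in> carrier_mat m m"
      thus "?\<psi> X = maximal_part m (carrier_mat m m) ?T X" by (rule eq)
    next
      fix As Bs assume T: "is_kraus m ?T As" and \<psi>: "is_kraus m ?\<psi> Bs"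
      note ideal = kraus_ideal[OF T \<psi> D K lim]
      show "is_ideal m (mspan m Bs) (gen_alg m As)" by (rule ideal(2))
      show "mspan m Bs \<noteq> {0\<^sub>m m m}" by (rule kraus_nonzero[OF T \<psi> D lim \<gamma> \<gamma>ne Dn])
      have "mspan m Bs \<subseteq> carrier_mat m m"
        using msubspace_mspan[of Bs m] \<psi> by (auto simp: is_kraus_def msubspace_def)
      \<comment> \<open>Closure under products follows from the ideal property, since the span lies
        inside the generated algebra.\<close>
      thus "subalg m (mspan m Bs)" using ideal unfolding is_ideal_def subalg_def by blast
    qed
  qed
qed

end
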